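(* Let $\psi:\Sigma\to\mathbb{S}^3$ be an isometric immersion in $\mathbb{S}^3$, with positive extrinsic curvature $K$, and Gauss map $g:\Sigma\to\mathbb{C}\cup\{\infty\}$. Then $K$ is a positive constant if, and only if, $g$ is a harmonic map (into the Riemann sphere) for the conformal structure induced by the second fundamental form.
   Context: $\mathbb{S}^3$ is the unit 3-sphere with its Lie group structure and canonical (bi-invariant) metric, with a left invariant positively oriented orthonormal frame $E_i(q)$, $E_i=E_i(e)$, satisfying $[E_2,E_3]=2E_1$, $[E_3,E_1]=2E_2$, $[E_1,E_2]=2E_3$. The extrinsic curvature $K$ is the determinant of the shape operator. Since $K>0$, $N$ denotes the global unit normal for which the second fundamental form $\langle -dN,d\psi\rangle$ is positive definite. With $N_i=\langle N,E_i(\psi)\rangle$, the Gauss map is $g=\frac{N_1+iN_2}{1-N_3}$. Harmonicity of $g$ into the Riemann sphere $\mathbb S^2$ means, for conformal parameters $z$ of the second fundamental form, $g_{z\overline z}-\frac{2\overline g}{1+|g|^2}g_zg_{\overline z}=0$ (where $g\ne\infty$). *)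

theory Defs
  imports "HOL-Analysis.Analysis"
begin

section \<open>Smooth surfaces\<close>

primrec times_differentiable_on ::
    "nat \<Rightarrow> complex set \<Rightarrow> (complex \<Rightarrow> 'b::real_normed_vector) \<Rightarrow> bool" where
  "times_differentiable_on 0 D f \<longleftrightarrow> continuous_on D f"
| "times_differentiable_on (Suc k) D f \<longleftrightarrow>
     (\<forall>z\<in>D. f differentiable (at z)) \<and>
     (\<forall>v. times_differentiable_on k D (\<lambda>z. frechet_derivative f (at z) v))"

text \<open>Class \<open>C\<close>-infinity in the real sense; meant for open \<open>D\<close>.\<close>

definition smooth_on :: "complex set \<Rightarrow> (complex \<Rightarrow> 'b::real_normed_vector) \<Rightarrow> bool" where
  "smooth_on D f \<longleftrightarrow> (\<forall>k. times_differentiable_on k D f)"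

text \<open>A chart is a coordinate domain together with a coordinate map. The parameter plane
  is \<open>complex\<close>, seen as the Euclidean plane; no complex structure is implied.\<close>

type_synonym 'a chart = "'a set \<times> ('a \<Rightarrow> complex)"

definition chart_image :: "'a chart \<Rightarrow> complex set" where
  "chart_image c = snd c ` fst c"

definition in_chart :: "'a chart \<Rightarrow> ('a \<Rightarrow> 'b) \<Rightarrow> complex \<Rightarrow> 'b" where
  "in_chart c f = f \<circ> inv_into (fst c) (snd c)"

definition is_chart :: "'a::topological_space chart \<Rightarrow> bool" where
  "is_chart c \<longleftrightarrow> open (fst c) \<and> open (chart_image c) \<and>
     homeomorphism (fst c) (chart_image c) (snd c) (inv_into (fst c) (snd c))"

definition smooth_transition :: "'a chart \<Rightarrow> 'a chart \<Rightarrow> bool" where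
  "smooth_transition c d \<longleftrightarrow> smooth_on (snd c ` (fst c \<inter> fst d)) (in_chart c (snd d))"

text \<open>The surface is the whole (Hausdorff, second countable) type \<open>'a\<close>.\<close>

definition smooth_surface ::
    "'a::{t2_space,second_countable_topology} chart set \<Rightarrow> bool" where
  "smooth_surface A \<longleftrightarrow> connected (UNIV :: 'a set) \<and> (\<Union>c\<in>A. fst c) = UNIV \<and>
     (\<forall>c\<in>A. is_chart c) \<and> (\<forall>c\<in>A. \<forall>d\<in>A. smooth_transition c d)"

text \<open>Membership in the maximal atlas generated by \<open>A\<close>.\<close>

definition compatible_chart :: "'a::topological_space chart set \<Rightarrow> 'a chart \<Rightarrow> bool" where
  "compatible_chart A c \<longleftrightarrow> is_chart c \<and>
     (\<forall>d\<in>A. smooth_transition c d \<and> smooth_transition d c)"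

text \<open>A metric is given by its expression \<open>m c z u v\<close> in each chart \<open>c\<close> of the atlas.\<close>

definition riemannian_metric ::
    "'a chart set \<Rightarrow> ('a chart \<Rightarrow> complex \<Rightarrow> complex \<Rightarrow> complex \<Rightarrow> real) \<Rightarrow> bool" where
  "riemannian_metric A m \<longleftrightarrow>
     (\<forall>c\<in>A. (\<forall>z\<in>chart_image c. bilinear (m c z) \<and> (\<forall>u v. m c z u v = m c z v u) \<and>
                                  (\<forall>v. v \<noteq> 0 \<longrightarrow> m c z v v > 0)) \<and>
             (\<forall>u v. smooth_on (chart_image c) (\<lambda>z. m c z u v))) \<and>
     (\<forall>c\<in>A. \<forall>d\<in>A. \<forall>p \<in> fst c \<inter> fst d. \<forall>u v.
        let T = frechet_derivative (in_chart c (snd d)) (at (snd c p))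
        in m c (snd c p) u v = m d (snd d p) (T u) (T v))"

section \<open>The Lie group \<open>S\<^sup>3\<close>\<close>

text \<open>The quaternion \<open>a + b j\<close> with complex \<open>a\<close>, \<open>b\<close> is the pair \<open>(a, b)\<close>. The inner
  product and norm of the product type are the Euclidean ones of \<open>R\<^sup>4\<close>.\<close>

type_synonym quat = "complex \<times> complex"

definition qone :: quat where
  "qone = (1, 0)"

definition qmult :: "quat \<Rightarrow> quat \<Rightarrow> quat" where
  "qmult p q = (fst p * fst q - snd p * cnj (snd q), fst p * snd q + snd p * cnj (fst q))"

definition S3 :: "quat set" where
  "S3 = sphere 0 1"

text \<open>The left invariant field with value \<open>e\<close> at the identity, extended linearly to \<open>R\<^sup>4\<close>.\<close>

definition left_field :: "quat \<Rightarrow> quat \<Rightarrow> quat" where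
  "left_field e q = qmult q e"

text \<open>The bracket of vector fields on \<open>R\<^sup>4\<close>; at points of \<open>S3\<close> it agrees with the bracket
  on the sphere when both fields are tangent to the sphere along it.\<close>

definition lie_bracket :: "(quat \<Rightarrow> quat) \<Rightarrow> (quat \<Rightarrow> quat) \<Rightarrow> quat \<Rightarrow> quat" where
  "lie_bracket X Y q = frechet_derivative Y (at q) (X q) - frechet_derivative X (at q) (Y q)"

text \<open>The orientation of \<open>S\<^sup>3\<close> is fixed by the bracket relations.\<close>

definition left_invariant_frame :: "quat \<Rightarrow> quat \<Rightarrow> quat \<Rightarrow> bool" where
  "left_invariant_frame e1 e2 e3 \<longleftrightarrow>
     e1 \<bullet> qone = 0 \<and> e2 \<bullet> qone = 0 \<and> e3 \<bullet> qone = 0 \<and>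
     (\<forall>q\<in>S3. let E1 = left_field e1; E2 = left_field e2; E3 = left_field e3 in
        norm (E1 q) = 1 \<and> norm (E2 q) = 1 \<and> norm (E3 q) = 1 \<and>
        E1 q \<bullet> E2 q = 0 \<and> E2 q \<bullet> E3 q = 0 \<and> E3 q \<bullet> E1 q = 0 \<and>
        lie_bracket E2 E3 q = 2 *\<^sub>R E1 q \<and>
        lie_bracket E3 E1 q = 2 *\<^sub>R E2 q \<and>
        lie_bracket E1 E2 q = 2 *\<^sub>R E3 q)"

section \<open>Immersed surfaces in \<open>S\<^sup>3\<close>\<close>

definition immersion_S3 :: "'a chart set \<Rightarrow> ('a \<Rightarrow> quat) \<Rightarrow> bool" where
  "immersion_S3 A \<psi> \<longleftrightarrow> range \<psi> \<subseteq> S3 \<and>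
     (\<forall>c\<in>A. smooth_on (chart_image c) (in_chart c \<psi>) \<and>
        (\<forall>z\<in>chart_image c. inj (frechet_derivative (in_chart c \<psi>) (at z))))"

definition isometric_immersion_S3 ::
    "'a chart set \<Rightarrow> ('a chart \<Rightarrow> complex \<Rightarrow> complex \<Rightarrow> complex \<Rightarrow> real) \<Rightarrow> ('a \<Rightarrow> quat) \<Rightarrow> bool" where
  "isometric_immersion_S3 A m \<psi> \<longleftrightarrow> immersion_S3 A \<psi> \<and>
     (\<forall>c\<in>A. \<forall>z\<in>chart_image c. \<forall>u v.
        frechet_derivative (in_chart c \<psi>) (at z) u \<bullet> frechet_derivative (in_chart c \<psi>) (at z) v
          = m c z u v)"

text \<open>Unit normal of the surface in \<open>S\<^sup>3\<close> (so also orthogonal to the position vector) over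
  the domain of one chart; the values of \<open>n\<close> elsewhere are irrelevant.\<close>

definition unit_normal_on :: "'a chart \<Rightarrow> ('a \<Rightarrow> quat) \<Rightarrow> ('a \<Rightarrow> quat) \<Rightarrow> bool" where
  "unit_normal_on c \<psi> n \<longleftrightarrow> smooth_on (chart_image c) (in_chart c n) \<and>
     (\<forall>z\<in>chart_image c. norm (in_chart c n z) = 1 \<and> in_chart c n z \<bullet> in_chart c \<psi> z = 0 \<and>
        (\<forall>v. in_chart c n z \<bullet> frechet_derivative (in_chart c \<psi>) (at z) v = 0))"

text \<open>The derivative of a unit normal \<open>n\<close> in \<open>R\<^sup>4\<close> is orthogonal to \<open>n\<close> and to \<open>\<psi>\<close>, so it
  equals the covariant derivative in \<open>S\<^sup>3\<close> and is tangent to the surface.\<close>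

definition shape_operator ::
    "'a chart \<Rightarrow> ('a \<Rightarrow> quat) \<Rightarrow> ('a \<Rightarrow> quat) \<Rightarrow> complex \<Rightarrow> complex \<Rightarrow> complex" where
  "shape_operator c \<psi> n z v =
     (THE w. frechet_derivative (in_chart c \<psi>) (at z) w = - frechet_derivative (in_chart c n) (at z) v)"

definition second_form ::
    "'a chart \<Rightarrow> ('a \<Rightarrow> quat) \<Rightarrow> ('a \<Rightarrow> quat) \<Rightarrow> complex \<Rightarrow> complex \<Rightarrow> complex \<Rightarrow> real" where
  "second_form c \<psi> n z u v =
     (- frechet_derivative (in_chart c n) (at z) u) \<bullet> frechet_derivative (in_chart c \<psi>) (at z) v"

text \<open>Determinant of a real linear endomorphism of the plane, in the basis \<open>1\<close>, \<open>\<i>\<close>.\<close>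

definition plane_det :: "(complex \<Rightarrow> complex) \<Rightarrow> real" where
  "plane_det L = det (vector [vector [Re (L 1), Re (L \<i>)],
                              vector [Im (L 1), Im (L \<i>)]] :: real^2^2)"

text \<open>The value depends neither on the chart nor on the choice of the local unit normal, as
  changing the sign of \<open>n\<close> does not change a \<open>2 \<times> 2\<close> determinant.\<close>

definition extrinsic_curvature :: "'a chart set \<Rightarrow> ('a \<Rightarrow> quat) \<Rightarrow> 'a \<Rightarrow> real" where
  "extrinsic_curvature A \<psi> p =
     (THE k. \<exists>c\<in>A. \<exists>n. p \<in> fst c \<and> unit_normal_on c \<psi> n \<and>
        k = plane_det (shape_operator c \<psi> n (snd c p)))"

text \<open>The global unit normal making the second fundamental form positive definite; it exists
  and is unique when the extrinsic curvature is positive.\<close>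

definition positive_normal :: "'a chart set \<Rightarrow> ('a \<Rightarrow> quat) \<Rightarrow> 'a \<Rightarrow> quat" where
  "positive_normal A \<psi> =
     (THE N. \<forall>c\<in>A. unit_normal_on c \<psi> N \<and>
        (\<forall>z\<in>chart_image c. \<forall>v. v \<noteq> 0 \<longrightarrow> second_form c \<psi> N z v v > 0))"

text \<open>The conformal parameters of the second fundamental form: the charts of the surface in
  which it is \<open>\<rho> \<bar>dz\<bar>\<^sup>2\<close>. Both orientations are admitted; the harmonicity equation
  below is unchanged when \<open>z\<close> is replaced by its conjugate.\<close>

definition conformal_charts ::
    "'a::topological_space chart set \<Rightarrow> ('a \<Rightarrow> quat) \<Rightarrow> ('a \<Rightarrow> quat) \<Rightarrow> 'a chart set" where
  "conformal_charts A \<psi> N =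
     {c. compatible_chart A c \<and>
         (\<forall>z\<in>chart_image c. \<exists>\<rho>>0. \<forall>u v. second_form c \<psi> N z u v = \<rho> * (u \<bullet> v))}"

section \<open>Gauss map and harmonicity\<close>

text \<open>The Riemann sphere, \<open>None\<close> being the point at infinity.\<close>

type_synonym riemann_sphere = "complex option"

fun sphere_inversion :: "riemann_sphere \<Rightarrow> riemann_sphere" where
  "sphere_inversion None = Some 0"
| "sphere_inversion (Some w) = (if w = 0 then None else Some (1 / w))"

definition gauss_map ::
    "quat \<Rightarrow> quat \<Rightarrow> quat \<Rightarrow> ('a \<Rightarrow> quat) \<Rightarrow> ('a \<Rightarrow> quat) \<Rightarrow> 'a \<Rightarrow> riemann_sphere" where
  "gauss_map e1 e2 e3 \<psi> N p =
     (let N1 = N p \<bullet> left_field e1 (\<psi> p);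
          N2 = N p \<bullet> left_field e2 (\<psi> p);
          N3 = N p \<bullet> left_field e3 (\<psi> p)
      in if N3 = 1 then None
         else Some ((of_real N1 + \<i> * of_real N2) / (1 - of_real N3)))"

definition deriv_z :: "(complex \<Rightarrow> complex) \<Rightarrow> complex \<Rightarrow> complex" where
  "deriv_z f z = (frechet_derivative f (at z) 1 - \<i> * frechet_derivative f (at z) \<i>) / 2"

definition deriv_zbar :: "(complex \<Rightarrow> complex) \<Rightarrow> complex \<Rightarrow> complex" where
  "deriv_zbar f z = (frechet_derivative f (at z) 1 + \<i> * frechet_derivative f (at z) \<i>) / 2"

definition harmonic_equation :: "(complex \<Rightarrow> complex) \<Rightarrow> complex \<Rightarrow> bool" where
  "harmonic_equation f z \<longleftrightarrow>
     deriv_zbar (deriv_z f) z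
       - 2 * cnj (f z) / (1 + of_real ((cmod (f z))\<^sup>2)) * deriv_z f z * deriv_zbar f z = 0"

text \<open>A smooth map into the sphere that satisfies the equation in every conformal parameter
  and in both affine coordinates of the sphere, \<open>g\<close> (where \<open>g \<noteq> \<infinity>\<close>) and \<open>1/g\<close> (where
  \<open>g \<noteq> 0\<close>). Inversion is an isometry of the sphere, so the two equations agree where
  both coordinates are finite; the second one covers the points where \<open>g = \<infinity>\<close>.\<close>

definition harmonic_to_sphere :: "'a chart set \<Rightarrow> ('a \<Rightarrow> riemann_sphere) \<Rightarrow> bool" where
  "harmonic_to_sphere C g \<longleftrightarrow>
     (\<forall>c\<in>C. \<forall>s \<in> {id, sphere_inversion}.
        let D = {z \<in> chart_image c. s (in_chart c g z) \<noteq> None};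
            f = (\<lambda>z. the (s (in_chart c g z)))
        in open D \<and> smooth_on D f \<and> (\<forall>z\<in>D. harmonic_equation f z))"

end

theory Submission
  imports Defs
begin

text \<open>
  In a conformal parameter of the second fundamental form, let \<open>X\<close> be the immersion, \<open>n\<close> the unit
  normal and \<open>\<rho>\<close> the conformal factor. The Codazzi equations give
  \<open>\<langle>\<Delta>n, X\<^sub>b\<rangle> = - \<langle>n\<^sub>b, \<Delta>X\<rangle>\<close> and \<open>2 K \<langle>n\<^sub>b, \<Delta>X\<rangle> = \<rho> K\<^sub>b\<close>. Left translating \<open>n\<close> to the
  identity gives the Gauss map as a map into the unit sphere of \<open>R\<^sup>3\<close>, and if \<open>w\<close> denotes the
  coordinates of the tangential part of \<open>\<Delta>X\<close>, then the tangential part of its Laplacian is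
  \<open>\<rho> w\<close> plus a multiple of \<open>w\<close> rotated by a right angle. It vanishes exactly if \<open>w = 0\<close>, that is,
  if \<open>K\<close> is critical, and stereographic projection turns this into the harmonic map equation.

  That harmonicity implies constancy of \<open>K\<close> requires conformal parameters near every point, that is,
  smooth isothermal coordinates for the second form. They solve a Beltrami equation
  \<open>w\<^bsub>zbar\<^esub> = \<mu> w\<^sub>z\<close>. After freezing \<open>\<mu>\<close> at the point and zooming in, \<open>\<mu> - \<mu>(p)\<close> is a smooth
  function on a torus with small absolutely convergent Fourier series. Inverting the constant
  coefficient operator multiplies Fourier coefficients by bounded factors, so the Neumann series
  converges in the Wiener algebra; with the weights \<open>(1 + \<epsilon> \<bar>N\<bar>)\<^sup>k\<close>, \<open>\<epsilon>\<close> small, the same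
  series converges for every \<open>k\<close>, which makes the solution smooth.
\<close>

section \<open>Calculus of smooth maps\<close>

text \<open>Without a conformal chart around each point \<open>harmonic_to_sphere\<close> would say
  nothing there, so the converse rests on the existence of smooth isothermal coordinates. The
  Neumann series is indexed by all finite lists of frequencies: one list is one exponential, equal
  frequencies are never merged, and no convolution algebra has to be set up. On the exponential of
  frequency M the z-derivative acts as i cnj M / 2 and the zbar-derivative as i M / 2; this is the
  source of the bounded factors. Frequency zero cannot be inverted and is absorbed in a multiple of
  zbar. The coefficient sum is kept below (1 - |\<mu>(p)|) / 2, not just below 1 - |\<mu>(p)|, so
  that the z-derivative does not vanish at the point and the solution can serve as a coordinate. The
  torus is reached by composing \<mu> with a smooth periodic map that is the identity near the
  origin. The geometry is pointwise: quaternion multiplication compares the tangent spaces of the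
  sphere, and the volume form written with it is alternating, which kills the mixed terms in the
  Laplacian of the Gauss map.\<close>

abbreviation dd :: "(complex \<Rightarrow> 'b::real_normed_vector) \<Rightarrow> complex \<Rightarrow> complex \<Rightarrow> 'b" where
  "dd f v \<equiv> (\<lambda>z. frechet_derivative f (at z) v)"

text \<open>No differentiability is required: \<open>frechet_derivative\<close> is a choice among
  the derivatives of a function, and both functions have the same ones at z.\<close>

lemma frechet_derivative_cong_open:
  assumes "open D" "z \<in> D" "\<And>x. x \<in> D \<Longrightarrow> f x = g x"
  shows "frechet_derivative f (at z) = frechet_derivative g (at z)"
proof -
  have "(f has_derivative f') (at z) \<longleftrightarrow> (g has_derivative f') (at z)" for f'
    using has_derivative_transform_within_open[of f f' z UNIV D g]
      has_derivative_transform_within_open[of g f' z UNIV D f] assms by auto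
  then show ?thesis by (simp add: frechet_derivative_def)
qed

lemma differentiable_cong_open:
  assumes "open D" "z \<in> D" "\<And>x. x \<in> D \<Longrightarrow> f x = g x" "f differentiable (at z)"
  shows "g differentiable (at z)"
  using assms has_derivative_transform_within_open[of f _ z UNIV D g]
  unfolding differentiable_def by blast

lemma times_differentiable_on_cong:
  assumes "open D" "\<And>x. x \<in> D \<Longrightarrow> f x = g x" "times_differentiable_on k D f"
  shows "times_differentiable_on k D g"
  using assms(2,3)
proof (induction k arbitrary: f g)
  case 0
  then show ?case by (simp cong: continuous_on_cong)
next
  case (Suc k)
  show ?case
    unfolding times_differentiable_on.simps
  proof safe
    show "g differentiable at z" if "z \<in> D" for z
      by (rule differentiable_cong_open[of D z f]) (use Suc that assms(1) in auto)
    show "times_differentiable_on k D (dd g v)" for v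
    proof (rule Suc.IH[of "dd f v"])
      show "frechet_derivative f (at x) v = frechet_derivative g (at x) v" if "x \<in> D" for x
        using frechet_derivative_cong_open[OF assms(1) that Suc.prems(1)] by simp
      show "times_differentiable_on k D (dd f v)" using Suc.prems(2) by simp
    qed
  qed
qed

lemma times_differentiable_on_SucD:
  assumes "times_differentiable_on (Suc k) D f"
  shows "times_differentiable_on k D f"
  using assms
proof (induction k arbitrary: f)
  case 0
  then show ?case
    by (auto intro!: differentiable_imp_continuous_on differentiable_at_imp_differentiable_on)
next
  case (Suc k)
  then show ?case by (metis times_differentiable_on.simps(2))
qed

text \<open>Lets a derivative in closed form stand in for the chosen one. All closure properties
  below are inductions through this rule.\<close>

lemma times_differentiable_on_SucI:
  assumes "open D" "\<And>z. z \<in> D \<Longrightarrow> (f has_derivative f' z) (at z)"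
    and "\<And>v. times_differentiable_on k D (\<lambda>z. f' z v)"
  shows "times_differentiable_on (Suc k) D f"
  unfolding times_differentiable_on.simps
proof safe
  show "f differentiable at z" if "z \<in> D" for z
    using assms(2)[OF that] by (auto simp: differentiable_def)
  show "times_differentiable_on k D (dd f v)" for v
    by (rule times_differentiable_on_cong[OF assms(1) _ assms(3)[of v]])
      (use frechet_derivative_at[OF assms(2)] in auto)
qed

lemma times_differentiable_on_has_derivative:
  assumes "times_differentiable_on (Suc k) D f" "z \<in> D"
  shows "(f has_derivative frechet_derivative f (at z)) (at z)"
  using assms by (simp add: frechet_derivative_works)

lemma times_differentiable_on_subset:
  assumes "times_differentiable_on k D f" "E \<subseteq> D"
  shows "times_differentiable_on k E f"
  using assms by (induction k arbitrary: f) (auto intro: continuous_on_subset)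

lemma times_differentiable_on_local:
  assumes "\<And>z. z \<in> D \<Longrightarrow> \<exists>E. open E \<and> z \<in> E \<and> times_differentiable_on k E f"
  shows "times_differentiable_on k D f"
  using assms
proof (induction k arbitrary: f)
  case 0
  have "\<And>z. z \<in> D \<Longrightarrow> isCont f z"
    using "0" continuous_on_eq_continuous_at by auto
  then show ?case by (simp add: continuous_at_imp_continuous_on)
next
  case (Suc k)
  then show ?case by (metis times_differentiable_on.simps(2))
qed

lemma smooth_on_cong:
  assumes "open D" "\<And>x. x \<in> D \<Longrightarrow> f x = g x" "smooth_on D f"
  shows "smooth_on D g"
  using times_differentiable_on_cong[OF assms(1,2)] assms(3) by (simp add: smooth_on_def)

lemma smooth_on_subset: "smooth_on D f \<Longrightarrow> E \<subseteq> D \<Longrightarrow> smooth_on E f"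
  using times_differentiable_on_subset unfolding smooth_on_def by blast

lemma smooth_on_local:
  assumes "\<And>z. z \<in> D \<Longrightarrow> \<exists>E. open E \<and> z \<in> E \<and> smooth_on E f"
  shows "smooth_on D f"
  using times_differentiable_on_local assms unfolding smooth_on_def by meson

lemma smooth_onI:
  assumes "open D" "\<And>z. z \<in> D \<Longrightarrow> (f has_derivative f' z) (at z)"
    and "\<And>v. smooth_on D (\<lambda>z. f' z v)"
  shows "smooth_on D f"
  unfolding smooth_on_def
proof
  fix k show "times_differentiable_on k D f"
    using times_differentiable_on_SucI[OF assms(1,2)] assms(3) times_differentiable_on_SucD
    unfolding smooth_on_def by blast
qed

lemma smooth_on_has_derivative:
  assumes "smooth_on D f" "z \<in> D"
  shows "(f has_derivative frechet_derivative f (at z)) (at z)"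
  using times_differentiable_on_has_derivative assms unfolding smooth_on_def by blast

lemma smooth_on_dd: "smooth_on D f \<Longrightarrow> smooth_on D (dd f v)"
  unfolding smooth_on_def by (metis times_differentiable_on.simps(2))

lemma smooth_on_continuous_on: "smooth_on D f \<Longrightarrow> continuous_on D f"
  unfolding smooth_on_def by (metis times_differentiable_on.simps(1))

lemma dd_expand:
  assumes "(f has_derivative f') (at z)"
  shows "f' v = Re v *\<^sub>R f' 1 + Im v *\<^sub>R f' \<i>"
proof -
  have lin: "linear f'" using assms has_derivative_linear by blast
  have "v = Re v *\<^sub>R 1 + Im v *\<^sub>R \<i>" by (simp add: complex_eq_iff)
  then show ?thesis by (metis lin linear_add linear_scale)
qed

section \<open>Closure of the finite differentiability classes\<close>

lemma times_differentiable_on_const: "times_differentiable_on k D (\<lambda>_. c)"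
  by (induction k arbitrary: c) auto

lemma times_differentiable_on_bounded_linear:
  assumes "bounded_linear L" "open D" "times_differentiable_on k D f"
  shows "times_differentiable_on k D (\<lambda>z. L (f z))"
  using assms(3)
proof (induction k arbitrary: f)
  case 0
  then show ?case using linear_continuous_on[OF assms(1)] by (auto intro: continuous_on_compose2)
next
  case (Suc k)
  show ?case
    by (rule times_differentiable_on_SucI[OF assms(2), where f' = "\<lambda>z v. L (frechet_derivative f (at z) v)"])
      (use Suc bounded_linear.has_derivative[OF assms(1) times_differentiable_on_has_derivative[OF Suc.prems]]
        in auto)
qed

lemma times_differentiable_on_add:
  assumes "open D" "times_differentiable_on k D f" "times_differentiable_on k D g"
  shows "times_differentiable_on k D (\<lambda>z. f z + g z)"
  using assms(2,3)
proof (induction k arbitrary: f g)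
  case 0
  then show ?case by (auto intro: continuous_intros)
next
  case (Suc k)
  show ?case
    by (rule times_differentiable_on_SucI[OF assms(1)], rule has_derivative_add,
        (rule times_differentiable_on_has_derivative[OF Suc.prems(1)], assumption),
        (rule times_differentiable_on_has_derivative[OF Suc.prems(2)], assumption))
      (use Suc in auto)
qed

lemma times_differentiable_on_bilinear:
  assumes "bounded_bilinear B" "open D" "times_differentiable_on k D f" "times_differentiable_on k D g"
  shows "times_differentiable_on k D (\<lambda>z. B (f z) (g z))"
  using assms(3,4)
proof (induction k arbitrary: f g)
  case 0
  then show ?case using bounded_bilinear.continuous_on[OF assms(1)] by auto
next
  case (Suc k)
  show ?case
    by (rule times_differentiable_on_SucI[OF assms(2)], rule bounded_bilinear.FDERIV[OF assms(1)],
        (rule times_differentiable_on_has_derivative[OF Suc.prems(1)], assumption),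
        (rule times_differentiable_on_has_derivative[OF Suc.prems(2)], assumption),
        rule times_differentiable_on_add[OF assms(2)])
      (use Suc.prems in \<open>auto intro!: Suc.IH times_differentiable_on_SucD[OF Suc.prems(1)]
        times_differentiable_on_SucD[OF Suc.prems(2)]\<close>)
qed

text \<open>The derivative is built from \<open>inverse f\<close> itself and the derivative of f, so
  order k for the reciprocal gives order k + 1 without changing f. The square root is treated in the
  same way.\<close>

lemma times_differentiable_on_inverse:
  fixes f :: "complex \<Rightarrow> 'b::real_normed_field"
  assumes "open D" "times_differentiable_on k D f" "\<And>z. z \<in> D \<Longrightarrow> f z \<noteq> 0"
  shows "times_differentiable_on k D (\<lambda>z. inverse (f z))"
  using assms(2)
proof (induction k)
  case 0
  then show ?case using assms(3) by (auto intro!: continuous_intros)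
next
  case (Suc k)
  have "((\<lambda>z. inverse (f z)) has_derivative
      (\<lambda>v. - (inverse (f z) * frechet_derivative f (at z) v * inverse (f z)))) (at z)" if "z \<in> D" for z
    by (rule Deriv.has_derivative_inverse[OF assms(3)[OF that]
          times_differentiable_on_has_derivative[OF Suc.prems that]])
  then show ?case
  proof (rule times_differentiable_on_SucI[OF assms(1)])
    fix v
    have 1: "times_differentiable_on k D (\<lambda>z. inverse (f z))"
      using Suc.IH times_differentiable_on_SucD[OF Suc.prems] by blast
    have 2: "times_differentiable_on k D (dd f v)" using Suc.prems by simp
    show "times_differentiable_on k D
        (\<lambda>z. - (inverse (f z) * frechet_derivative f (at z) v * inverse (f z)))"
      by (intro times_differentiable_on_bounded_linear[of uminus] bounded_linear_minus bounded_linear_ident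
          times_differentiable_on_bilinear[OF bounded_bilinear_mult] assms(1) 1 2)
  qed
qed

lemma times_differentiable_on_sqrt:
  assumes "open D" "times_differentiable_on k D f" "\<And>z. z \<in> D \<Longrightarrow> f z > 0"
  shows "times_differentiable_on k D (\<lambda>z. sqrt (f z))"
  using assms(2)
proof (induction k)
  case 0
  then show ?case by (auto intro!: continuous_intros)
next
  case (Suc k)
  have "((\<lambda>z. sqrt (f z)) has_derivative
      (\<lambda>v. (1/2) * (frechet_derivative f (at z) v * inverse (sqrt (f z))))) (at z)" if "z \<in> D" for z
    by (rule has_derivative_eq_rhs[OF DERIV_compose_FDERIV[OF DERIV_real_sqrt[OF assms(3)[OF that]]
            times_differentiable_on_has_derivative[OF Suc.prems that]]])
      (simp add: fun_eq_iff field_simps)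
  then show ?case
  proof (rule times_differentiable_on_SucI[OF assms(1)])
    fix v
    have 1: "times_differentiable_on k D (\<lambda>z. sqrt (f z))"
      using Suc.IH times_differentiable_on_SucD[OF Suc.prems] by blast
    have 2: "times_differentiable_on k D (dd f v)" using Suc.prems by simp
    show "times_differentiable_on k D
        (\<lambda>z. (1/2) * (frechet_derivative f (at z) v * inverse (sqrt (f z))))"
      by (intro times_differentiable_on_bounded_linear[of "(*) (1/2)"] bounded_linear_mult_right
          times_differentiable_on_bilinear[OF bounded_bilinear_mult] times_differentiable_on_inverse assms(1) 1 2)
        (use assms(3) in force)
  qed
qed

text \<open>Faa di Bruno without formulas: \<open>G j\<close> is the \<open>j\<close>-th derivative of \<open>G 0\<close>.\<close>

lemma times_differentiable_on_real_compose:
  fixes G :: "nat \<Rightarrow> real \<Rightarrow> real"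
  assumes "open D" "times_differentiable_on k D f" "\<And>z. z \<in> D \<Longrightarrow> f z \<in> S"
    and G: "\<And>j x. x \<in> S \<Longrightarrow> (G j has_real_derivative G (Suc j) x) (at x)"
  shows "times_differentiable_on k D (\<lambda>z. G j (f z))"
  using assms(2)
proof (induction k arbitrary: j)
  case 0
  have "isCont (G j) x" if "x \<in> S" for x using G[OF that] DERIV_isCont by blast
  then have "continuous_on S (G j)" by (simp add: continuous_at_imp_continuous_on)
  then show ?case using 0 assms(3) by (auto intro: continuous_on_compose2)
next
  case (Suc k)
  have "((\<lambda>z. G j (f z)) has_derivative
      (\<lambda>v. frechet_derivative f (at z) v * G (Suc j) (f z))) (at z)" if "z \<in> D" for z
    by (rule DERIV_compose_FDERIV[OF G times_differentiable_on_has_derivative[OF Suc.prems that]])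
      (use assms(3)[OF that] in simp)
  then show ?case
  proof (rule times_differentiable_on_SucI[OF assms(1)])
    fix v
    have 1: "times_differentiable_on k D (\<lambda>z. G (Suc j) (f z))"
      using Suc.IH times_differentiable_on_SucD[OF Suc.prems] by blast
    have 2: "times_differentiable_on k D (dd f v)" using Suc.prems by simp
    show "times_differentiable_on k D (\<lambda>z. frechet_derivative f (at z) v * G (Suc j) (f z))"
      by (intro times_differentiable_on_bilinear[OF bounded_bilinear_mult] assms(1) 1 2)
  qed
qed

text \<open>In the chain rule the direction \<open>dd \<tau> v z\<close> varies with z, while
  differentiability is defined through fixed directions. Expanding it in 1 and i by
  \<open>dd_expand\<close> moves the dependence on z into scalar factors.\<close>

lemma times_differentiable_on_compose:
  assumes "open D" "times_differentiable_on k D \<tau>" "\<And>z. z \<in> D \<Longrightarrow> \<tau> z \<in> E"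
    and "times_differentiable_on k E f"
  shows "times_differentiable_on k D (\<lambda>z. f (\<tau> z))"
  using assms(2,4)
proof (induction k arbitrary: f)
  case 0
  then show ?case using assms(3) by (auto intro: continuous_on_compose2)
next
  case (Suc k)
  have d\<tau>: "(\<tau> has_derivative frechet_derivative \<tau> (at z)) (at z)" if "z \<in> D" for z
    using times_differentiable_on_has_derivative[OF Suc.prems(1) that] .
  have df: "(f has_derivative frechet_derivative f (at (\<tau> z))) (at (\<tau> z))" if "z \<in> D" for z
    using times_differentiable_on_has_derivative[OF Suc.prems(2)] assms(3) that by blast
  have "((\<lambda>z. f (\<tau> z)) has_derivative
      (\<lambda>v. Re (frechet_derivative \<tau> (at z) v) *\<^sub>R frechet_derivative f (at (\<tau> z)) 1
         + Im (frechet_derivative \<tau> (at z) v) *\<^sub>R frechet_derivative f (at (\<tau> z)) \<i>)) (at z)" if "z \<in> D" for z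
    by (rule has_derivative_eq_rhs[OF has_derivative_compose[OF d\<tau>[OF that] df[OF that]]], rule ext,
        rule dd_expand[OF df[OF that]])
  then show ?case
  proof (rule times_differentiable_on_SucI[OF assms(1)])
    fix v
    have 1: "times_differentiable_on k D (dd \<tau> v)" using Suc.prems by simp
    have 2: "times_differentiable_on k D (\<lambda>z. frechet_derivative f (at (\<tau> z)) u)" for u
      using Suc.IH[of "dd f u"] Suc.prems(2) times_differentiable_on_SucD[OF Suc.prems(1)] by simp
    show "times_differentiable_on k D (\<lambda>z. Re (frechet_derivative \<tau> (at z) v) *\<^sub>R frechet_derivative f (at (\<tau> z)) 1
         + Im (frechet_derivative \<tau> (at z) v) *\<^sub>R frechet_derivative f (at (\<tau> z)) \<i>)"
      by (intro times_differentiable_on_add times_differentiable_on_bilinear[OF bounded_bilinear_scaleR] assms(1) 2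
          times_differentiable_on_bounded_linear[OF bounded_linear_Re] times_differentiable_on_bounded_linear[OF bounded_linear_Im] 1)
  qed
qed

section \<open>Closure of the class of smooth maps\<close>

lemma smooth_on_const [simp]: "smooth_on D (\<lambda>_. c)"
  by (simp add: smooth_on_def times_differentiable_on_const)

lemma smooth_on_id [simp]: "open D \<Longrightarrow> smooth_on D (\<lambda>z. z)"
  by (rule smooth_onI[where f' = "\<lambda>_ v. v"]) auto

context
  fixes D :: "complex set"
  assumes D: "open D"
begin

lemma smooth_on_bounded_linear: "bounded_linear L \<Longrightarrow> smooth_on D f \<Longrightarrow> smooth_on D (\<lambda>z. L (f z))"
  using times_differentiable_on_bounded_linear[OF _ D] unfolding smooth_on_def by blast

lemma smooth_on_bilinear:
  "bounded_bilinear B \<Longrightarrow> smooth_on D f \<Longrightarrow> smooth_on D g \<Longrightarrow> smooth_on D (\<lambda>z. B (f z) (g z))"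
  using times_differentiable_on_bilinear[OF _ D] unfolding smooth_on_def by blast

lemma smooth_on_add: "smooth_on D f \<Longrightarrow> smooth_on D g \<Longrightarrow> smooth_on D (\<lambda>z. f z + g z)"
  using times_differentiable_on_add[OF D] unfolding smooth_on_def by blast

lemma smooth_on_inverse:
  fixes f :: "complex \<Rightarrow> 'b::real_normed_field"
  shows "smooth_on D f \<Longrightarrow> (\<And>z. z \<in> D \<Longrightarrow> f z \<noteq> 0) \<Longrightarrow> smooth_on D (\<lambda>z. inverse (f z))"
  using times_differentiable_on_inverse[OF D] unfolding smooth_on_def by blast

lemma smooth_on_sqrt: "smooth_on D f \<Longrightarrow> (\<And>z. z \<in> D \<Longrightarrow> f z > 0) \<Longrightarrow> smooth_on D (\<lambda>z. sqrt (f z))"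
  using times_differentiable_on_sqrt[OF D] unfolding smooth_on_def by blast

lemma smooth_on_real_compose:
  fixes G :: "nat \<Rightarrow> real \<Rightarrow> real"
  assumes "smooth_on D f" "\<And>z. z \<in> D \<Longrightarrow> f z \<in> S"
    and "\<And>j x. x \<in> S \<Longrightarrow> (G j has_real_derivative G (Suc j) x) (at x)"
  shows "smooth_on D (\<lambda>z. G j (f z))"
  using times_differentiable_on_real_compose[where G = G and S = S and f = f, OF D] assms
  unfolding smooth_on_def by blast

lemma smooth_on_compose:
  assumes "smooth_on D \<tau>" "\<And>z. z \<in> D \<Longrightarrow> \<tau> z \<in> E" "smooth_on E f"
  shows "smooth_on D (\<lambda>z. f (\<tau> z))"
  using times_differentiable_on_compose[where \<tau> = \<tau> and f = f and E = E, OF D] assms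
  unfolding smooth_on_def by blast

lemma smooth_on_minus: "smooth_on D f \<Longrightarrow> smooth_on D (\<lambda>z. - f z)"
  by (rule smooth_on_bounded_linear[OF bounded_linear_minus[OF bounded_linear_ident]])

lemma smooth_on_diff: "smooth_on D f \<Longrightarrow> smooth_on D g \<Longrightarrow> smooth_on D (\<lambda>z. f z - g z)"
  using smooth_on_add[of f "\<lambda>z. - g z"] smooth_on_minus[of g] by simp

lemma smooth_on_mult:
  fixes f g :: "complex \<Rightarrow> 'b::real_normed_algebra"
  shows "smooth_on D f \<Longrightarrow> smooth_on D g \<Longrightarrow> smooth_on D (\<lambda>z. f z * g z)"
  by (rule smooth_on_bilinear[OF bounded_bilinear_mult])

lemma smooth_on_scaleR: "smooth_on D f \<Longrightarrow> smooth_on D g \<Longrightarrow> smooth_on D (\<lambda>z. f z *\<^sub>R g z)"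
  by (rule smooth_on_bilinear[OF bounded_bilinear_scaleR])

lemma smooth_on_inner:
  fixes f g :: "complex \<Rightarrow> 'b::real_inner"
  shows "smooth_on D f \<Longrightarrow> smooth_on D g \<Longrightarrow> smooth_on D (\<lambda>z. f z \<bullet> g z)"
  by (rule smooth_on_bilinear[OF bounded_bilinear_inner])

lemma smooth_on_divide:
  fixes f g :: "complex \<Rightarrow> 'b::real_normed_field"
  shows "smooth_on D f \<Longrightarrow> smooth_on D g \<Longrightarrow> (\<And>z. z \<in> D \<Longrightarrow> g z \<noteq> 0) \<Longrightarrow> smooth_on D (\<lambda>z. f z / g z)"
  unfolding divide_inverse by (intro smooth_on_mult smooth_on_inverse)

lemma smooth_on_power2:
  fixes f :: "complex \<Rightarrow> 'b::real_normed_algebra_1"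
  shows "smooth_on D f \<Longrightarrow> smooth_on D (\<lambda>z. (f z)\<^sup>2)"
  unfolding power2_eq_square by (intro smooth_on_mult)

lemma smooth_on_Re: "smooth_on D f \<Longrightarrow> smooth_on D (\<lambda>z. Re (f z))"
  by (rule smooth_on_bounded_linear[OF bounded_linear_Re])

lemma smooth_on_Im: "smooth_on D f \<Longrightarrow> smooth_on D (\<lambda>z. Im (f z))"
  by (rule smooth_on_bounded_linear[OF bounded_linear_Im])

lemma smooth_on_cnj: "smooth_on D f \<Longrightarrow> smooth_on D (\<lambda>z. cnj (f z))"
  by (rule smooth_on_bounded_linear[OF bounded_linear_cnj])

lemma smooth_on_fst: "smooth_on D f \<Longrightarrow> smooth_on D (\<lambda>z. fst (f z))"
  by (rule smooth_on_bounded_linear[OF bounded_linear_fst])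

lemma smooth_on_snd: "smooth_on D f \<Longrightarrow> smooth_on D (\<lambda>z. snd (f z))"
  by (rule smooth_on_bounded_linear[OF bounded_linear_snd])

lemma smooth_on_of_real:
  "smooth_on D f \<Longrightarrow> smooth_on D (\<lambda>z. of_real (f z) :: 'b::{real_normed_algebra_1})"
  by (rule smooth_on_bounded_linear[OF bounded_linear_of_real])

lemma smooth_on_Pair:
  assumes "smooth_on D f" "smooth_on D g"
  shows "smooth_on D (\<lambda>z. (f z, g z))"
proof -
  have "smooth_on D (\<lambda>z. (f z, 0) + (0, g z))"
    using assms
    by (intro smooth_on_add smooth_on_bounded_linear[of "\<lambda>x. (x, 0)"] smooth_on_bounded_linear[of "\<lambda>x. (0, x)"]
        bounded_linear_Pair bounded_linear_ident bounded_linear_zero)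
  then show ?thesis by simp
qed

lemma smooth_on_sin:
  assumes "smooth_on D f"
  shows "smooth_on D (\<lambda>z. sin (f z :: real))"
proof -
  \<comment> \<open>Each derivative of the sine advances the phase by a quarter period, so
    \<open>?G j\<close> is its j-th derivative.\<close>
  let ?G = "\<lambda>j x. sin (x + of_nat j * (pi/2))"
  have "(?G j has_real_derivative ?G (Suc j) x) (at x)" for j x
  proof -
    have "x + of_nat (Suc j) * (pi/2) = (x + of_nat j * (pi/2)) + pi/2" by (simp add: algebra_simps)
    then have "?G (Suc j) x = cos (x + of_nat j * (pi/2))" by (simp only: sin_add) simp
    then show ?thesis by (auto intro!: derivative_eq_intros)
  qed
  then show ?thesis using smooth_on_real_compose[of f UNIV ?G 0] assms by simp
qed

lemma smooth_on_cos: "smooth_on D f \<Longrightarrow> smooth_on D (\<lambda>z. cos (f z :: real))"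
  using smooth_on_sin[of "\<lambda>z. f z + pi/2"] smooth_on_add[of f "\<lambda>_. pi/2"]
  by (simp add: sin_add)

end

lemmas smooth_intros = smooth_on_add smooth_on_minus smooth_on_diff smooth_on_mult smooth_on_scaleR
  smooth_on_inner smooth_on_divide smooth_on_power2 smooth_on_Re smooth_on_Im smooth_on_cnj smooth_on_fst
  smooth_on_snd smooth_on_of_real smooth_on_Pair smooth_on_const smooth_on_dd smooth_on_inverse
  smooth_on_sqrt smooth_on_sin smooth_on_cos smooth_on_id

text \<open>A bootstrap: the derivative of g at y inverts that of f at g y, and Cramer's rule writes
  it rationally in the partial derivatives of f at g y. Hence g of class k has a derivative of class
  k.\<close>

lemma smooth_on_inverse_map:
  fixes f g :: "complex \<Rightarrow> complex"
  assumes "open V" "\<And>y. y \<in> V \<Longrightarrow> (g has_derivative g' y) (at y)"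
    and "\<And>y. y \<in> V \<Longrightarrow> f (g y) = y" "\<And>y. y \<in> V \<Longrightarrow> g y \<in> U" "smooth_on U f"
  shows "smooth_on V g"
proof -
  define A B d where "A = dd f 1" "B = dd f \<i>" "d = (\<lambda>x. Im (cnj (A x) * B x))"
  note ABd = this
  \<comment> \<open>Cramer's rule; \<open>Im (cnj a * b)\<close> is the determinant of the columns a
    and b.\<close>
  define s t where "s = (\<lambda>v y. Im (cnj v * B (g y)) * inverse (d (g y)))"
    "t = (\<lambda>v y. Im (cnj (A (g y)) * v) * inverse (d (g y)))"
  have g': "v = Re (g' y v) *\<^sub>R A (g y) + Im (g' y v) *\<^sub>R B (g y)" if "y \<in> V" for y v
  proof -
    have df: "(f has_derivative frechet_derivative f (at (g y))) (at (g y))"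
      using smooth_on_has_derivative[OF assms(5)] assms(4) that by blast
    have "((\<lambda>y. f (g y)) has_derivative (\<lambda>v. frechet_derivative f (at (g y)) (g' y v))) (at y)"
      by (rule has_derivative_compose[OF assms(2)[OF that] df])
    moreover have "((\<lambda>y. f (g y)) has_derivative (\<lambda>v. v)) (at y)"
      by (rule has_derivative_transform_within_open[OF _ assms(1) that, where f = "\<lambda>y. y"])
        (auto simp: assms(3))
    ultimately have "(\<lambda>v. frechet_derivative f (at (g y)) (g' y v)) = (\<lambda>v. v)"
      by (rule has_derivative_unique)
    then have "frechet_derivative f (at (g y)) (g' y v) = v" by meson
    then show ?thesis using dd_expand[OF df, of "g' y v"] by (simp add: ABd)
  qed
  \<comment> \<open>Every vector is a combination of A and B. If their determinant vanished, so
    would that of any two vectors, in particular of 1 and i.\<close>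
  have d0: "d (g y) \<noteq> 0" if yV: "y \<in> V" for y
  proof
    assume 0: "d (g y) = 0"
    have *: "Im (cnj v * w) = 0" for v w
    proof -
      obtain a b a' b' where v: "v = of_real a * A (g y) + of_real b * B (g y)"
        and w: "w = of_real a' * A (g y) + of_real b' * B (g y)"
        using g'[OF yV, of v] g'[OF yV, of w] by (metis scaleR_conv_of_real)
      have "Im (cnj v * w) = (a * b' - b * a') * d (g y)"
        unfolding v w ABd by (simp add: algebra_simps)
      then show ?thesis using 0 by simp
    qed
    show False using *[of 1 \<i>] by simp
  qed
  have eq: "g' y v = Complex (s v y) (t v y)" if "y \<in> V" for y v
  proof -
    have "Im (cnj v * B (g y)) = Re (g' y v) * d (g y)"
      by (subst g'[OF that, of v]) (simp add: ABd algebra_simps)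
    moreover have "Im (cnj (A (g y)) * v) = Im (g' y v) * d (g y)"
      by (subst g'[OF that, of v]) (simp add: ABd algebra_simps)
    ultimately show ?thesis using d0[OF that] by (simp add: s_t_def complex_eq_iff)
  qed
  have "times_differentiable_on k V g" for k
  proof (induction k)
    case 0
    then show ?case using assms(2)
      by (auto intro!: continuous_at_imp_continuous_on dest: has_derivative_continuous)
  next
    case (Suc k)
    have AB: "times_differentiable_on k V (\<lambda>y. A (g y))" "times_differentiable_on k V (\<lambda>y. B (g y))"
      unfolding ABd
      by (rule times_differentiable_on_compose[OF assms(1) Suc assms(4)],
          use smooth_on_dd[OF assms(5)] in \<open>auto simp: smooth_on_def\<close>)+
    note c = times_differentiable_on_bilinear[OF bounded_bilinear_mult assms(1)] times_differentiable_on_const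
      times_differentiable_on_inverse[OF assms(1)]
      times_differentiable_on_bounded_linear[OF bounded_linear_Im assms(1)]
      times_differentiable_on_bounded_linear[OF bounded_linear_cnj assms(1)]
      times_differentiable_on_bounded_linear[OF bounded_linear_of_real assms(1)] AB
    have d: "times_differentiable_on k V (\<lambda>y. d (g y))"
      unfolding ABd(3) by (intro c)
    have "times_differentiable_on k V (\<lambda>y. of_real (s v y) + \<i> * of_real (t v y))" for v
      unfolding s_t_def by (intro times_differentiable_on_add[OF assms(1)] c d d0)
    then have "times_differentiable_on k V (\<lambda>y. g' y v)" for v
      by (rule times_differentiable_on_cong[OF assms(1), rotated]) (simp add: eq complex_eq_iff)
    then show ?case using times_differentiable_on_SucI[OF assms(1,2)] by blast
  qed
  then show ?thesis by (simp add: smooth_on_def)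
qed

section \<open>Symmetry of second derivatives\<close>

text \<open>Two applications of the mean value theorem to the second difference of \<open>f\<close>.\<close>

lemma second_difference:
  fixes f :: "complex \<Rightarrow> real"
  assumes f: "smooth_on (ball z r) f" and h: "h > 0" "h * (norm u + norm v) < r"
  shows "\<exists>w \<in> ball z r. dist w z < h * (norm u + norm v + 1) \<and>
    f (z + h *\<^sub>R u + h *\<^sub>R v) - f (z + h *\<^sub>R u) - f (z + h *\<^sub>R v) + f z = h * h * dd (dd f u) v w"
proof -
  have inb: "z + s *\<^sub>R u + t *\<^sub>R v \<in> ball z r" and dst: "dist (z + s *\<^sub>R u + t *\<^sub>R v) z < h * (norm u + norm v + 1)"
    if "0 \<le> s" "s \<le> h" "0 \<le> t" "t \<le> h" for s t
  proof -
    have "norm (s *\<^sub>R u + t *\<^sub>R v) \<le> s * norm u + t * norm v"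
      using that by (intro norm_triangle_le) auto
    also have "\<dots> \<le> h * norm u + h * norm v"
      using that by (intro add_mono mult_right_mono) auto
    finally have *: "norm (s *\<^sub>R u + t *\<^sub>R v) \<le> h * (norm u + norm v)" by (simp add: algebra_simps)
    have "z - (z + s *\<^sub>R u + t *\<^sub>R v) = - (s *\<^sub>R u + t *\<^sub>R v)"
      "z + s *\<^sub>R u + t *\<^sub>R v - z = s *\<^sub>R u + t *\<^sub>R v" by auto
    then show "z + s *\<^sub>R u + t *\<^sub>R v \<in> ball z r" "dist (z + s *\<^sub>R u + t *\<^sub>R v) z < h * (norm u + norm v + 1)"
      using * h by (simp_all add: dist_norm norm_minus_commute algebra_simps del: minus_add_distrib)
  qed
  have der: "((\<lambda>s. F (a + s *\<^sub>R b)) has_real_derivative dd F b (a + s *\<^sub>R b)) (at s)"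
    if "smooth_on (ball z r) F" "a + s *\<^sub>R b \<in> ball z r" for F :: "complex \<Rightarrow> real" and a b s
  proof -
    have F: "(F has_derivative frechet_derivative F (at (a + s *\<^sub>R b))) (at (a + s *\<^sub>R b))"
      by (rule smooth_on_has_derivative[OF that])
    have "((\<lambda>s. F (a + s *\<^sub>R b)) has_derivative (\<lambda>x. frechet_derivative F (at (a + s *\<^sub>R b)) (x *\<^sub>R b))) (at s)"
      by (rule has_derivative_compose[where f = "\<lambda>s. a + s *\<^sub>R b" and g = F, OF _ F])
        (auto intro!: derivative_eq_intros)
    moreover have "frechet_derivative F (at (a + s *\<^sub>R b)) (x *\<^sub>R b) = dd F b (a + s *\<^sub>R b) * x" for x
      using linear_scale[OF has_derivative_linear[OF F]] by simp
    ultimately show ?thesis by (simp add: has_field_derivative_def)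
  qed
  define G where "G = (\<lambda>s. f (z + h *\<^sub>R v + s *\<^sub>R u) - f (z + s *\<^sub>R u))"
  have "\<exists>s>0. s < h \<and> G h - G 0 = (h - 0) * (dd f u (z + h *\<^sub>R v + s *\<^sub>R u) - dd f u (z + s *\<^sub>R u))"
  proof (rule MVT2[OF h(1)])
    fix s assume s: "0 \<le> s" "s \<le> h"
    have "z + h *\<^sub>R v + s *\<^sub>R u \<in> ball z r" "z + s *\<^sub>R u \<in> ball z r"
      using inb[of s h] inb[of s 0] s h by (simp_all add: add.commute add.left_commute)
    then show "(G has_real_derivative dd f u (z + h *\<^sub>R v + s *\<^sub>R u) - dd f u (z + s *\<^sub>R u)) (at s)"
      unfolding G_def by (intro DERIV_diff der f)
  qed
  then obtain s where s: "0 < s" "s < h"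
    and Gs: "G h - G 0 = h * (dd f u (z + h *\<^sub>R v + s *\<^sub>R u) - dd f u (z + s *\<^sub>R u))" by auto
  have "\<exists>t>0. t < h \<and> dd f u (z + s *\<^sub>R u + h *\<^sub>R v) - dd f u (z + s *\<^sub>R u + 0 *\<^sub>R v)
      = (h - 0) * dd (dd f u) v (z + s *\<^sub>R u + t *\<^sub>R v)"
    by (rule MVT2[OF h(1)]) (use inb s in \<open>auto intro!: der smooth_on_dd[OF f]\<close>)
  then obtain t where t: "0 < t" "t < h"
    and "dd f u (z + s *\<^sub>R u + h *\<^sub>R v) - dd f u (z + s *\<^sub>R u) = h * dd (dd f u) v (z + s *\<^sub>R u + t *\<^sub>R v)"
    by auto
  then have "G h - G 0 = h * h * dd (dd f u) v (z + s *\<^sub>R u + t *\<^sub>R v)"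
    using Gs by (simp add: algebra_simps)
  moreover have "G h - G 0 = f (z + h *\<^sub>R u + h *\<^sub>R v) - f (z + h *\<^sub>R u) - f (z + h *\<^sub>R v) + f z"
    by (simp add: G_def algebra_simps)
  ultimately show ?thesis
    using inb[of s t] dst[of s t] s t by (intro bexI[of _ "z + s *\<^sub>R u + t *\<^sub>R v"]) auto
qed

text \<open>The second difference is symmetric in u and v. It equals the step squared times either
  mixed derivative, taken at points that tend to z with the step, and both mixed derivatives are
  continuous.\<close>

lemma dd_commute_real:
  fixes f :: "complex \<Rightarrow> real"
  assumes "open D" "smooth_on D f" "z \<in> D"
  shows "dd (dd f u) v z = dd (dd f v) u z"
proof -
  obtain r where r: "r > 0" "ball z r \<subseteq> D" using assms openE by blast
  have f: "smooth_on (ball z r) f" using smooth_on_subset[OF assms(2) r(2)] .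
  \<comment> \<open>The summand 1 keeps m positive even if both directions vanish.\<close>
  define m where "m = norm u + norm v + 1"
  have m: "m > 0" "norm v + norm u + 1 = m" unfolding m_def by (auto intro: add_nonneg_pos)
  define h where "h = (\<lambda>n. r / m * inverse (Suc n))"
  have h0: "h n > 0" for n using r m by (simp add: h_def)
  have hr: "h n * (norm u + norm v) < r" for n
  proof -
    have "h n \<le> r / m * 1" unfolding h_def
      by (rule mult_left_mono) (use r m in \<open>auto simp: inverse_le_1_iff\<close>)
    then have "h n * m \<le> r" using m by (simp add: field_simps)
    moreover have "h n * (norm u + norm v) < h n * m" using h0 by (simp add: m_def)
    ultimately show ?thesis by linarith
  qed
  have "\<forall>n. \<exists>p q. dist p z < h n * m \<and> dist q z < h n * m \<and> dd (dd f u) v p = dd (dd f v) u q"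
  proof
    fix n
    obtain p where p: "dist p z < h n * m" "f (z + h n *\<^sub>R u + h n *\<^sub>R v) - f (z + h n *\<^sub>R u) - f (z + h n *\<^sub>R v) + f z
        = h n * h n * dd (dd f u) v p"
      using second_difference[OF f h0 hr] unfolding m_def by blast
    obtain q where q: "dist q z < h n * m" "f (z + h n *\<^sub>R v + h n *\<^sub>R u) - f (z + h n *\<^sub>R v) - f (z + h n *\<^sub>R u) + f z
        = h n * h n * dd (dd f v) u q"
      using second_difference[OF f h0, of n v u] hr m by (auto simp: add.commute)
    have "h n * h n * dd (dd f u) v p = h n * h n * dd (dd f v) u q"
      using p(2) q(2) by (simp add: algebra_simps)
    then show "\<exists>p q. dist p z < h n * m \<and> dist q z < h n * m \<and> dd (dd f u) v p = dd (dd f v) u q"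
      using p(1) q(1) h0[of n] by auto
  qed
  then obtain p q where pq: "\<And>n. dist (p n) z < h n * m" "\<And>n. dist (q n) z < h n * m"
    "\<And>n. dd (dd f u) v (p n) = dd (dd f v) u (q n)" by metis
  have "(\<lambda>n. h n * m) \<longlonglongrightarrow> r / m * 0 * m"
    unfolding h_def by (intro tendsto_intros LIMSEQ_inverse_real_of_nat)
  then have lim: "(\<lambda>n. h n * m) \<longlonglongrightarrow> 0" by simp
  have pz: "p \<longlonglongrightarrow> z" "q \<longlonglongrightarrow> z"
    by (rule iffD2[OF tendsto_dist_iff], rule tendsto_sandwich[OF _ _ tendsto_const lim];
        intro always_eventually allI zero_le_dist less_imp_le pq)+
  have "isCont (dd (dd f u) v) z" "isCont (dd (dd f v) u) z"
    using smooth_on_continuous_on[OF smooth_on_dd[OF smooth_on_dd[OF assms(2)]]] assms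
    by (auto simp: continuous_on_eq_continuous_at)
  then have "(\<lambda>n. dd (dd f u) v (p n)) \<longlonglongrightarrow> dd (dd f u) v z"
    "(\<lambda>n. dd (dd f v) u (q n)) \<longlonglongrightarrow> dd (dd f v) u z"
    using pz by (auto intro: isCont_tendsto_compose)
  then show ?thesis using pq(3) LIMSEQ_unique by force
qed

lemma dd_bounded_linear:
  assumes "bounded_linear L" "smooth_on D f" "z \<in> D"
  shows "dd (\<lambda>z. L (f z)) v z = L (dd f v z)"
  using frechet_derivative_at[OF bounded_linear.has_derivative[OF assms(1) smooth_on_has_derivative[OF assms(2,3)]]]
  by metis

text \<open>Pairing with a fixed vector reduces to real functions, for which the mean value theorem
  is available.\<close>

lemma dd_commute:
  fixes f :: "complex \<Rightarrow> 'b::real_inner"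
  assumes "open D" "smooth_on D f" "z \<in> D"
  shows "dd (dd f u) v z = dd (dd f v) u z"
proof -
  have "b \<bullet> dd (dd f u) v z = b \<bullet> dd (dd f v) u z" for b
  proof -
    have L: "bounded_linear ((\<bullet>) b)" by (rule bounded_linear_inner_right)
    have *: "b \<bullet> dd (dd f x) y z = dd (dd (\<lambda>z. b \<bullet> f z) x) y z" for x y
      using frechet_derivative_cong_open[OF assms(1,3), of "dd (\<lambda>z. b \<bullet> f z) x" "\<lambda>z. b \<bullet> dd f x z"]
        dd_bounded_linear[OF L assms(2)] dd_bounded_linear[OF L smooth_on_dd[OF assms(2)] assms(3)]
      by simp
    show ?thesis unfolding * by (rule dd_commute_real[OF assms(1) _ assms(3)])
        (rule smooth_on_bounded_linear[OF assms(1) L assms(2)])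
  qed
  then have "(dd (dd f u) v z - dd (dd f v) u z) \<bullet> (dd (dd f u) v z - dd (dd f v) u z) = 0"
    by (simp only: inner_diff_right)
  then show ?thesis by simp
qed

lemma dd_bilinear:
  assumes "bounded_bilinear B" "smooth_on D f" "smooth_on D g" "z \<in> D"
  shows "dd (\<lambda>z. B (f z) (g z)) v z = B (f z) (dd g v z) + B (dd f v z) (g z)"
  using frechet_derivative_at[OF bounded_bilinear.FDERIV[OF assms(1)
      smooth_on_has_derivative[OF assms(2,4)] smooth_on_has_derivative[OF assms(3,4)]]]
  by metis

lemma dd_compose:
  assumes "smooth_on D \<tau>" "z \<in> D" "\<tau> z \<in> E" "smooth_on E f"
  shows "dd (\<lambda>z. f (\<tau> z)) v z = frechet_derivative f (at (\<tau> z)) (dd \<tau> v z)"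
  using frechet_derivative_at[OF has_derivative_compose[OF smooth_on_has_derivative[OF assms(1,2)]
      smooth_on_has_derivative[OF assms(4,3)]]]
  by metis

lemma dd_add:
  assumes "smooth_on D f" "smooth_on D g" "z \<in> D"
  shows "dd (\<lambda>z. f z + g z) v z = dd f v z + dd g v z"
  using frechet_derivative_at[OF has_derivative_add[OF
      smooth_on_has_derivative[OF assms(1,3)] smooth_on_has_derivative[OF assms(2,3)]]]
  by metis

section \<open>Absolutely convergent sums of exponentials\<close>

definition plane_wave :: "complex \<Rightarrow> complex \<Rightarrow> complex" where
  "plane_wave N z = cis (N \<bullet> z)"

lemma norm_plane_wave [simp]: "norm (plane_wave N z) = 1"
  by (simp add: plane_wave_def)

lemma plane_wave_zero [simp]: "plane_wave 0 z = 1" "plane_wave N 0 = 1"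
  by (simp_all add: plane_wave_def)

lemma plane_wave_add: "plane_wave (M + N) z = plane_wave M z * plane_wave N z"
  by (simp add: plane_wave_def inner_add_left cis_mult)

lemma plane_wave_add_right: "plane_wave N (z + w) = plane_wave N z * plane_wave N w"
  by (simp add: plane_wave_def inner_add_right cis_mult)

lemma norm_cis_minus_linear: "norm (cis t - 1 - \<i> * t) \<le> t\<^sup>2"
proof -
  have "\<bar>sin t - t\<bar> \<le> t\<^sup>2 / 2"
    using Maclaurin_sin_bound[of t 2] by (simp add: sin_coeff_def eval_nat_numeral)
  moreover have "\<bar>cos t - 1\<bar> \<le> t\<^sup>2 / 2"
  proof -
    have "\<bar>cos t - 1\<bar> = 2 * (sin (t/2))\<^sup>2" using cos_double_sin[of "t/2"] by simp
    also have "\<dots> \<le> 2 * (t/2)\<^sup>2"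
      using abs_sin_x_le_abs_x[of "t/2"] by (simp only: abs_le_square_iff)
    finally show ?thesis by (simp add: power_divide)
  qed
  ultimately show ?thesis
    using cmod_le[of "cis t - 1 - \<i> * t"] by simp
qed

lemma infsum_minus_diff:
  fixes f g :: "'a \<Rightarrow> complex"
  assumes "f summable_on A" "g summable_on A"
  shows "infsum (\<lambda>x. f x - g x) A = infsum f A - infsum g A" "(\<lambda>x. f x - g x) summable_on A"
  using infsum_add[OF assms(1) summable_on_uminus[THEN iffD2, OF assms(2)]]
    summable_on_add[OF assms(1) summable_on_uminus[THEN iffD2, OF assms(2)]] by (simp_all add: infsum_uminus)

text \<open>Decay of the coefficients faster than every power of the frequency. The index type is
  arbitrary and N need not be injective, which is what allows lists of frequencies as indices
  later.\<close>

definition rapid :: "('i \<Rightarrow> complex) \<Rightarrow> ('i \<Rightarrow> complex) \<Rightarrow> bool" where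
  "rapid c N \<longleftrightarrow> (\<forall>k. (\<lambda>i. norm (c i) * (1 + norm (N i)) ^ k) summable_on UNIV)"

lemma rapidD: "rapid c N \<Longrightarrow> (\<lambda>i. norm (c i) * (1 + norm (N i)) ^ k) summable_on UNIV"
  by (simp add: rapid_def)

lemma rapid_summable: "rapid c N \<Longrightarrow> (\<lambda>i. norm (c i)) summable_on UNIV"
  using rapidD[of c N 0] by simp

text \<open>A polynomial loss in the frequency is harmless, because the decay hypothesis holds for
  every power.\<close>

lemma rapid_mono:
  assumes "rapid c N" "\<And>i. norm (d i) \<le> C * norm (c i) * (1 + norm (N i)) ^ p"
  shows "rapid d N"
  unfolding rapid_def
proof
  fix k
  have *: "(\<lambda>i. C * (norm (c i) * (1 + norm (N i)) ^ (p + k))) summable_on UNIV"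
    by (intro summable_on_cmult_right rapidD assms)
  show "(\<lambda>i. norm (d i) * (1 + norm (N i)) ^ k) summable_on UNIV"
  proof (rule summable_on_comparison_test[OF *])
    show "norm (d i) * (1 + norm (N i)) ^ k \<le> C * (norm (c i) * (1 + norm (N i)) ^ (p + k))" for i
      using mult_right_mono[OF assms(2)[of i], of "(1 + norm (N i)) ^ k"]
      by (simp add: power_add mult.assoc)
  qed auto
qed

lemma rapid_mult_freq:
  assumes "rapid c N"
  shows "rapid (\<lambda>i. \<i> * of_real (N i \<bullet> v) * c i) N"
proof (rule rapid_mono[OF assms, of _ "norm v" 1])
  fix i
  have "\<bar>N i \<bullet> v\<bar> \<le> norm v * (1 + norm (N i))"
    using Cauchy_Schwarz_ineq2[of "N i" v] norm_ge_zero[of v] by (simp only: algebra_simps mult_1_right)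
  from mult_right_mono[OF this norm_ge_zero[of "c i"]]
  show "norm (\<i> * of_real (N i \<bullet> v) * c i) \<le> norm v * norm (c i) * (1 + norm (N i)) ^ 1"
    by (simp add: norm_mult mult_ac)
qed

definition wave_sum :: "('i \<Rightarrow> complex) \<Rightarrow> ('i \<Rightarrow> complex) \<Rightarrow> complex \<Rightarrow> complex" where
  "wave_sum c N z = (\<Sum>\<^sub>\<infinity>i. c i * plane_wave (N i) z)"

lemma wave_sum_summable:
  assumes "(\<lambda>i. norm (c i)) summable_on UNIV"
  shows "(\<lambda>i. c i * plane_wave (N i) z) summable_on UNIV"
  by (rule abs_summable_summable) (simp add: norm_mult assms)

text \<open>The first-order remainder of a single wave is at most (|N| |v|)^2, and rapid decay with
  exponent 2 makes these bounds summable. The remainder of the whole sum is therefore quadratic in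
  v.\<close>

lemma wave_sum_has_derivative:
  assumes "rapid c N"
  shows "(wave_sum c N has_derivative
    (\<lambda>v. Re v *\<^sub>R wave_sum (\<lambda>i. \<i> * of_real (N i \<bullet> 1) * c i) N z
       + Im v *\<^sub>R wave_sum (\<lambda>i. \<i> * of_real (N i \<bullet> \<i>) * c i) N z)) (at z)" (is "(_ has_derivative ?D) _")
proof -
  note sm = wave_sum_summable[OF rapid_summable]
  have Dv: "?D v = (\<Sum>\<^sub>\<infinity>i. (\<i> * of_real (N i \<bullet> v) * c i) * plane_wave (N i) z)" for v
  proof -
    have "?D v = (\<Sum>\<^sub>\<infinity>i. of_real (Re v) * ((\<i> * of_real (N i \<bullet> 1) * c i) * plane_wave (N i) z)
        + of_real (Im v) * ((\<i> * of_real (N i \<bullet> \<i>) * c i) * plane_wave (N i) z))"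
      unfolding wave_sum_def scaleR_conv_of_real infsum_cmult_right'[symmetric]
      by (intro infsum_add[symmetric] summable_on_cmult_right sm[OF rapid_mult_freq[OF assms]])
    also have "\<dots> = (\<Sum>\<^sub>\<infinity>i. (\<i> * of_real (N i \<bullet> v) * c i) * plane_wave (N i) z)"
      by (intro infsum_cong) (simp add: inner_complex_def algebra_simps)
    finally show ?thesis .
  qed
  define C where "C = (\<Sum>\<^sub>\<infinity>i. norm (c i) * (1 + norm (N i)) ^ 2)"
  have C0: "C \<ge> 0" unfolding C_def by (rule infsum_nonneg) auto
  have bound: "norm (wave_sum c N (z + v) - wave_sum c N z - ?D v) \<le> C * (norm v)\<^sup>2" for v
  proof -
    let ?r = "\<lambda>i. c i * plane_wave (N i) z * (cis (N i \<bullet> v) - 1 - \<i> * of_real (N i \<bullet> v))"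
    have r: "norm (?r i) \<le> norm (c i) * (1 + norm (N i)) ^ 2 * (norm v)\<^sup>2" for i
    proof -
      have "norm (?r i) \<le> norm (c i) * (N i \<bullet> v)\<^sup>2"
        using norm_cis_minus_linear[of "N i \<bullet> v"] by (simp add: norm_mult mult_left_mono)
      also have "\<dots> \<le> norm (c i) * ((1 + norm (N i)) ^ 2 * (norm v)\<^sup>2)"
      proof (rule mult_left_mono)
        have "\<bar>N i \<bullet> v\<bar> \<le> norm (N i) * norm v" by (rule Cauchy_Schwarz_ineq2)
        also have "\<dots> \<le> (1 + norm (N i)) * norm v" by (simp add: mult_right_mono)
        finally have "\<bar>N i \<bullet> v\<bar> \<le> \<bar>(1 + norm (N i)) * norm v\<bar>" by simp
        then show "(N i \<bullet> v)\<^sup>2 \<le> (1 + norm (N i)) ^ 2 * (norm v)\<^sup>2"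
          by (simp only: abs_le_square_iff power_mult_distrib)
      qed simp
      finally show ?thesis by (simp add: mult.assoc)
    qed
    have S: "(\<lambda>i. norm (c i) * (1 + norm (N i)) ^ 2 * (norm v)\<^sup>2) summable_on UNIV"
      by (intro summable_on_cmult_left rapidD assms)
    have rs: "(\<lambda>i. norm (?r i)) summable_on UNIV"
      by (rule Infinite_Sum.abs_summable_on_comparison_test'[OF S]) (rule r)
    have "wave_sum c N (z + v) - wave_sum c N z - ?D v = (\<Sum>\<^sub>\<infinity>i. c i * plane_wave (N i) (z + v)
        - c i * plane_wave (N i) z - (\<i> * of_real (N i \<bullet> v) * c i) * plane_wave (N i) z)"
      unfolding Dv unfolding wave_sum_def
      by (simp only: infsum_minus_diff(1)[OF sm[OF assms] sm[OF assms]] infsum_minus_diff(1)[OF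
          infsum_minus_diff(2)[OF sm[OF assms] sm[OF assms]] sm[OF rapid_mult_freq[OF assms]]])
    also have "\<dots> = (\<Sum>\<^sub>\<infinity>i. ?r i)"
      by (intro infsum_cong) (simp add: plane_wave_add_right, simp add: plane_wave_def algebra_simps)
    finally have eq: "wave_sum c N (z + v) - wave_sum c N z - ?D v = infsum ?r UNIV" .
    have "norm (infsum ?r UNIV) \<le> (\<Sum>\<^sub>\<infinity>i. norm (?r i))"
      by (rule Infinite_Sum.norm_infsum_bound[OF rs])
    also have "\<dots> \<le> (\<Sum>\<^sub>\<infinity>i. norm (c i) * (1 + norm (N i)) ^ 2 * (norm v)\<^sup>2)"
      by (rule infsum_mono[OF rs S]) (rule r)
    also have "\<dots> = C * (norm v)\<^sup>2" by (simp add: C_def infsum_cmult_left')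
    finally show ?thesis unfolding eq .
  qed
  show ?thesis
    unfolding has_derivative_at
  proof
    show "bounded_linear ?D" by (intro bounded_linear_intros bounded_linear_Re bounded_linear_Im)
    have lim: "(\<lambda>v. C * norm v) \<midarrow>(0::complex)\<rightarrow> 0" by (auto intro!: tendsto_eq_intros)
    show "(\<lambda>v. norm (wave_sum c N (z + v) - wave_sum c N z - ?D v) / norm v) \<midarrow>0\<rightarrow> 0"
    proof (rule Lim_null_comparison[OF _ lim], rule always_eventually, rule allI)
      fix v :: complex
      show "norm (norm (wave_sum c N (z + v) - wave_sum c N z - ?D v) / norm v) \<le> C * norm v"
        using bound[of v] C0 by (cases "v = 0") (auto simp: field_simps power2_eq_square)
    qed
  qed
qed

lemma smooth_on_wave_sum:
  assumes "rapid c N"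
  shows "smooth_on UNIV (wave_sum c N)"
proof -
  have "times_differentiable_on k UNIV (wave_sum c N)" for k
    using assms
  proof (induction k arbitrary: c)
    case 0
    then show ?case
      by (auto intro!: continuous_at_imp_continuous_on dest: wave_sum_has_derivative has_derivative_continuous)
  next
    case (Suc k)
    show ?case
    proof (rule times_differentiable_on_SucI[OF open_UNIV wave_sum_has_derivative[OF Suc.prems]])
      fix v
      show "times_differentiable_on k UNIV (\<lambda>z. Re v *\<^sub>R wave_sum (\<lambda>i. \<i> * of_real (N i \<bullet> 1) * c i) N z
       + Im v *\<^sub>R wave_sum (\<lambda>i. \<i> * of_real (N i \<bullet> \<i>) * c i) N z)"
        by (intro times_differentiable_on_add times_differentiable_on_bounded_linear[OF bounded_linear_scaleR_right]
            open_UNIV Suc.IH rapid_mult_freq Suc.prems)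
    qed
  qed
  then show ?thesis by (simp add: smooth_on_def)
qed

lemma summable_on_product:
  fixes f :: "'a \<Rightarrow> complex" and g :: "'b \<Rightarrow> complex"
  assumes "(\<lambda>x. norm (f x)) summable_on UNIV" "(\<lambda>x. norm (g x)) summable_on UNIV"
  shows "Infinite_Sum.abs_summable_on (\<lambda>(x, y). f x * g y) UNIV"
    and "(\<Sum>\<^sub>\<infinity>(x, y). f x * g y) = infsum f UNIV * infsum g UNIV"
proof -
  have "Infinite_Sum.abs_summable_on (\<lambda>(x, y). f x * g y) (UNIV \<times> UNIV)"
    unfolding Infinite_Sum.abs_summable_on_Sigma_iff
    using assms by (auto simp: norm_mult infsum_cmult_right' infsum_nonneg intro!: summable_on_cmult_right
        summable_on_cmult_left)
  then show *: "Infinite_Sum.abs_summable_on (\<lambda>(x, y). f x * g y) UNIV" by simp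
  have "(\<Sum>\<^sub>\<infinity>(x, y)\<in>UNIV \<times> UNIV. f x * g y) = (\<Sum>\<^sub>\<infinity>x. \<Sum>\<^sub>\<infinity>y. f x * g y)"
    by (rule infsum_Sigma'_banach[symmetric]) (use abs_summable_summable[OF *] in simp)
  then show "(\<Sum>\<^sub>\<infinity>(x, y). f x * g y) = infsum f UNIV * infsum g UNIV"
    by (simp add: infsum_cmult_right' infsum_cmult_left')
qed

section \<open>The Beltrami equation with small oscillation\<close>

text \<open>Expanding the j-th power of the sum by distributivity: a list of length j records which
  summand is taken from each factor.\<close>

lemma sum_prod_list_length:
  fixes b :: "'a \<Rightarrow> 'b::comm_semiring_1"
  assumes "finite S"
  shows "(\<Sum>xs | set xs \<subseteq> S \<and> length xs = j. prod_list (map b xs)) = (sum b S) ^ j"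
proof (induction j)
  case 0
  have "{xs. set xs \<subseteq> S \<and> length xs = 0} = {[]}" by auto
  then show ?case by simp
next
  case (Suc j)
  have "(\<Sum>xs | set xs \<subseteq> S \<and> length xs = Suc j. prod_list (map b xs))
      = (\<Sum>(xs, x) \<in> {xs. set xs \<subseteq> S \<and> length xs = j} \<times> S. prod_list (map b (x # xs)))"
    unfolding lists_length_Suc_eq by (subst sum.reindex) (auto simp: inj_on_def case_prod_beta)
  also have "\<dots> = (\<Sum>xs | set xs \<subseteq> S \<and> length xs = j. \<Sum>x\<in>S. b x * prod_list (map b xs))"
    by (simp add: sum.cartesian_product)
  also have "\<dots> = sum b S ^ Suc j"
    by (simp add: Suc.IH[symmetric] sum_distrib_right[symmetric] sum_distrib_left[symmetric])
  finally show ?case .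
qed

text \<open>Finitely many lists use finitely many letters and have bounded length, so their
  contribution is dominated by a partial sum of a geometric series.\<close>

lemma prod_list_summable:
  fixes b :: "'a \<Rightarrow> real"
  assumes "\<And>x. b x \<ge> 0" "b summable_on UNIV" "infsum b UNIV < 1"
  shows "(\<lambda>xs. prod_list (map b xs)) summable_on UNIV"
    and "(\<Sum>\<^sub>\<infinity>xs. prod_list (map b xs)) \<le> 1 / (1 - infsum b UNIV)"
proof -
  define B where "B = infsum b UNIV"
  have B: "0 \<le> B" "B < 1" unfolding B_def using assms by (auto intro: infsum_nonneg)
  have nn: "prod_list (map b xs) \<ge> 0" for xs by (induction xs) (auto simp: assms)
  have bd: "(\<Sum>xs\<in>F. prod_list (map b xs)) \<le> 1 / (1 - B)" if F: "finite F" for F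
  proof -
    define S where "S = (\<Union>xs\<in>F. set xs)"
    define L where "L = Max (insert 0 (length ` F))"
    have S: "finite S" using F by (auto simp: S_def)
    have SB: "sum b S \<le> B" "0 \<le> sum b S"
      unfolding B_def by (auto intro!: finite_sum_le_infsum S sum_nonneg assms)
    have fin: "finite {xs. set xs \<subseteq> S \<and> length xs = j}" for j
      using finite_lists_length_eq[OF S] by simp
    have "F \<subseteq> (\<Union>j\<in>{..L}. {xs. set xs \<subseteq> S \<and> length xs = j})"
      using F by (auto simp: S_def L_def)
    then have "(\<Sum>xs\<in>F. prod_list (map b xs)) \<le> (\<Sum>xs\<in>(\<Union>j\<in>{..L}. {xs. set xs \<subseteq> S \<and> length xs = j}). prod_list (map b xs))"
      by (intro sum_mono2) (use fin nn in auto)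
    also have "\<dots> = (\<Sum>j\<le>L. \<Sum>xs | set xs \<subseteq> S \<and> length xs = j. prod_list (map b xs))"
      by (subst sum.UNION_disjoint) (use fin in auto)
    also have "\<dots> = (\<Sum>j\<le>L. (sum b S) ^ j)"
      by (intro sum.cong refl sum_prod_list_length[OF S])
    also have "\<dots> \<le> (\<Sum>j\<le>L. B ^ j)" by (intro sum_mono power_mono SB)
    also have "\<dots> \<le> (\<Sum>j. B ^ j)"
      by (rule sum_le_suminf) (use B summable_geometric[of B] in auto)
    also have "\<dots> = 1 / (1 - B)" using B suminf_geometric[of B] by simp
    finally show ?thesis .
  qed
  show 1: "(\<lambda>xs. prod_list (map b xs)) summable_on UNIV"
    by (rule nonneg_bdd_above_summable_on) (use bd nn in \<open>auto simp: bdd_above_def\<close>)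
  show "(\<Sum>\<^sub>\<infinity>xs. prod_list (map b xs)) \<le> 1 / (1 - infsum b UNIV)"
    by (rule infsum_le_finite_sums[OF 1]) (use bd in \<open>auto simp: B_def\<close>)
qed

text \<open>1 + e x is the mean of 1 and 1 + x with weights 1 - e and e, and the k-th power is
  convex. Hence a small weight changes a coefficient sum only by a multiple of e.\<close>

lemma convex_weight:
  fixes x e :: real
  assumes "0 \<le> x" "0 \<le> e" "e \<le> 1"
  shows "(1 + e * x) ^ k \<le> (1 - e) + e * (1 + x) ^ k"
proof (induction k)
  case (Suc k)
  let ?p = "(1 + x) ^ k"
  have p: "?p \<ge> 1" using assms by simp
  have "(1 + e * x) ^ Suc k \<le> (1 + e * x) * ((1 - e) + e * ?p)"
    using Suc mult_left_mono[of _ _ "1 + e * x"] assms by simp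
  also have "\<dots> = (1 - e) + e * ((1 + x) * ?p) - e * x * (1 - e) * (?p - 1)"
    by (simp add: algebra_simps)
  also have "\<dots> \<le> (1 - e) + e * ((1 + x) * ?p)"
    using assms p by simp
  finally show ?case by simp
qed simp

text \<open>The function \<open>wave_sum k N\<close> is the oscillation of the Beltrami coefficient
  about its frozen value \<open>\<mu>\<^sub>0\<close>. The lattice condition separates nonzero
  frequencies from 0, and \<open>small\<close> controls the ratio of the Neumann series.\<close>

locale neumann =
  fixes k :: "'n \<Rightarrow> complex" and N :: "'n \<Rightarrow> complex" and \<mu>\<^sub>0 :: complex
  assumes rapid: "rapid k N"
    and lattice: "\<And>n. Re (N n) \<in> \<int>" "\<And>n. Im (N n) \<in> \<int>"
    and \<mu>\<^sub>0: "norm \<mu>\<^sub>0 < 1"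
    and small: "(\<Sum>\<^sub>\<infinity>n. norm (k n)) < (1 - norm \<mu>\<^sub>0) / 2"
begin

text \<open>The Fourier multiplier of the z-derivative composed with the inverse of (zbar-derivative
  minus \<open>\<mu>\<^sub>0\<close> times z-derivative). At frequency 0 it is 0, since division by
  zero yields zero.\<close>

definition symb :: "complex \<Rightarrow> complex" where
  "symb M = cnj M / (M - \<mu>\<^sub>0 * cnj M)"

definition freq :: "'n list \<Rightarrow> complex" where
  "freq ns = sum_list (map N ns)"

text \<open>The Neumann series for \<open>P = \<partial>w\<close> expanded completely: a list of frequencies of the
  coefficient contributes one exponential, whose frequency is the sum of the list.\<close>

primrec t :: "'n list \<Rightarrow> complex" where
  "t [] = 1"
| "t (n # ns) = symb (N n + freq ns) * (k n * t ns)"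

definition Q :: real where "Q = 1 / (1 - norm \<mu>\<^sub>0)"

lemma Q_pos: "Q > 0" using \<mu>\<^sub>0 by (simp add: Q_def)

lemma norm_denominator: "norm (M - \<mu>\<^sub>0 * cnj M) \<ge> norm M * (1 - norm \<mu>\<^sub>0)"
proof -
  have "norm M - norm (\<mu>\<^sub>0 * cnj M) \<le> norm (M - \<mu>\<^sub>0 * cnj M)" by (rule norm_triangle_ineq2)
  then show ?thesis by (simp add: norm_mult algebra_simps)
qed

lemma denominator_nonzero: "M \<noteq> 0 \<Longrightarrow> M - \<mu>\<^sub>0 * cnj M \<noteq> 0"
  using norm_denominator[of M] \<mu>\<^sub>0 by (auto simp: mult_le_0_iff)

lemma norm_symb: "norm (symb M) \<le> Q"
proof (cases "M = 0")
  case False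
  have "norm (symb M) \<le> norm M / (norm M * (1 - norm \<mu>\<^sub>0))"
    unfolding symb_def norm_divide complex_mod_cnj
    by (rule divide_left_mono[OF norm_denominator]) (use False \<mu>\<^sub>0 denominator_nonzero[OF False] in auto)
  then show ?thesis using False by (simp add: Q_def)
qed (use Q_pos in \<open>simp add: symb_def\<close>)

text \<open>The weight 1 + \<epsilon> |N| is submultiplicative under addition of frequencies, so it
  distributes over the letters of a list.\<close>

lemma norm_t_le:
  assumes "\<epsilon> \<ge> 0"
  shows "norm (t ns) * (1 + \<epsilon> * norm (freq ns)) ^ p
    \<le> prod_list (map (\<lambda>n. Q * norm (k n) * (1 + \<epsilon> * norm (N n)) ^ p) ns)"
proof (induction ns)
  case (Cons n ns)
  have "1 + \<epsilon> * norm (freq (n # ns)) \<le> 1 + \<epsilon> * norm (N n) + \<epsilon> * norm (freq ns)"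
    using mult_left_mono[OF norm_triangle_ineq[of "N n" "freq ns"] assms]
    by (simp add: freq_def algebra_simps)
  also have "\<dots> \<le> (1 + \<epsilon> * norm (N n)) * (1 + \<epsilon> * norm (freq ns))"
    using assms by (simp add: algebra_simps)
  finally have "(1 + \<epsilon> * norm (freq (n # ns))) ^ p \<le> ((1 + \<epsilon> * norm (N n)) * (1 + \<epsilon> * norm (freq ns))) ^ p"
    using assms by (intro power_mono) auto
  moreover have "norm (t (n # ns)) \<le> Q * norm (k n) * norm (t ns)"
    using mult_right_mono[OF norm_symb[of "N n + freq ns"], of "norm (k n) * norm (t ns)"]
    by (simp add: norm_mult mult.assoc)
  ultimately have "norm (t (n # ns)) * (1 + \<epsilon> * norm (freq (n # ns))) ^ p
    \<le> (Q * norm (k n) * norm (t ns)) * ((1 + \<epsilon> * norm (N n)) * (1 + \<epsilon> * norm (freq ns))) ^ p"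
    using assms Q_pos by (intro mult_mono) auto
  also have "\<dots> = (Q * norm (k n) * (1 + \<epsilon> * norm (N n)) ^ p) * (norm (t ns) * (1 + \<epsilon> * norm (freq ns)) ^ p)"
    by (simp add: power_mult_distrib mult_ac)
  also have "\<dots> \<le> (Q * norm (k n) * (1 + \<epsilon> * norm (N n)) ^ p) *
      prod_list (map (\<lambda>n. Q * norm (k n) * (1 + \<epsilon> * norm (N n)) ^ p) ns)"
    using Cons.IH assms Q_pos by (intro mult_left_mono) auto
  finally show ?case by simp
qed (simp add: freq_def)

definition B where "B = (\<Sum>\<^sub>\<infinity>n. Q * norm (k n))"

text \<open>The bound is 1/2 and not merely 1: \<open>rapid_t\<close> spends the other half on the
  weights, and \<open>P_0\<close> needs B / (1 - B) < 1.\<close>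

lemma B: "0 \<le> B" "B < 1 / 2"
proof -
  show "0 \<le> B" unfolding B_def using Q_pos by (intro infsum_nonneg) auto
  have "B = Q * (\<Sum>\<^sub>\<infinity>n. norm (k n))" unfolding B_def by (rule infsum_cmult_right')
  also have "\<dots> < 1 / 2" using small \<mu>\<^sub>0 by (simp add: Q_def field_simps)
  finally show "B < 1 / 2" .
qed

lemma rapid_t: "rapid t freq"
  unfolding rapid_def
proof
  fix p
  define C where "C = (\<Sum>\<^sub>\<infinity>n. Q * (norm (k n) * (1 + norm (N n)) ^ p))"
  have C0: "C \<ge> 0" unfolding C_def using Q_pos by (intro infsum_nonneg) auto
  \<comment> \<open>Makes \<open>\<epsilon> * C\<close> less than 1/2, so that the weighted ratio
    \<open>(1 - \<epsilon>) * B + \<epsilon> * C\<close> stays below 1.\<close>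
  define \<epsilon> where "\<epsilon> = 1 / (2 * (1 + C))"
  have \<epsilon>: "0 < \<epsilon>" "\<epsilon> \<le> 1" "\<epsilon> * C < 1 / 2" using C0 by (auto simp: \<epsilon>_def field_simps)
  let ?b = "\<lambda>n. Q * norm (k n) * (1 + \<epsilon> * norm (N n)) ^ p"
  let ?u = "\<lambda>n. (1 - \<epsilon>) * (Q * norm (k n)) + \<epsilon> * (Q * (norm (k n) * (1 + norm (N n)) ^ p))"
  have s1: "(\<lambda>n. (1 - \<epsilon>) * (Q * norm (k n))) summable_on UNIV"
    and s2: "(\<lambda>n. \<epsilon> * (Q * (norm (k n) * (1 + norm (N n)) ^ p))) summable_on UNIV"
    by (intro summable_on_cmult_right rapid_summable[OF rapid] rapidD[OF rapid])+
  have su: "?u summable_on UNIV" by (rule summable_on_add[OF s1 s2])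
  have le: "?b n \<le> ?u n" for n
    using mult_left_mono[OF convex_weight[of "norm (N n)" \<epsilon> p], of "Q * norm (k n)"] \<epsilon> Q_pos
    by (simp add: algebra_simps)
  have nn: "?b n \<ge> 0" for n using Q_pos \<epsilon> by simp
  have sb: "?b summable_on UNIV" by (rule summable_on_comparison_test[OF su le nn])
  have "infsum ?b UNIV \<le> infsum ?u UNIV" by (rule infsum_mono[OF sb su le])
  also have "\<dots> = (1 - \<epsilon>) * B + \<epsilon> * C"
    unfolding infsum_add[OF s1 s2] B_def C_def by (simp only: infsum_cmult_right')
  also have "\<dots> < 1"
    using B \<epsilon> mult_left_le_one_le[of B "1 - \<epsilon>"] by auto
  finally have lt: "infsum ?b UNIV < 1" .
  have S: "(\<lambda>ns. inverse \<epsilon> ^ p * prod_list (map ?b ns)) summable_on UNIV"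
    by (intro summable_on_cmult_right prod_list_summable[OF nn sb lt])
  show "(\<lambda>ns. norm (t ns) * (1 + norm (freq ns)) ^ p) summable_on UNIV"
  proof (rule summable_on_comparison_test[OF S])
    fix ns
    \<comment> \<open>Returning from the weight with \<epsilon> to the weight with 1 costs only the
      constant factor \<open>inverse \<epsilon> ^ p\<close>.\<close>
    have "\<epsilon> * (1 + norm (freq ns)) \<le> 1 + \<epsilon> * norm (freq ns)"
      using \<epsilon> by (simp add: algebra_simps)
    then have "1 + norm (freq ns) \<le> inverse \<epsilon> * (1 + \<epsilon> * norm (freq ns))"
      using \<epsilon> by (simp add: field_simps)
    then have "norm (t ns) * (1 + norm (freq ns)) ^ p \<le> norm (t ns) * (inverse \<epsilon> * (1 + \<epsilon> * norm (freq ns))) ^ p"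
      by (intro mult_left_mono power_mono) auto
    also have "\<dots> = inverse \<epsilon> ^ p * (norm (t ns) * (1 + \<epsilon> * norm (freq ns)) ^ p)"
      by (simp only: power_mult_distrib mult_ac)
    also have "\<dots> \<le> inverse \<epsilon> ^ p * prod_list (map ?b ns)"
      using \<epsilon> norm_t_le[of \<epsilon> ns p] by (intro mult_left_mono) auto
    finally show "norm (t ns) * (1 + norm (freq ns)) ^ p \<le> inverse \<epsilon> ^ p * prod_list (map ?b ns)" .
  qed auto
qed

abbreviation P where "P \<equiv> wave_sum t freq"

lemma lists_UNIV: "UNIV = insert [] (range (\<lambda>(n, ns). n # ns))"
  by (auto simp: image_iff) (metis neq_Nil_conv surj_pair case_prod_conv)

text \<open>Separating the empty list from the others turns the explicit series into the fixed point
  equation \<open>P_eq\<close>.\<close>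

lemma infsum_lists:
  fixes f :: "'n list \<Rightarrow> complex"
  assumes "f summable_on UNIV"
  shows "infsum f UNIV = f [] + (\<Sum>\<^sub>\<infinity>(n, ns). f (n # ns))"
proof -
  have "infsum f UNIV = f [] + infsum f (range (\<lambda>(n, ns). n # ns))"
    by (subst lists_UNIV, rule infsum_insert) (auto intro: summable_on_subset_banach[OF assms])
  also have "infsum f (range (\<lambda>(n, ns). n # ns)) = (\<Sum>\<^sub>\<infinity>(n, ns). f (n # ns))"
    by (subst infsum_reindex) (auto simp: inj_on_def o_def case_prod_beta')
  finally show ?thesis .
qed

text \<open>The empty list contributes 1, and all other lists together contribute at most B / (1 -
  B), which is less than 1.\<close>

lemma P_0: "P 0 \<noteq> 0"
proof -
  have sb: "(\<lambda>n. Q * norm (k n)) summable_on UNIV"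
    by (intro summable_on_cmult_right rapid_summable[OF rapid])
  let ?b = "\<lambda>n. Q * norm (k n)"
  have bp: "?b n \<ge> 0" for n using Q_pos by simp
  have B1: "infsum ?b UNIV < 1" using B by (simp add: B_def)
  note pl = prod_list_summable[OF bp sb B1]
  have st: "t summable_on UNIV" by (rule abs_summable_summable[OF rapid_summable[OF rapid_t]])
  have "P 0 = infsum t (insert [] (UNIV - {[]}))" by (simp add: wave_sum_def insert_absorb)
  also have "\<dots> = 1 + infsum t (UNIV - {[]})"
    by (subst infsum_insert) (auto intro: summable_on_subset_banach[OF st])
  finally have 1: "P 0 = 1 + infsum t (UNIV - {[]})" .
  have a: "Infinite_Sum.abs_summable_on t (UNIV - {[]})"
    by (rule summable_on_subset_banach[OF rapid_summable[OF rapid_t]]) auto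
  have b: "(\<lambda>ns. prod_list (map ?b ns)) summable_on (UNIV - {[]})"
    by (rule summable_on_subset_banach[OF pl(1)]) auto
  have "norm (infsum t (UNIV - {[]})) \<le> (\<Sum>\<^sub>\<infinity>ns\<in>UNIV - {[]}. norm (t ns))"
    by (rule Infinite_Sum.norm_infsum_bound[OF a])
  also have "\<dots> \<le> (\<Sum>\<^sub>\<infinity>ns\<in>UNIV - {[]}. prod_list (map ?b ns))"
    by (rule infsum_mono[OF a b]) (use norm_t_le[of 0 _ 0] in simp)
  also have "\<dots> = (\<Sum>\<^sub>\<infinity>ns\<in>insert [] (UNIV - {[]}). prod_list (map ?b ns)) - 1"
    by (subst infsum_insert[OF b]) auto
  also have "\<dots> \<le> 1 / (1 - B) - 1" using pl(2) by (simp add: insert_absorb B_def)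
  also have "\<dots> < 1" using B by (simp add: field_simps)
  finally have "norm (infsum t (UNIV - {[]})) < 1" .
  then have "infsum t (UNIV - {[]}) \<noteq> - 1" by auto
  then show ?thesis unfolding 1 by (simp add: eq_neg_iff_add_eq_0 add.commute)
qed

text \<open>Frequencies of the product of the oscillation with P, one for each pair of summands;
  \<open>c2\<close> gives the corresponding coefficients. Pairs with equal frequency are kept
  apart.\<close>

definition N2 :: "'n \<times> 'n list \<Rightarrow> complex" where
  "N2 = (\<lambda>(n, ns). N n + freq ns)"

definition c2 :: "'n \<times> 'n list \<Rightarrow> complex" where
  "c2 = (\<lambda>(n, ns). k n * t ns)"

lemma t_Cons: "t (n # ns) = symb (N2 (n, ns)) * c2 (n, ns)" "freq (n # ns) = N2 (n, ns)"
  by (simp_all add: N2_def c2_def freq_def)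

lemma rapid_c2: "rapid c2 N2"
  unfolding rapid_def
proof
  fix p
  have nrm: "norm (complex_of_real (norm a * (1 + norm b) ^ p)) = norm a * (1 + norm b) ^ p" for a b :: complex
    by (simp only: norm_of_real) simp
  have *: "Infinite_Sum.abs_summable_on (\<lambda>(n, ns). complex_of_real (norm (k n) * (1 + norm (N n)) ^ p)
      * of_real (norm (t ns) * (1 + norm (freq ns)) ^ p)) UNIV"
    by (intro summable_on_product; simp only: nrm) (rule rapidD[OF rapid] rapidD[OF rapid_t])+
  show "(\<lambda>i. norm (c2 i) * (1 + norm (N2 i)) ^ p) summable_on UNIV"
  proof (rule summable_on_comparison_test[OF *])
    fix i :: "'n \<times> 'n list"
    obtain n ns where i: "i = (n, ns)" by force
    have "1 + norm (N n + freq ns) \<le> 1 + norm (N n) + norm (freq ns)"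
      using norm_triangle_ineq[of "N n" "freq ns"] by simp
    also have "\<dots> \<le> (1 + norm (N n)) * (1 + norm (freq ns))" by (simp add: algebra_simps)
    finally have "norm (c2 i) * (1 + norm (N2 i)) ^ p \<le> norm (c2 i) * ((1 + norm (N n)) * (1 + norm (freq ns))) ^ p"
      by (intro mult_left_mono power_mono) (auto simp: i N2_def)
    then show "norm (c2 i) * (1 + norm (N2 i)) ^ p \<le> norm (case i of (n, ns) \<Rightarrow>
        complex_of_real (norm (k n) * (1 + norm (N n)) ^ p) * of_real (norm (t ns) * (1 + norm (freq ns)) ^ p))"
      by (simp only: i c2_def norm_mult[of "of_real _"] nrm case_prod_conv power_mult_distrib)
        (simp add: norm_mult mult_ac)
  qed auto
qed

lemma N2_lattice: "Re (N2 i) \<in> \<int>" "Im (N2 i) \<in> \<int>"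
proof -
  have "Re (freq ns) \<in> \<int> \<and> Im (freq ns) \<in> \<int>" for ns
    by (induction ns) (auto simp: freq_def lattice)
  then show "Re (N2 i) \<in> \<int>" "Im (N2 i) \<in> \<int>" by (auto simp: N2_def lattice split: prod.split)
qed

lemma norm_N2: "N2 i \<noteq> 0 \<Longrightarrow> norm (N2 i) \<ge> 1"
proof -
  assume "N2 i \<noteq> 0"
  then have "Re (N2 i) \<noteq> 0 \<or> Im (N2 i) \<noteq> 0" by (auto simp: complex_eq_iff)
  then have "\<bar>Re (N2 i)\<bar> \<ge> 1 \<or> \<bar>Im (N2 i)\<bar> \<ge> 1" using N2_lattice Ints_nonzero_abs_ge1 by blast
  then show ?thesis using abs_Re_le_cmod[of "N2 i"] abs_Im_le_cmod[of "N2 i"] by linarith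
qed

text \<open>\<open>c2\<close> divided by (i/2) (M - \<open>\<mu>\<^sub>0\<close> cnj M) with M =
  \<open>N2 i\<close>, the symbol of the constant coefficient operator; at M = 0 the value is 0 by
  convention.\<close>

definition d2 :: "'n \<times> 'n list \<Rightarrow> complex" where
  "d2 i = (- 2 * \<i>) * c2 i / (N2 i - \<mu>\<^sub>0 * cnj (N2 i))"

text \<open>Nonzero lattice points have modulus at least 1, so the denominator is there at least
  \<open>1 - norm \<mu>\<^sub>0\<close>: no small divisors occur.\<close>

lemma rapid_d2: "rapid d2 N2"
proof (rule rapid_mono[OF rapid_c2, of _ "2 * Q" 0])
  fix i
  show "norm (d2 i) \<le> 2 * Q * norm (c2 i) * (1 + norm (N2 i)) ^ 0"
  proof (cases "N2 i = 0")
    case True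
    then show ?thesis using Q_pos by (simp add: d2_def)
  next
    case False
    have "1 - norm \<mu>\<^sub>0 \<le> norm (N2 i) * (1 - norm \<mu>\<^sub>0)"
      using norm_N2[OF False] \<mu>\<^sub>0 by simp
    then have "1 - norm \<mu>\<^sub>0 \<le> norm (N2 i - \<mu>\<^sub>0 * cnj (N2 i))" using norm_denominator[of "N2 i"] by linarith
    then have "norm (d2 i) \<le> norm ((- 2 * \<i>) * c2 i) / (1 - norm \<mu>\<^sub>0)"
      unfolding d2_def norm_divide using \<mu>\<^sub>0 by (intro divide_left_mono mult_pos_pos) auto
    then show ?thesis by (simp add: Q_def norm_mult)
  qed
qed

text \<open>The zero-frequency part of the product of the oscillation with P, which is not in the
  range of the operator on periodic functions. In \<open>w\<close> it becomes part of the
  coefficient of \<open>cnj z\<close>, a term without z-derivative.\<close>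

definition h0 :: complex where
  "h0 = (\<Sum>\<^sub>\<infinity>i. if N2 i = 0 then c2 i else 0)"

definition w :: "complex \<Rightarrow> complex" where
  "w z = z + (\<mu>\<^sub>0 + h0) * cnj z + wave_sum d2 N2 z"

text \<open>The recursion of \<open>t\<close> summed over the nonempty lists: P is 1 plus the
  multiplier \<open>symb\<close> applied to the product expanded in
  \<open>\<kappa>P_eq\<close>.\<close>

lemma P_eq: "P z = 1 + (\<Sum>\<^sub>\<infinity>i. symb (N2 i) * c2 i * plane_wave (N2 i) z)"
  unfolding wave_sum_def
  by (subst infsum_lists[OF wave_sum_summable[OF rapid_summable[OF rapid_t]]])
    (simp add: t_Cons freq_def[of "[]"] del: t.simps(2), rule infsum_cong, auto)

lemma \<kappa>P_eq: "wave_sum k N z * P z = (\<Sum>\<^sub>\<infinity>i. c2 i * plane_wave (N2 i) z)"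
proof -
  have "wave_sum k N z * P z = (\<Sum>\<^sub>\<infinity>(n, ns). (k n * plane_wave (N n) z) * (t ns * plane_wave (freq ns) z))"
    unfolding wave_sum_def using rapid_summable[OF rapid] rapid_summable[OF rapid_t]
    by (subst summable_on_product) (auto simp: norm_mult)
  also have "\<dots> = (\<Sum>\<^sub>\<infinity>i. c2 i * plane_wave (N2 i) z)"
    by (intro infsum_cong) (auto simp: c2_def N2_def plane_wave_add)
  finally show ?thesis .
qed

lemma w_has_derivative:
  "(w has_derivative (\<lambda>v. v + (\<mu>\<^sub>0 + h0) * cnj v
    + (Re v *\<^sub>R wave_sum (\<lambda>i. \<i> * of_real (N2 i \<bullet> 1) * d2 i) N2 z
       + Im v *\<^sub>R wave_sum (\<lambda>i. \<i> * of_real (N2 i \<bullet> \<i>) * d2 i) N2 z))) (at z)"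
proof -
  have c: "(cnj has_derivative cnj) (at z)"
    by (rule bounded_linear_imp_has_derivative[OF bounded_linear_cnj])
  show ?thesis
    unfolding w_def[abs_def]
    by (intro has_derivative_add has_derivative_ident has_derivative_mult_right c wave_sum_has_derivative rapid_d2)
qed

text \<open>X and Y are the partial derivatives of the periodic part of \<open>w\<close>. Termwise,
  with M = \<open>N2 i\<close>, the second identity is M / (M - \<open>\<mu>\<^sub>0\<close> cnj M)
  = 1 + \<open>\<mu>\<^sub>0\<close> symb M, valid for nonzero M.\<close>

lemma wave_derivs:
  fixes z
  defines "X \<equiv> wave_sum (\<lambda>i. \<i> * of_real (N2 i \<bullet> 1) * d2 i) N2 z"
    and "Y \<equiv> wave_sum (\<lambda>i. \<i> * of_real (N2 i \<bullet> \<i>) * d2 i) N2 z"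
  shows "(X - \<i> * Y) / 2 = (\<Sum>\<^sub>\<infinity>i. symb (N2 i) * c2 i * plane_wave (N2 i) z)"
    and "(X + \<i> * Y) / 2 = (\<Sum>\<^sub>\<infinity>i. (if N2 i = 0 then 0 else c2 i * plane_wave (N2 i) z)
            + \<mu>\<^sub>0 * (symb (N2 i) * c2 i * plane_wave (N2 i) z))"
proof -
  note s = wave_sum_summable[OF rapid_summable[OF rapid_mult_freq[OF rapid_d2]]]
  have "(X - \<i> * Y) / 2 = (\<Sum>\<^sub>\<infinity>i. (\<i> * of_real (N2 i \<bullet> 1) * d2 i * plane_wave (N2 i) z
      - \<i> * (\<i> * of_real (N2 i \<bullet> \<i>) * d2 i * plane_wave (N2 i) z)) * (1/2))"
    unfolding X_def Y_def wave_sum_def infsum_cmult_left'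
    by (subst infsum_minus_diff(1)[OF s summable_on_cmult_right[OF s]]) (simp add: infsum_cmult_right')
  also have "\<dots> = (\<Sum>\<^sub>\<infinity>i. symb (N2 i) * c2 i * plane_wave (N2 i) z)"
  proof (intro infsum_cong)
    fix i
    have "of_real (N2 i \<bullet> 1) - \<i> * of_real (N2 i \<bullet> \<i>) = cnj (N2 i)"
      by (simp add: complex_eq_iff inner_complex_def)
    then have "(\<i> * of_real (N2 i \<bullet> 1) * d2 i * plane_wave (N2 i) z
      - \<i> * (\<i> * of_real (N2 i \<bullet> \<i>) * d2 i * plane_wave (N2 i) z)) * (1/2)
      = (\<i> / 2) * cnj (N2 i) * d2 i * plane_wave (N2 i) z"
      by (simp add: field_simps)
    also have "\<dots> = symb (N2 i) * c2 i * plane_wave (N2 i) z"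
      by (simp add: symb_def d2_def field_simps)
    finally show "(\<i> * of_real (N2 i \<bullet> 1) * d2 i * plane_wave (N2 i) z
      - \<i> * (\<i> * of_real (N2 i \<bullet> \<i>) * d2 i * plane_wave (N2 i) z)) * (1/2)
      = symb (N2 i) * c2 i * plane_wave (N2 i) z" .
  qed
  finally show "(X - \<i> * Y) / 2 = (\<Sum>\<^sub>\<infinity>i. symb (N2 i) * c2 i * plane_wave (N2 i) z)" .
  have "(X + \<i> * Y) / 2 = (\<Sum>\<^sub>\<infinity>i. (\<i> * of_real (N2 i \<bullet> 1) * d2 i * plane_wave (N2 i) z
      + \<i> * (\<i> * of_real (N2 i \<bullet> \<i>) * d2 i * plane_wave (N2 i) z)) * (1/2))"
    unfolding X_def Y_def wave_sum_def infsum_cmult_left'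
    by (subst infsum_add[OF s summable_on_cmult_right[OF s]]) (simp add: infsum_cmult_right')
  also have "\<dots> = (\<Sum>\<^sub>\<infinity>i. (if N2 i = 0 then 0 else c2 i * plane_wave (N2 i) z)
            + \<mu>\<^sub>0 * (symb (N2 i) * c2 i * plane_wave (N2 i) z))"
  proof (intro infsum_cong)
    fix i
    have N2: "of_real (N2 i \<bullet> 1) + \<i> * of_real (N2 i \<bullet> \<i>) = N2 i"
      by (simp add: complex_eq_iff inner_complex_def)
    have "(\<i> * of_real (N2 i \<bullet> 1) * d2 i * plane_wave (N2 i) z
      + \<i> * (\<i> * of_real (N2 i \<bullet> \<i>) * d2 i * plane_wave (N2 i) z)) * (1/2)
      = (\<i> / 2) * (of_real (N2 i \<bullet> 1) + \<i> * of_real (N2 i \<bullet> \<i>)) * d2 i * plane_wave (N2 i) z"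
      by (simp add: algebra_simps)
    also have "\<dots> = (\<i> / 2) * N2 i * d2 i * plane_wave (N2 i) z" by (simp only: N2)
    also have "\<dots> = (if N2 i = 0 then 0 else c2 i * plane_wave (N2 i) z)
            + \<mu>\<^sub>0 * (symb (N2 i) * c2 i * plane_wave (N2 i) z)"
      using denominator_nonzero[of "N2 i"] by (simp add: symb_def d2_def field_simps)
    finally show "(\<i> * of_real (N2 i \<bullet> 1) * d2 i * plane_wave (N2 i) z
      + \<i> * (\<i> * of_real (N2 i \<bullet> \<i>) * d2 i * plane_wave (N2 i) z)) * (1/2)
      = (if N2 i = 0 then 0 else c2 i * plane_wave (N2 i) z)
            + \<mu>\<^sub>0 * (symb (N2 i) * c2 i * plane_wave (N2 i) z)" .
  qed
  finally show "(X + \<i> * Y) / 2 = (\<Sum>\<^sub>\<infinity>i. (if N2 i = 0 then 0 else c2 i * plane_wave (N2 i) z)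
            + \<mu>\<^sub>0 * (symb (N2 i) * c2 i * plane_wave (N2 i) z))" .
qed

lemma deriv_z_w: "deriv_z w z = P z"
  unfolding deriv_z_def frechet_derivative_at[OF w_has_derivative, symmetric] P_eq wave_derivs(1)[symmetric]
  by (simp add: field_simps)

lemma deriv_zbar_w: "deriv_zbar w z = (\<mu>\<^sub>0 + wave_sum k N z) * deriv_z w z"
proof -
  have s1: "(\<lambda>i. symb (N2 i) * c2 i * plane_wave (N2 i) z) summable_on UNIV"
  proof (rule wave_sum_summable[OF rapid_summable[OF rapid_mono[OF rapid_c2, of _ Q 0]]])
    show "norm (symb (N2 i) * c2 i) \<le> Q * norm (c2 i) * (1 + norm (N2 i)) ^ 0" for i
      using norm_symb by (simp add: norm_mult mult_right_mono)
  qed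
  have s: "Infinite_Sum.abs_summable_on (\<lambda>i. c2 i * plane_wave (N2 i) z) UNIV"
    using rapid_summable[OF rapid_c2] by (simp add: norm_mult)
  have s2: "(\<lambda>i. if N2 i = 0 then 0 else c2 i * plane_wave (N2 i) z) summable_on UNIV"
    by (rule abs_summable_summable, rule Infinite_Sum.abs_summable_on_comparison_test[OF s]) auto
  have s3: "(\<lambda>i. if N2 i = 0 then c2 i else 0) summable_on UNIV"
    by (rule abs_summable_summable, rule Infinite_Sum.abs_summable_on_comparison_test[OF s]) (auto simp: norm_mult)
  have "deriv_zbar w z = \<mu>\<^sub>0 + h0 + (\<Sum>\<^sub>\<infinity>i. (if N2 i = 0 then 0 else c2 i * plane_wave (N2 i) z)
            + \<mu>\<^sub>0 * (symb (N2 i) * c2 i * plane_wave (N2 i) z))"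
    unfolding deriv_zbar_def frechet_derivative_at[OF w_has_derivative, symmetric] wave_derivs(2)[symmetric]
    by (simp add: field_simps)
  also have "\<dots> = (h0 + (\<Sum>\<^sub>\<infinity>i. (if N2 i = 0 then 0 else c2 i * plane_wave (N2 i) z))) + \<mu>\<^sub>0 * P z"
    unfolding P_eq infsum_add[OF s2 summable_on_cmult_right[OF s1]] infsum_cmult_right' by (simp add: algebra_simps)
  \<comment> \<open>The zero-frequency terms that the periodic part could not supply are restored by
    \<open>h0\<close>.\<close>
  also have "h0 + (\<Sum>\<^sub>\<infinity>i. (if N2 i = 0 then 0 else c2 i * plane_wave (N2 i) z))
      = (\<Sum>\<^sub>\<infinity>i. c2 i * plane_wave (N2 i) z)"
    unfolding h0_def infsum_add[OF s3 s2, symmetric] by (intro infsum_cong) auto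
  also have "\<dots> = wave_sum k N z * P z" by (rule \<kappa>P_eq[symmetric])
  finally show ?thesis by (simp add: deriv_z_w algebra_simps)
qed

lemma smooth_w: "smooth_on UNIV w"
proof -
  have "smooth_on UNIV (\<lambda>z. z + (\<mu>\<^sub>0 + h0) * cnj z + wave_sum d2 N2 z)"
    by (intro smooth_intros open_UNIV smooth_on_wave_sum rapid_d2)
  then show ?thesis by (simp add: w_def[abs_def])
qed

end

section \<open>Fourier series of smooth periodic functions of two variables\<close>

definition cell_integral :: "(complex \<Rightarrow> complex) \<Rightarrow> complex" where
  "cell_integral g = integral (cbox (- pi, - pi) (pi, pi)) (\<lambda>(x, y). g (Complex x y))"

definition torus_freq :: "int \<times> int \<Rightarrow> complex" where
  "torus_freq = (\<lambda>(m, n). Complex (of_int m) (of_int n))"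

definition periodic :: "(complex \<Rightarrow> 'a) \<Rightarrow> bool" where
  "periodic f \<longleftrightarrow> (\<forall>z. f (z + of_real (2 * pi)) = f z \<and> f (z + of_real (2 * pi) * \<i>) = f z)"

definition fcoeff :: "(complex \<Rightarrow> complex) \<Rightarrow> int \<times> int \<Rightarrow> complex" where
  "fcoeff f k = cell_integral (\<lambda>z. f z * plane_wave (- torus_freq k) z) / (2 * pi)\<^sup>2"

section \<open>Integration over one period cell\<close>

lemma continuous_on_Complex_fst_snd:
  assumes "continuous_on UNIV g"
  shows "continuous_on S (\<lambda>(x, y). g (Complex x y))"
proof -
  have "continuous_on S (\<lambda>p::real \<times> real. g (of_real (fst p) + \<i> * of_real (snd p)))"
    by (rule continuous_on_compose2[OF assms]) (auto intro!: continuous_intros)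
  then show ?thesis by (simp add: case_prod_beta' Complex_eq)
qed

lemma cell_integrable:
  fixes g :: "complex \<Rightarrow> 'a::banach"
  shows "continuous_on UNIV g \<Longrightarrow> (\<lambda>(x, y). g (Complex x y)) integrable_on cbox (- pi, - pi) (pi, pi)"
  by (rule integrable_continuous) (rule continuous_on_Complex_fst_snd)

lemma cell_integral_add:
  assumes "continuous_on UNIV f" "continuous_on UNIV g"
  shows "cell_integral (\<lambda>z. f z + g z) = cell_integral f + cell_integral g"
  using integral_add[OF cell_integrable[OF assms(1)] cell_integrable[OF assms(2)]]
  by (simp add: cell_integral_def case_prod_beta')

lemma cell_integral_diff:
  assumes "continuous_on UNIV f" "continuous_on UNIV g"
  shows "cell_integral (\<lambda>z. f z - g z) = cell_integral f - cell_integral g"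
  using integral_diff[OF cell_integrable[OF assms(1)] cell_integrable[OF assms(2)]]
  by (simp add: cell_integral_def case_prod_beta')

lemma cell_integral_cmult: "cell_integral (\<lambda>z. c * f z) = c * cell_integral f"
  by (simp add: cell_integral_def case_prod_beta')

lemma cell_integral_sum:
  assumes "finite F" "\<And>i. i \<in> F \<Longrightarrow> continuous_on UNIV (f i)"
  shows "cell_integral (\<lambda>z. \<Sum>i\<in>F. f i z) = (\<Sum>i\<in>F. cell_integral (f i))"
  using assms
proof (induction F rule: finite_induct)
  case (insert a F)
  then show ?case
    by (simp add: cell_integral_add[of "f a" "\<lambda>z. \<Sum>i\<in>F. f i z"] continuous_on_sum)
qed (simp add: cell_integral_def case_prod_beta')

lemma content_cell: "Henstock_Kurzweil_Integration.content (cbox (- pi, - pi) (pi, pi)) = (2 * pi)\<^sup>2"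
  by (simp add: content_Pair power2_eq_square)

lemma norm_cell_integral_le:
  assumes "continuous_on UNIV g" "C \<ge> 0"
    and "\<And>x y. - pi \<le> x \<Longrightarrow> x \<le> pi \<Longrightarrow> - pi \<le> y \<Longrightarrow> y \<le> pi \<Longrightarrow> norm (g (Complex x y)) \<le> C"
  shows "norm (cell_integral g) \<le> C * (2 * pi)\<^sup>2"
proof -
  have "norm (cell_integral g) \<le> C * Henstock_Kurzweil_Integration.content (cbox (- pi, - pi) (pi, pi))"
    unfolding cell_integral_def
    by (rule has_integral_bound[OF assms(2) integrable_integral[OF cell_integrable[OF assms(1)]]])
      (use assms(3) in auto)
  then show ?thesis by (simp only: content_cell)
qed

lemma cell_integral_one: "cell_integral (\<lambda>_. 1) = (2 * pi)\<^sup>2"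
  unfolding cell_integral_def by (simp add: case_prod_beta' content_cell del: power_mult_distrib)
    (simp add: power2_eq_square scaleR_conv_of_real)

lemma has_vector_derivative_line:
  assumes "smooth_on UNIV H"
  shows "((\<lambda>s. H (a + of_real s * v)) has_vector_derivative dd H v (a + of_real s * v)) (at s within S)"
proof -
  have H: "(H has_derivative frechet_derivative H (at (a + of_real s * v))) (at (a + of_real s * v))"
    by (rule smooth_on_has_derivative[OF assms]) simp
  have "((\<lambda>s. H (a + of_real s * v)) has_derivative
      (\<lambda>x. frechet_derivative H (at (a + of_real s * v)) (of_real x * v))) (at s within S)"
    by (rule has_derivative_compose[where f = "\<lambda>s. a + of_real s * v" and g = H, OF _ H])
      (auto intro!: derivative_eq_intros has_derivative_of_real)
  moreover have "frechet_derivative H (at (a + of_real s * v)) (of_real x * v) = x *\<^sub>R dd H v (a + of_real s * v)" for x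
    using linear_scale[OF has_derivative_linear[OF H]] by (simp add: scaleR_conv_of_real[symmetric])
  ultimately show ?thesis by (simp add: has_vector_derivative_def)
qed

lemma periodic_cell_edges:
  assumes "periodic f"
  shows "f (Complex pi y) = f (Complex (- pi) y)" "f (Complex x pi) = f (Complex x (- pi))"
proof -
  have "Complex pi y = Complex (- pi) y + of_real (2 * pi)" "Complex x pi = Complex x (- pi) + of_real (2 * pi) * \<i>"
    by (simp_all add: complex_eq_iff)
  then show "f (Complex pi y) = f (Complex (- pi) y)" "f (Complex x pi) = f (Complex x (- pi))"
    using assms unfolding periodic_def by metis+
qed

text \<open>The fundamental theorem of calculus on lines in direction v leaves boundary values,
  which cancel by periodicity.\<close>

lemma cell_integral_dd:
  assumes H: "smooth_on UNIV H" "periodic H" and v: "v \<in> {1, \<i>}"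
  shows "cell_integral (dd H v) = 0"
proof -
  have c: "continuous_on S (\<lambda>(x, y). dd H v (Complex x y))" for v S
    by (rule continuous_on_Complex_fst_snd) (rule smooth_on_continuous_on[OF smooth_on_dd[OF H(1)]])
  have x: "integral {- pi..pi} (\<lambda>x. dd H 1 (Complex x y)) = 0" for y
  proof -
    have "((\<lambda>x. dd H 1 (\<i> * of_real y + of_real x * 1)) has_integral
        H (\<i> * of_real y + of_real pi * 1) - H (\<i> * of_real y + of_real (- pi) * 1)) {- pi..pi}"
      by (rule fundamental_theorem_of_calculus) (simp, rule has_vector_derivative_line[OF H(1)])
    moreover have "H (\<i> * of_real y + of_real pi * 1) = H (\<i> * of_real y + of_real (- pi) * 1)"
      using periodic_cell_edges(1)[OF H(2), of y] by (simp add: Complex_eq algebra_simps)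
    ultimately show ?thesis by (simp add: Complex_eq algebra_simps integral_unique)
  qed
  have y: "integral {- pi..pi} (\<lambda>y. dd H \<i> (Complex x y)) = 0" for x
  proof -
    have "((\<lambda>y. dd H \<i> (of_real x + of_real y * \<i>)) has_integral
        H (of_real x + of_real pi * \<i>) - H (of_real x + of_real (- pi) * \<i>)) {- pi..pi}"
      by (rule fundamental_theorem_of_calculus) (simp, rule has_vector_derivative_line[OF H(1)])
    moreover have "H (of_real x + of_real pi * \<i>) = H (of_real x + of_real (- pi) * \<i>)"
      using periodic_cell_edges(2)[OF H(2), of x] by (simp add: Complex_eq algebra_simps)
    ultimately show ?thesis by (simp add: Complex_eq algebra_simps integral_unique)
  qed
  show ?thesis
  proof (cases "v = 1")
    case True
    \<comment> \<open>The iterated integral has y as the inner variable, so for the x-derivative the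
      order of integration is exchanged.\<close>
    have "cell_integral (dd H 1) = integral (cbox (- pi) pi) (\<lambda>x. integral (cbox (- pi) pi) (\<lambda>y. dd H 1 (Complex x y)))"
      unfolding cell_integral_def by (subst integral_prod_continuous[OF c]) simp
    also have "\<dots> = integral (cbox (- pi) pi) (\<lambda>y. integral (cbox (- pi) pi) (\<lambda>x. dd H 1 (Complex x y)))"
      by (rule integral_swap_continuous[OF c])
    finally show ?thesis using x True by simp
  next
    case False
    then have "v = \<i>" using v by simp
    moreover have "cell_integral (dd H \<i>) = integral (cbox (- pi) pi) (\<lambda>x. integral (cbox (- pi) pi) (\<lambda>y. dd H \<i> (Complex x y)))"
      unfolding cell_integral_def by (subst integral_prod_continuous[OF c]) simp
    ultimately show ?thesis using y by simp
  qed
qed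

lemma plane_wave_has_derivative:
  "(plane_wave N has_derivative (\<lambda>v. \<i> * of_real (N \<bullet> v) * plane_wave N z)) (at z)"
proof -
  have "((\<lambda>z. N \<bullet> z) has_derivative (\<lambda>v. N \<bullet> v)) (at z)"
    by (rule bounded_linear_imp_has_derivative[OF bounded_linear_inner_right])
  then have "((\<lambda>z. \<i> * of_real (N \<bullet> z)) has_derivative (\<lambda>v. \<i> * of_real (N \<bullet> v))) (at z)"
    by (intro has_derivative_mult_right has_derivative_of_real)
  then have "((\<lambda>z. exp (\<i> * of_real (N \<bullet> z))) has_derivative
      (\<lambda>v. exp (\<i> * of_real (N \<bullet> z)) * (\<i> * of_real (N \<bullet> v)))) (at z)"
    by (rule has_derivative_compose[OF _ DERIV_exp[unfolded has_field_derivative_def]])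
  then show ?thesis by (simp add: plane_wave_def[abs_def] cis_conv_exp mult.commute)
qed

lemma dd_plane_wave: "dd (plane_wave N) v z = \<i> * of_real (N \<bullet> v) * plane_wave N z"
  using frechet_derivative_at[OF plane_wave_has_derivative] by metis

lemma smooth_plane_wave: "smooth_on UNIV (plane_wave N)"
proof -
  have "times_differentiable_on k UNIV (\<lambda>z. c * plane_wave N z)" for k c
  proof (induction k arbitrary: c)
    case 0
    then show ?case
      using has_derivative_continuous[OF plane_wave_has_derivative]
      by (auto intro!: continuous_on_mult continuous_at_imp_continuous_on)
  next
    case (Suc k)
    show ?case
      by (rule times_differentiable_on_SucI[OF open_UNIV has_derivative_mult_right[OF plane_wave_has_derivative]])
        (use Suc.IH in \<open>simp only: mult.assoc[symmetric]\<close>)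
  qed
  from this[of _ 1] show ?thesis by (simp add: smooth_on_def)
qed

lemma continuous_plane_wave: "continuous_on S (plane_wave N)"
  using smooth_on_continuous_on[OF smooth_plane_wave] continuous_on_subset by blast

lemma periodic_plane_wave: "periodic (plane_wave (torus_freq k))" "periodic (plane_wave (- torus_freq k))"
proof -
  have *: "plane_wave N (2 * pi) = 1" "plane_wave N (of_real (2 * pi) * \<i>) = 1"
    if "Re N \<in> \<int>" "Im N \<in> \<int>" for N
    using that cis_multiple_2pi[of "Re N"] cis_multiple_2pi[of "Im N"]
    by (simp_all add: plane_wave_def inner_complex_def mult.commute mult.left_commute)
  show "periodic (plane_wave (torus_freq k))" "periodic (plane_wave (- torus_freq k))"
    using *[of "torus_freq k"] *[of "- torus_freq k"]
    by (auto simp: periodic_def plane_wave_add_right torus_freq_def case_prod_beta')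
qed

section \<open>Derivatives and decay of Fourier coefficients\<close>

lemma periodic_mult: "periodic f \<Longrightarrow> periodic g \<Longrightarrow> periodic (\<lambda>z. f z * g z :: complex)"
  by (simp add: periodic_def)

lemma periodic_dd:
  assumes "periodic f" "smooth_on UNIV f"
  shows "periodic (dd f v)"
proof -
  have "dd f v (z + c) = dd f v z" if c: "\<And>z. f (z + c) = f z" for z c
  proof -
    have "((\<lambda>z. f (z + c)) has_derivative frechet_derivative f (at (z + c))) (at z)"
      by (rule has_derivative_compose[where f = "\<lambda>z. z + c" and f' = "\<lambda>x. x" and g = f, simplified])
        (auto intro!: derivative_eq_intros smooth_on_has_derivative[OF assms(2)])
    then show ?thesis unfolding c using frechet_derivative_at by metis
  qed
  then show ?thesis using assms(1) by (simp add: periodic_def)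
qed

text \<open>Integration by parts: the derivative of f times the conjugate wave has integral zero
  over the cell.\<close>

lemma fcoeff_dd:
  assumes "smooth_on UNIV f" "periodic f" "v \<in> {1, \<i>}"
  shows "fcoeff (dd f v) k = \<i> * of_real (torus_freq k \<bullet> v) * fcoeff f k"
proof -
  let ?e = "plane_wave (- torus_freq k)"
  note c = smooth_on_continuous_on[OF assms(1)] smooth_on_continuous_on[OF smooth_on_dd[OF assms(1)]]
    continuous_plane_wave
  have "0 = cell_integral (dd (\<lambda>z. f z * ?e z) v)"
    by (rule cell_integral_dd[symmetric])
      (intro smooth_intros open_UNIV assms smooth_plane_wave periodic_mult periodic_plane_wave)+
  also have "dd (\<lambda>z. f z * ?e z) v = (\<lambda>z. (- \<i> * of_real (torus_freq k \<bullet> v)) * (f z * ?e z) + dd f v z * ?e z)"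
    using dd_bilinear[OF bounded_bilinear_mult assms(1) smooth_plane_wave UNIV_I]
    by (intro ext) (simp add: dd_plane_wave)
  also have "cell_integral \<dots> = (- \<i> * of_real (torus_freq k \<bullet> v)) * cell_integral (\<lambda>z. f z * ?e z)
      + cell_integral (\<lambda>z. dd f v z * ?e z)"
    by (subst cell_integral_add; (intro continuous_on_mult continuous_on_const c)?) (simp only: cell_integral_cmult)
  finally show ?thesis unfolding fcoeff_def by (simp add: field_simps)
qed

lemma fcoeff_diff:
  assumes "continuous_on UNIV f" "continuous_on UNIV g"
  shows "fcoeff (\<lambda>z. f z - g z) k = fcoeff f k - fcoeff g k"
  using cell_integral_diff[of "\<lambda>z. f z * plane_wave (- torus_freq k) z" "\<lambda>z. g z * plane_wave (- torus_freq k) z"] assms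
  by (simp add: fcoeff_def left_diff_distrib diff_divide_distrib continuous_on_mult continuous_plane_wave)

lemma norm_fcoeff_le:
  assumes "continuous_on UNIV f" "\<And>z. norm (f z) \<le> C"
  shows "norm (fcoeff f k) \<le> C"
proof -
  have C: "C \<ge> 0" using assms(2)[of 0] norm_ge_zero order_trans by blast
  have "norm (cell_integral (\<lambda>z. f z * plane_wave (- torus_freq k) z)) \<le> C * (2 * pi)\<^sup>2"
    by (rule norm_cell_integral_le) (use assms C in \<open>auto intro!: continuous_on_mult continuous_plane_wave simp: norm_mult\<close>)
  then show ?thesis unfolding fcoeff_def norm_divide
    by (simp add: norm_power norm_mult divide_le_eq del: power_mult_distrib)
qed

text \<open>The operator (1 - d^2/dx^2) (1 - d^2/dy^2). Its multiplier \<open>wt\<close> is a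
  product of one-dimensional factors, so summability of the inverse over the lattice reduces to
  one-dimensional series.\<close>

definition bessel :: "(complex \<Rightarrow> complex) \<Rightarrow> complex \<Rightarrow> complex" where
  "bessel f = (\<lambda>z. (f z - dd (dd f 1) 1 z) - dd (dd (\<lambda>z. f z - dd (dd f 1) 1 z) \<i>) \<i> z)"

lemma smooth_bessel_half: "smooth_on UNIV f \<Longrightarrow> smooth_on UNIV (\<lambda>z. f z - dd (dd f v) v z)"
  by (intro smooth_intros open_UNIV)

lemma periodic_bessel_half: "periodic f \<Longrightarrow> smooth_on UNIV f \<Longrightarrow> periodic (\<lambda>z. f z - dd (dd f v) v z)"
  using periodic_dd[OF periodic_dd[of f v] smooth_on_dd, of v] by (simp add: periodic_def)

lemma fcoeff_bessel_half:
  assumes "smooth_on UNIV f" "periodic f" "v \<in> {1, \<i>}"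
  shows "fcoeff (\<lambda>z. f z - dd (dd f v) v z) k = of_real (1 + (torus_freq k \<bullet> v)\<^sup>2) * fcoeff f k"
  using fcoeff_dd[OF smooth_on_dd[OF assms(1)] periodic_dd[OF assms(2,1)] assms(3)] fcoeff_dd[OF assms]
  by (simp add: fcoeff_diff smooth_on_continuous_on assms(1) smooth_on_dd algebra_simps power2_eq_square)

definition wt :: "int \<times> int \<Rightarrow> real" where
  "wt = (\<lambda>(m, n). (1 + (of_int m)\<^sup>2) * (1 + (of_int n)\<^sup>2))"

lemma wt_ge_1: "wt k \<ge> 1"
proof -
  obtain m n where k: "k = (m, n)" by force
  have "1 * 1 \<le> (1 + (real_of_int m)\<^sup>2) * (1 + (of_int n)\<^sup>2)" by (intro mult_mono) auto
  then show ?thesis by (simp add: wt_def k)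
qed

lemma fcoeff_bessel:
  assumes "smooth_on UNIV f" "periodic f"
  shows "fcoeff (bessel f) k = of_real (wt k) * fcoeff f k"
proof -
  obtain m n where k: "k = (m, n)" by force
  show ?thesis
    unfolding bessel_def
    using fcoeff_bessel_half[OF smooth_bessel_half[OF assms(1)] periodic_bessel_half[OF assms(2,1)], of \<i> 1 k]
      fcoeff_bessel_half[OF assms, of 1 k]
    by (simp add: k wt_def torus_freq_def mult_ac)
qed

lemma smooth_bessel: "smooth_on UNIV f \<Longrightarrow> smooth_on UNIV (bessel f)"
  unfolding bessel_def by (intro smooth_bessel_half)

lemma periodic_bessel: "periodic f \<Longrightarrow> smooth_on UNIV f \<Longrightarrow> periodic (bessel f)"
  unfolding bessel_def by (intro periodic_bessel_half smooth_bessel_half)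

text \<open>Converts a uniform bound on derivatives into absolutely summable coefficients with an
  explicit constant; this is how a small function acquires a small coefficient sum.\<close>

lemma norm_fcoeff_bessel_le:
  assumes "smooth_on UNIV f" "periodic f" "\<And>z. norm (bessel f z) \<le> C"
  shows "norm (fcoeff f k) \<le> C * (1 / wt k)"
  using norm_fcoeff_le[OF smooth_on_continuous_on[OF smooth_bessel[OF assms(1)]] assms(3), of k] wt_ge_1[of k]
  by (simp add: fcoeff_bessel[OF assms(1,2)] norm_mult field_simps)

lemma summable_inverse_wt: "(\<lambda>k. 1 / wt k) summable_on UNIV"
proof -
  have s: "summable (\<lambda>n. 1 / (1 + (real n)\<^sup>2))"
  proof (rule summable_comparison_test')
    show "summable (\<lambda>n. 1 / (real n)\<^sup>2)" using inverse_power_summable[of 2] by (simp add: inverse_eq_divide)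
    show "norm (1 / (1 + (real n)\<^sup>2)) \<le> 1 / (real n)\<^sup>2" if "n \<ge> 1" for n
      using that by (simp add: frac_le)
  qed
  have 1: "(\<lambda>n. 1 / (1 + (real n)\<^sup>2)) summable_on UNIV"
    by (rule norm_summable_imp_summable_on) (use s in simp)
  have a: "(\<lambda>n::int. 1 / (1 + (real_of_int n)\<^sup>2)) summable_on range int"
    by (subst summable_on_reindex) (use 1 in \<open>auto simp: inj_on_def o_def\<close>)
  have b: "(\<lambda>n::int. 1 / (1 + (real_of_int n)\<^sup>2)) summable_on range (\<lambda>n. - int n)"
    by (subst summable_on_reindex) (use 1 in \<open>auto simp: inj_on_def o_def\<close>)
  have "UNIV = range int \<union> range (\<lambda>n. - int n)"
    by (auto simp: image_iff) (metis int_cases2)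
  then have z: "(\<lambda>n::int. 1 / (1 + (real_of_int n)\<^sup>2)) summable_on UNIV"
    using summable_on_union[OF a b] by simp
  \<comment> \<open>Complex valued only to match the form of
    \<open>summable_on_product\<close>.\<close>
  define q where "q = (\<lambda>n::int. complex_of_real (1 / (1 + (real_of_int n)\<^sup>2)))"
  have nq: "norm (q n) = 1 / (1 + (real_of_int n)\<^sup>2)" for n
    unfolding q_def norm_of_real by simp
  have "Infinite_Sum.abs_summable_on (\<lambda>(m, n). q m * q n) UNIV"
    by (rule summable_on_product) (simp_all add: nq z)
  moreover have "norm (case k of (m, n) \<Rightarrow> q m * q n) = 1 / wt k" for k
    by (simp add: wt_def case_prod_beta norm_mult nq)
  ultimately show ?thesis by simp
qed

lemma norm_torus_freq_le: "(1 + norm (torus_freq k)) ^ p \<le> 2 ^ p * wt k ^ p"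
proof -
  obtain m n where k: "k = (m, n)" by force
  have "(1 + norm (torus_freq k))\<^sup>2 + (1 - norm (torus_freq k))\<^sup>2 = 2 * (1 + (norm (torus_freq k))\<^sup>2)"
    by (simp add: power2_eq_square algebra_simps)
  then have "(1 + norm (torus_freq k))\<^sup>2 \<le> 2 * (1 + (norm (torus_freq k))\<^sup>2)"
    using zero_le_power2[of "1 - norm (torus_freq k)"] by linarith
  also have "\<dots> \<le> 2 * wt k"
    by (simp add: k torus_freq_def wt_def cmod_def algebra_simps)
  finally have "(1 + norm (torus_freq k))\<^sup>2 \<le> 2 * wt k" .
  moreover have "1 + norm (torus_freq k) \<le> (1 + norm (torus_freq k))\<^sup>2"
    by (simp add: power2_eq_square algebra_simps)
  ultimately have "1 + norm (torus_freq k) \<le> 2 * wt k" by linarith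
  then have "(1 + norm (torus_freq k)) ^ p \<le> (2 * wt k) ^ p" by (intro power_mono) auto
  then show ?thesis by (simp add: power_mult_distrib)
qed

lemma periodic_int:
  assumes "periodic f"
  shows "f (z + 2 * of_real pi * (of_int m + of_int n * \<i>)) = f z"
proof -
  have 1: "f (z + of_nat j * c) = f z" if "\<And>z. f (z + c) = f z" for z c j
  proof (induction j)
    case (Suc j)
    then show ?case using that[of "z + of_nat j * c"] by (simp add: algebra_simps)
  qed simp
  have 2: "f (z + of_int j * c) = f z" if c: "\<And>z. f (z + c) = f z" for z c j
  proof (cases j)
    case (nonneg n)
    then show ?thesis using 1[of c z n] c by simp
  next
    case (neg n)
    have "z + of_int j * c + of_nat (Suc n) * c = z" by (simp add: neg algebra_simps)
    then show ?thesis using 1[of c "z + of_int j * c" "Suc n"] c by metis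
  qed
  have "f (z + 2 * of_real pi * (of_int m + of_int n * \<i>))
      = f ((z + of_int m * of_real (2 * pi)) + of_int n * (of_real (2 * pi) * \<i>))"
    by (simp add: algebra_simps)
  also have "\<dots> = f z" using assms by (simp add: 2 periodic_def del: of_real_mult)
  finally show ?thesis .
qed

lemma periodic_bounded:
  fixes f :: "complex \<Rightarrow> complex"
  assumes "continuous_on UNIV f" "periodic f"
  obtains C where "\<And>z. norm (f z) \<le> C"
proof -
  have "compact (f ` cbox (Complex 0 0) (Complex (2 * pi) (2 * pi)))"
    by (rule compact_continuous_image[OF continuous_on_subset[OF assms(1)] compact_cbox]) auto
  then obtain C where C: "\<And>z. z \<in> cbox (Complex 0 0) (Complex (2 * pi) (2 * pi)) \<Longrightarrow> norm (f z) \<le> C"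
    using compact_imp_bounded bounded_iff by (metis imageI)
  have "norm (f z) \<le> C" for z
  proof -
    define r where "r = (\<lambda>x. x - 2 * pi * of_int \<lfloor>x / (2 * pi)\<rfloor>)"
    have r: "0 \<le> r x \<and> r x \<le> 2 * pi" for x
    proof -
      have "of_int \<lfloor>x / (2 * pi)\<rfloor> \<le> x / (2 * pi)" "x / (2 * pi) < of_int \<lfloor>x / (2 * pi)\<rfloor> + 1" by linarith+
      then have "of_int \<lfloor>x / (2 * pi)\<rfloor> * (2 * pi) \<le> x" "x < (of_int \<lfloor>x / (2 * pi)\<rfloor> + 1) * (2 * pi)"
        using pi_gt_zero by (simp_all only: pos_le_divide_eq pos_divide_less_eq mult_pos_pos zero_less_numeral)
      then show ?thesis by (simp add: r_def algebra_simps)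
    qed
    have "z = Complex (r (Re z)) (r (Im z)) + 2 * of_real pi * (of_int \<lfloor>Re z / (2 * pi)\<rfloor> + of_int \<lfloor>Im z / (2 * pi)\<rfloor> * \<i>)"
      by (simp add: complex_eq_iff r_def)
    then have "f z = f (Complex (r (Re z)) (r (Im z)))" using periodic_int[OF assms(2)] by metis
    also have "norm \<dots> \<le> C" by (rule C) (use r in \<open>simp add: in_cbox_complex_iff\<close>)
    finally show ?thesis .
  qed
  then show ?thesis using that by blast
qed

text \<open>Every application of \<open>bessel\<close> leaves the function smooth and periodic and
  multiplies the coefficients by \<open>wt\<close>; the resulting function is bounded on the
  plane.\<close>

lemma fcoeff_decay:
  assumes "smooth_on UNIV f" "periodic f"
  shows "\<exists>C. \<forall>k. norm (fcoeff f k) * wt k ^ p \<le> C"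
  using assms
proof (induction p arbitrary: f)
  case 0
  then show ?case using periodic_bounded[OF smooth_on_continuous_on] norm_fcoeff_le[OF smooth_on_continuous_on]
    by (metis mult.right_neutral power_0)
next
  case (Suc p)
  then obtain C where "\<And>k. norm (fcoeff (bessel f) k) * wt k ^ p \<le> C"
    using Suc.IH[of "bessel f"] smooth_bessel periodic_bessel by blast
  then show ?case using wt_ge_1 by (auto simp: fcoeff_bessel Suc.prems norm_mult mult_ac abs_of_nonneg order_trans[OF zero_le_one])
qed

lemma rapid_fcoeff:
  assumes "smooth_on UNIV f" "periodic f"
  shows "rapid (fcoeff f) torus_freq"
  unfolding rapid_def
proof
  fix p
  \<comment> \<open>One of the p + 1 powers of \<open>wt\<close> is reserved for summability over
    the lattice.\<close>
  obtain C where C: "\<And>k. norm (fcoeff f k) * wt k ^ Suc p \<le> C" using fcoeff_decay[OF assms] by blast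
  have S: "(\<lambda>k. (C * 2 ^ p) * (1 / wt k)) summable_on UNIV"
    by (rule summable_on_cmult_right[OF summable_inverse_wt])
  show "(\<lambda>k. norm (fcoeff f k) * (1 + norm (torus_freq k)) ^ p) summable_on UNIV"
  proof (rule summable_on_comparison_test[OF S])
    fix k
    have "norm (fcoeff f k) * (1 + norm (torus_freq k)) ^ p \<le> norm (fcoeff f k) * (2 ^ p * wt k ^ p)"
      by (intro mult_left_mono norm_torus_freq_le) simp
    also have "\<dots> = (norm (fcoeff f k) * wt k ^ Suc p) * (2 ^ p / wt k)"
      using wt_ge_1[of k] by (simp add: field_simps)
    also have "\<dots> \<le> C * (2 ^ p / wt k)"
      using wt_ge_1[of k] by (intro mult_right_mono C) auto
    finally show "norm (fcoeff f k) * (1 + norm (torus_freq k)) ^ p \<le> (C * 2 ^ p) * (1 / wt k)" by simp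
  qed auto
qed

section \<open>Orthogonality, uniqueness and inversion\<close>

lemma torus_freq_arith:
  "torus_freq (fst k + fst l, snd k + snd l) = torus_freq k + torus_freq l"
  "torus_freq (- fst k, - snd k) = - torus_freq k"
  "torus_freq (0, 0) = 0"
  "torus_freq (1, 0) = 1" "torus_freq (0, 1) = \<i>"
  "torus_freq k = 0 \<longleftrightarrow> k = (0, 0)"
  by (auto simp: torus_freq_def complex_eq_iff case_prod_beta' prod_eq_iff)

text \<open>A wave of nonzero frequency is a multiple of one of its own partial derivatives, whose
  integral over the cell vanishes.\<close>

lemma cell_integral_plane_wave: "cell_integral (plane_wave (torus_freq k)) = (if k = (0, 0) then (2 * pi)\<^sup>2 else 0)"
proof (cases "k = (0, 0)")
  case True
  then show ?thesis using cell_integral_one by (simp add: torus_freq_arith plane_wave_zero[abs_def])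
next
  case False
  then have "torus_freq k \<noteq> 0" by (simp add: torus_freq_arith)
  then obtain v where v: "v \<in> {1, \<i>}" "torus_freq k \<bullet> v \<noteq> 0"
    by (metis complex_eq_iff complex_inner_1_right complex_inner_i_right insertI1 insertI2 zero_complex.simps)
  have "0 = cell_integral (dd (plane_wave (torus_freq k)) v)"
    by (rule cell_integral_dd[OF smooth_plane_wave periodic_plane_wave(1) v(1), symmetric])
  also have "\<dots> = \<i> * of_real (torus_freq k \<bullet> v) * cell_integral (plane_wave (torus_freq k))"
    unfolding dd_plane_wave[abs_def] by (rule cell_integral_cmult)
  finally show ?thesis using v(2) False by simp
qed

lemma infsum_tail_small:
  fixes c :: "'i \<Rightarrow> complex"
  assumes "(\<lambda>i. norm (c i)) summable_on UNIV" "\<epsilon> > 0"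
  shows "\<exists>F. finite F \<and> k \<in> F \<and> (\<Sum>\<^sub>\<infinity>i\<in>UNIV - F. norm (c i)) < \<epsilon>"
proof -
  let ?n = "\<lambda>i. norm (c i)"
  have "(?n has_sum infsum ?n UNIV) UNIV" using assms(1) by simp
  then have "\<forall>\<^sub>F F in finite_subsets_at_top UNIV. dist (sum ?n F) (infsum ?n UNIV) < \<epsilon>"
    using assms(2) by (auto simp: has_sum_def dest: tendstoD)
  then obtain X where X: "finite X" "\<And>F. finite F \<Longrightarrow> X \<subseteq> F \<Longrightarrow> dist (sum ?n F) (infsum ?n UNIV) < \<epsilon>"
    by (auto simp: eventually_finite_subsets_at_top)
  let ?F = "insert k X"
  have "infsum ?n UNIV = infsum ?n (?F \<union> (UNIV - ?F))" by (simp add: Un_absorb1)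
  also have "\<dots> = sum ?n ?F + infsum ?n (UNIV - ?F)"
    by (subst infsum_Un_disjoint) (use X(1) in \<open>auto intro: summable_on_subset_banach[OF assms(1)]\<close>)
  finally have "infsum ?n (UNIV - ?F) < \<epsilon>"
    using X(2)[OF finite_insert[THEN iffD2, OF X(1)] subset_insertI, of k] by (simp add: dist_real_def)
  then show ?thesis using X(1) by blast
qed

text \<open>For finite sums this is orthogonality. The tails are uniformly small, and a coefficient
  is bounded by the supremum of the function.\<close>

lemma fcoeff_wave_sum:
  assumes "rapid c torus_freq"
  shows "fcoeff (wave_sum c torus_freq) k = c k"
proof -
  let ?e = "\<lambda>i. plane_wave (torus_freq i)"
  note s = rapid_summable[OF assms]
  have cw: "continuous_on UNIV (wave_sum c torus_freq)"
    by (rule smooth_on_continuous_on[OF smooth_on_wave_sum[OF assms]])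
  have "norm (fcoeff (wave_sum c torus_freq) k - c k) < \<epsilon>" if \<epsilon>: "\<epsilon> > 0" for \<epsilon>
  proof -
    obtain F where F: "finite F" "k \<in> F" "(\<Sum>\<^sub>\<infinity>i\<in>UNIV - F. norm (c i)) < \<epsilon>"
      using infsum_tail_small[OF s \<epsilon>] by blast
    define p where "p = (\<lambda>z. \<Sum>i\<in>F. c i * ?e i z)"
    have cp: "continuous_on UNIV p" unfolding p_def by (intro continuous_intros continuous_plane_wave)
    have "fcoeff p k = cell_integral (\<lambda>z. \<Sum>i\<in>F. c i * ?e (fst i - fst k, snd i - snd k) z) / (2 * pi)\<^sup>2"
    proof -
      have "?e i z * plane_wave (- torus_freq k) z = ?e (fst i - fst k, snd i - snd k) z" for i z
        using torus_freq_arith(1)[of i "(- fst k, - snd k)"] torus_freq_arith(2)[of k]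
        by (simp add: plane_wave_add[symmetric])
      then show ?thesis unfolding fcoeff_def p_def by (simp add: sum_distrib_right mult.assoc)
    qed
    also have "\<dots> = (\<Sum>i\<in>F. c i * cell_integral (?e (fst i - fst k, snd i - snd k))) / (2 * pi)\<^sup>2"
      by (subst cell_integral_sum[OF F(1)])
        (auto intro!: continuous_on_mult continuous_plane_wave simp: cell_integral_cmult)
    also have "\<dots> = (\<Sum>i\<in>F. if i = k then c i * (2 * pi)\<^sup>2 else 0) / (2 * pi)\<^sup>2"
      unfolding cell_integral_plane_wave
      by (intro arg_cong2[where f = "(/)"] sum.cong refl) (auto simp: prod_eq_iff)
    also have "\<dots> = c k" using F by (simp add: sum.delta)
    finally have pk: "fcoeff p k = c k" .
    have "norm (wave_sum c torus_freq z - p z) \<le> (\<Sum>\<^sub>\<infinity>i\<in>UNIV - F. norm (c i))" for z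
    proof -
      have sm: "(\<lambda>i. c i * ?e i z) summable_on UNIV" by (rule wave_sum_summable[OF s])
      have "wave_sum c torus_freq z = infsum (\<lambda>i. c i * ?e i z) (F \<union> (UNIV - F))"
        by (simp add: wave_sum_def Un_absorb1)
      also have "\<dots> = p z + infsum (\<lambda>i. c i * ?e i z) (UNIV - F)"
        by (subst infsum_Un_disjoint) (use F(1) in \<open>auto simp: p_def intro: summable_on_subset_banach[OF sm]\<close>)
      finally have "wave_sum c torus_freq z - p z = infsum (\<lambda>i. c i * ?e i z) (UNIV - F)" by simp
      also have "norm \<dots> \<le> (\<Sum>\<^sub>\<infinity>i\<in>UNIV - F. norm (c i * ?e i z))"
        by (rule Infinite_Sum.norm_infsum_bound) (simp add: norm_mult summable_on_subset_banach[OF s])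
      finally show ?thesis by (simp add: norm_mult)
    qed
    then have "norm (fcoeff (\<lambda>z. wave_sum c torus_freq z - p z) k) \<le> (\<Sum>\<^sub>\<infinity>i\<in>UNIV - F. norm (c i))"
      by (intro norm_fcoeff_le continuous_on_diff cw cp)
    then show ?thesis using F(3) fcoeff_diff[OF cw cp, of k] pk by simp
  qed
  from this[of "norm (fcoeff (wave_sum c torus_freq) k - c k)"] show ?thesis by auto
qed

text \<open>Products with trigonometric polynomials preserve the vanishing of all coefficients; these
  are dense by Stone and Weierstrass.\<close>

lemma zero_coeffs_imp_zero:
  assumes G: "continuous_on UNIV G" "periodic G" and z: "\<And>k. cell_integral (\<lambda>z. G z * plane_wave (torus_freq k) z) = 0"
    and x: "- pi \<le> x" "x \<le> pi" "- pi \<le> y" "y \<le> pi"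
  shows "G (Complex x y) = 0"
proof -
  \<comment> \<open>Embeds the torus in the space of pairs of complex numbers, where polynomials
    restrict to trigonometric polynomials.\<close>
  define q :: "complex \<Rightarrow> complex \<times> complex" where "q = (\<lambda>z. (cis (Re z), cis (Im z)))"
  have cq: "continuous_on S q" for S unfolding q_def by (intro continuous_intros)
  define Z where "Z = {g. continuous_on UNIV g \<and> (\<forall>k. cell_integral (\<lambda>z. g z * plane_wave (torus_freq k) z) = 0)}"
  have Zadd: "(\<lambda>z. g z + h z) \<in> Z" if "g \<in> Z" "h \<in> Z" for g h
    using that unfolding Z_def
    by (auto simp: distrib_right cell_integral_add continuous_on_mult continuous_plane_wave intro!: continuous_on_add)
  have Zc: "(\<lambda>z. c * g z) \<in> Z" if "g \<in> Z" for g c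
    using that unfolding Z_def by (auto simp: mult.assoc cell_integral_cmult intro!: continuous_on_mult)
  have Zp: "(\<lambda>z. g z * plane_wave (torus_freq k) z) \<in> Z" if "g \<in> Z" for g k
    using that unfolding Z_def
    by (auto simp: mult.assoc plane_wave_add[symmetric] torus_freq_arith(1)[symmetric]
        intro!: continuous_on_mult continuous_plane_wave)
  have Zcs: "(\<lambda>z. g z * of_real (cos (Re z))) \<in> Z" "(\<lambda>z. g z * of_real (sin (Re z))) \<in> Z"
    "(\<lambda>z. g z * of_real (cos (Im z))) \<in> Z" "(\<lambda>z. g z * of_real (sin (Im z))) \<in> Z" if g: "g \<in> Z" for g
  proof -
    have e: "plane_wave (torus_freq (1, 0)) z = cis (Re z)" "plane_wave (torus_freq (- 1, 0)) z = cis (- Re z)"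
      "plane_wave (torus_freq (0, 1)) z = cis (Im z)" "plane_wave (torus_freq (0, - 1)) z = cis (- Im z)" for z
      by (simp_all add: torus_freq_def plane_wave_def inner_complex_def)
    have 1: "(\<lambda>z. g z * of_real (cos (Re z))) = (\<lambda>z. (1/2) * (g z * plane_wave (torus_freq (1, 0)) z)
        + (1/2) * (g z * plane_wave (torus_freq (- 1, 0)) z))"
      "(\<lambda>z. g z * of_real (sin (Re z))) = (\<lambda>z. (- \<i> / 2) * (g z * plane_wave (torus_freq (1, 0)) z)
        + (\<i> / 2) * (g z * plane_wave (torus_freq (- 1, 0)) z))"
      "(\<lambda>z. g z * of_real (cos (Im z))) = (\<lambda>z. (1/2) * (g z * plane_wave (torus_freq (0, 1)) z)
        + (1/2) * (g z * plane_wave (torus_freq (0, - 1)) z))"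
      "(\<lambda>z. g z * of_real (sin (Im z))) = (\<lambda>z. (- \<i> / 2) * (g z * plane_wave (torus_freq (0, 1)) z)
        + (\<i> / 2) * (g z * plane_wave (torus_freq (0, - 1)) z))"
      unfolding e by (auto simp: fun_eq_iff complex_eq_iff field_simps)
    show "(\<lambda>z. g z * of_real (cos (Re z))) \<in> Z" "(\<lambda>z. g z * of_real (sin (Re z))) \<in> Z"
      "(\<lambda>z. g z * of_real (cos (Im z))) \<in> Z" "(\<lambda>z. g z * of_real (sin (Im z))) \<in> Z"
      unfolding 1 by (intro Zadd Zc Zp g)+
  qed
  have ZP: "(\<lambda>z. g z * of_real (P (q z))) \<in> Z" if "real_polynomial_function P" "g \<in> Z" for P g
    using that
  proof (induction P arbitrary: g rule: real_polynomial_function.induct)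
    case (linear f)
    have lin: "linear f" using linear.hyps bounded_linear.linear by blast
    have f: "f (q z) = cos (Re z) * f (1, 0) + sin (Re z) * f (\<i>, 0) + cos (Im z) * f (0, 1) + sin (Im z) * f (0, \<i>)" for z
    proof -
      have "q z = cos (Re z) *\<^sub>R (1, 0) + sin (Re z) *\<^sub>R (\<i>, 0) + cos (Im z) *\<^sub>R (0, 1) + sin (Im z) *\<^sub>R (0, \<i>)"
        by (auto simp: q_def complex_eq_iff)
      then show ?thesis by (simp only: linear_add[OF lin] linear_scale[OF lin] real_scaleR_def)
    qed
    have "(\<lambda>z. g z * of_real (f (q z))) = (\<lambda>z. of_real (f (1, 0)) * (g z * of_real (cos (Re z)))
      + of_real (f (\<i>, 0)) * (g z * of_real (sin (Re z))) + of_real (f (0, 1)) * (g z * of_real (cos (Im z)))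
      + of_real (f (0, \<i>)) * (g z * of_real (sin (Im z))))"
      unfolding f by (auto simp: algebra_simps)
    then show ?case by (simp only:) (intro Zadd Zc Zcs linear.prems)
  next
    case (const c)
    then show ?case using Zc[of g "of_real c"] by (simp add: mult.commute)
  next
    case (add P R)
    then show ?case using Zadd[OF add.IH(1) add.IH(2), of g g] by (simp add: algebra_simps)
  next
    case (mult P R)
    then show ?case using mult.IH(2)[OF mult.IH(1)[OF mult.prems]] by (simp add: mult.assoc)
  qed
  have GZ: "G \<in> Z" using G z by (simp add: Z_def)
  have Z0: "cell_integral g = 0" if "g \<in> Z" for g
    using that unfolding Z_def by (auto dest!: spec[of _ 0] spec[of _ "(0, 0)"] simp: torus_freq_arith)
  have qG: "G z = G z'" if "q z = q z'" for z z'
  proof -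
    have "\<exists>m::int. Re z = Re z' + 2 * pi * m" "\<exists>n::int. Im z = Im z' + 2 * pi * n"
      using that by (simp_all add: q_def cis.ctr complex_eq_iff flip: sin_cos_eq_iff)
    then obtain m n :: int where "Re z = Re z' + 2 * pi * m" "Im z = Im z' + 2 * pi * n" by blast
    then have "z = z' + 2 * of_real pi * (of_int m + of_int n * \<i>)" by (simp add: complex_eq_iff)
    then show ?thesis using periodic_int[OF G(2)] by metis
  qed
  \<comment> \<open>The conjugate of G as a function on the embedded torus; by \<open>qG\<close> the
    value does not depend on the chosen preimage.\<close>
  define G' where "G' = (\<lambda>s. cnj (G (SOME z. q z = s)))"
  have G'q: "G' (q z) = cnj (G z)" for z
    unfolding G'_def using qG[OF someI[of "\<lambda>z'. q z' = q z" z]] by simp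
  define K where "K = cbox (Complex (- pi) (- pi)) (Complex pi pi)"
  have K: "compact K" by (simp add: K_def)
  have Kxy: "Complex x y \<in> K \<longleftrightarrow> - pi \<le> x \<and> x \<le> pi \<and> - pi \<le> y \<and> y \<le> pi" for x y
    by (auto simp: K_def in_cbox_complex_iff)
  have S: "compact (q ` K)" by (rule compact_continuous_image[OF cq K])
  \<comment> \<open>K is compact, so q maps closed subsets of K to closed sets, and continuity
    descends from G.\<close>
  have cG': "continuous_on (q ` K) G'"
    unfolding continuous_on_closed_vimage[OF compact_imp_closed[OF S]]
  proof (intro allI impI)
    fix B :: "complex set" assume B: "closed B"
    have "G' -` B \<inter> q ` K = q ` ((\<lambda>z. cnj (G z)) -` B \<inter> K)" by (auto simp: G'q)
    moreover have "compact ((\<lambda>z. cnj (G z)) -` B \<inter> K)"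
    proof (rule closed_Int_compact[OF _ K])
      show "closed ((\<lambda>z. cnj (G z)) -` B)"
        by (rule closed_vimage[OF B]) (intro continuous_on_cnj G(1))
    qed
    ultimately show "closed (G' -` B \<inter> q ` K)"
      using compact_imp_closed[OF compact_continuous_image[OF cq]] by simp
  qed
  obtain M where M: "\<And>z. norm (G z) \<le> M" using periodic_bounded[OF G] by blast
  have M0: "M \<ge> 0" using M[of 0] norm_ge_zero order_trans by blast
  have cGG: "continuous_on UNIV (\<lambda>z. G z * cnj (G z))" by (intro continuous_intros G(1))
  \<comment> \<open>A trigonometric polynomial close to the conjugate of G integrates to zero
    against G, so the integral of |G|^2 is arbitrarily small.\<close>
  have small: "norm (cell_integral (\<lambda>z. G z * cnj (G z))) \<le> M * \<epsilon> * (2 * pi)\<^sup>2" if \<epsilon>: "\<epsilon> > 0" for \<epsilon>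
  proof -
    obtain h where h: "polynomial_function h" "\<And>s. s \<in> q ` K \<Longrightarrow> norm (G' s - h s) < \<epsilon>"
      using Stone_Weierstrass_polynomial_function[OF S cG' \<epsilon>] by blast
    have RI: "real_polynomial_function (\<lambda>s. Re (h s))" "real_polynomial_function (\<lambda>s. Im (h s))"
      using h(1) bounded_linear_Re bounded_linear_Im unfolding polynomial_function_def o_def by blast+
    have "(\<lambda>z. G z * of_real (Re (h (q z))) + \<i> * (G z * of_real (Im (h (q z))))) \<in> Z"
      by (intro Zadd Zc ZP[OF RI(1) GZ] ZP[OF RI(2) GZ])
    moreover have "(\<lambda>z. G z * of_real (Re (h (q z))) + \<i> * (G z * of_real (Im (h (q z))))) = (\<lambda>z. G z * h (q z))"
      by (auto simp: fun_eq_iff complex_eq_iff algebra_simps)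
    ultimately have hZ: "(\<lambda>z. G z * h (q z)) \<in> Z" by simp
    have ch: "continuous_on UNIV (\<lambda>z. G z * h (q z))" using hZ by (simp add: Z_def)
    have "cell_integral (\<lambda>z. G z * cnj (G z)) = cell_integral (\<lambda>z. G z * cnj (G z) - G z * h (q z))"
      unfolding cell_integral_diff[OF cGG ch] using Z0[OF hZ] by simp
    also have "norm \<dots> \<le> M * \<epsilon> * (2 * pi)\<^sup>2"
    proof (rule norm_cell_integral_le[OF continuous_on_diff[OF cGG ch]])
      show "M * \<epsilon> \<ge> 0" using M0 \<epsilon> by simp
      fix x y assume "- pi \<le> x" "x \<le> pi" "- pi \<le> y" "y \<le> pi"
      then have "norm (cnj (G (Complex x y)) - h (q (Complex x y))) \<le> \<epsilon>"
        using h(2)[of "q (Complex x y)"] Kxy[of x y] G'q less_imp_le by auto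
      then show "norm (G (Complex x y) * cnj (G (Complex x y)) - G (Complex x y) * h (q (Complex x y))) \<le> M * \<epsilon>"
        unfolding right_diff_distrib[symmetric] norm_mult by (intro mult_mono M M0) auto
    qed
    finally show ?thesis .
  qed
  have zero: "cell_integral (\<lambda>z. G z * cnj (G z)) = 0"
  proof (rule ccontr)
    assume n: "cell_integral (\<lambda>z. G z * cnj (G z)) \<noteq> 0"
    \<comment> \<open>Chosen to make the bound in \<open>small\<close> at most half of the quantity
      it bounds; M + 1 keeps the divisor positive.\<close>
    define \<epsilon> where "\<epsilon> = norm (cell_integral (\<lambda>z. G z * cnj (G z))) / (2 * ((M + 1) * (2 * pi)\<^sup>2))"
    have p: "(M + 1) * (2 * pi)\<^sup>2 > 0" using M0 by simp
    have "\<epsilon> > 0" using n p by (simp add: \<epsilon>_def)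
    moreover from this have "M * \<epsilon> * (2 * pi)\<^sup>2 \<le> (M + 1) * \<epsilon> * (2 * pi)\<^sup>2" by (intro mult_right_mono) auto
    moreover have "(M + 1) * \<epsilon> * (2 * pi)\<^sup>2 = norm (cell_integral (\<lambda>z. G z * cnj (G z))) / 2"
    proof -
      have "\<epsilon> * ((M + 1) * (2 * pi)\<^sup>2) = norm (cell_integral (\<lambda>z. G z * cnj (G z))) / 2"
        using M0 unfolding \<epsilon>_def by (simp only: times_divide_eq_left) (simp add: divide_simps)
      then show ?thesis by (simp only: mult_ac)
    qed
    ultimately have "norm (cell_integral (\<lambda>z. G z * cnj (G z))) \<le> norm (cell_integral (\<lambda>z. G z * cnj (G z))) / 2"
      using small[of \<epsilon>] by linarith
    then show False using n by simp
  qed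
  have cr: "continuous_on (cbox (- pi, - pi) (pi, pi)) (\<lambda>(x, y). (norm (G (Complex x y)))\<^sup>2)"
    unfolding case_prod_beta'
    by (intro continuous_intros continuous_on_Complex_fst_snd[OF G(1), unfolded case_prod_beta'])
  have "of_real (integral (cbox (- pi, - pi) (pi, pi)) (\<lambda>(x, y). (norm (G (Complex x y)))\<^sup>2)) = cell_integral (\<lambda>z. G z * cnj (G z))"
    unfolding cell_integral_def
    using integral_linear[OF integrable_continuous[OF cr] bounded_linear_of_real[where 'a = complex]]
    by (simp add: o_def case_prod_beta' complex_norm_square[symmetric])
  then have "integral (cbox (- pi, - pi) (pi, pi)) (\<lambda>(x, y). (norm (G (Complex x y)))\<^sup>2) = 0"
    using zero by simp
  moreover have np: "\<not> pi \<le> 0" by (simp add: not_le)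
  ultimately have "\<forall>p\<in>cbox (- pi, - pi) (pi, pi). (case p of (x, y) \<Rightarrow> (norm (G (Complex x y)))\<^sup>2) = 0"
    by (subst (asm) integral_cbox_eq_0_iff[OF cr]) (auto simp: box_eq_empty Basis_prod_def np)
  moreover have "(x, y) \<in> cbox (- pi, - pi) (pi, pi)" using x by (simp add: cbox_Pair_eq)
  ultimately have "(case (x, y) of (x, y) \<Rightarrow> (norm (G (Complex x y)))\<^sup>2) = 0" by (rule bspec)
  then show ?thesis by simp
qed

lemma fourier_inversion:
  assumes "smooth_on UNIV f" "periodic f" "- pi \<le> x" "x \<le> pi" "- pi \<le> y" "y \<le> pi"
  shows "f (Complex x y) = wave_sum (fcoeff f) torus_freq (Complex x y)"
proof -
  note r = rapid_fcoeff[OF assms(1,2)]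
  have c: "continuous_on UNIV f" "continuous_on UNIV (wave_sum (fcoeff f) torus_freq)"
    using smooth_on_continuous_on assms(1) smooth_on_wave_sum[OF r] by blast+
  let ?G = "\<lambda>z. f z - wave_sum (fcoeff f) torus_freq z"
  have "?G (Complex x y) = 0"
  proof (rule zero_coeffs_imp_zero[OF _ _ _ assms(3-6)])
    show "continuous_on UNIV ?G" by (intro continuous_on_diff c)
    have "periodic (wave_sum (fcoeff f) torus_freq)"
      unfolding periodic_def wave_sum_def
      using periodic_plane_wave(1)[unfolded periodic_def] by simp
    then show "periodic ?G" using assms(2) by (simp add: periodic_def)
    fix k :: "int \<times> int"
    \<comment> \<open>Integrating against the wave of frequency k computes the coefficient of index
      -k.\<close>
    have "fcoeff ?G (- fst k, - snd k) = 0"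
      unfolding fcoeff_diff[OF c] fcoeff_wave_sum[OF r] by simp
    then show "cell_integral (\<lambda>z. ?G z * plane_wave (torus_freq k) z) = 0"
      unfolding fcoeff_def torus_freq_arith by simp
  qed
  then show ?thesis by simp
qed

section \<open>A periodic map that is the identity near the origin\<close>

text \<open>The functions P(1/x) exp(-1/x), extended by zero, form a family closed under
  differentiation. \<open>flat 1\<close> is the usual smooth function that is flat at the
  origin.\<close>

definition flat :: "real poly \<Rightarrow> real \<Rightarrow> real" where
  "flat P x = (if x > 0 then poly P (1 / x) * exp (- (1 / x)) else 0)"

lemma poly_exp_tendsto_0: "((\<lambda>y. poly P y * exp (- y)) \<longlongrightarrow> 0) at_top" for P :: "real poly"
proof -
  have "((\<lambda>y. \<Sum>i\<le>degree P. coeff P i * (y ^ i / exp y)) \<longlongrightarrow> (\<Sum>i\<le>degree P. coeff P i * 0)) at_top"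
    by (intro tendsto_sum tendsto_mult tendsto_const tendsto_power_div_exp_0)
  then show ?thesis
    by (simp add: poly_altdef sum_distrib_right exp_minus divide_inverse mult.assoc)
qed

text \<open>Differentiating P(1/x) exp(-1/x) gives x^(-2) (P - P')(1/x) exp(-1/x); the factor
  \<open>[:0, 0, 1:]\<close> is the square of the variable 1/x.\<close>

definition flat_deriv :: "real poly \<Rightarrow> real poly" where
  "flat_deriv P = [:0, 0, 1:] * (P - pderiv P)"

lemma flat_has_derivative: "(flat P has_real_derivative flat (flat_deriv P) x) (at x)"
proof -
  consider "x > 0" | "x < 0" | "x = 0" by linarith
  then show ?thesis
  proof cases
    case 1
    have "((\<lambda>x. poly P (1 / x) * exp (- (1 / x))) has_real_derivative
        (poly (pderiv P) (1 / x) * (- (1 / x\<^sup>2))) * exp (- (1 / x))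
        + poly P (1 / x) * (exp (- (1 / x)) * (1 / x\<^sup>2))) (at x)"
      using 1 by (auto intro!: derivative_eq_intros DERIV_chain2[OF poly_DERIV] simp: power2_eq_square)
    moreover have "(poly (pderiv P) (1 / x) * (- (1 / x\<^sup>2))) * exp (- (1 / x))
        + poly P (1 / x) * (exp (- (1 / x)) * (1 / x\<^sup>2)) = flat (flat_deriv P) x"
      using 1 by (simp add: flat_def flat_deriv_def power2_eq_square algebra_simps)
    ultimately have "((\<lambda>x. poly P (1 / x) * exp (- (1 / x))) has_real_derivative flat (flat_deriv P) x) (at x)"
      by simp
    then show ?thesis
      by (rule has_field_derivative_transform_within_open[of _ _ _ "{0<..}"])
        (use 1 in \<open>auto simp: flat_def\<close>)
  next
    case 2
    have "((\<lambda>x. 0) has_real_derivative 0) (at x)" by simp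
    then have "(flat P has_real_derivative 0) (at x)"
      by (rule has_field_derivative_transform_within_open[of _ _ _ "{..<0}"])
        (use 2 in \<open>auto simp: flat_def\<close>)
    then show ?thesis using 2 by (simp add: flat_def)
  next
    case 3
    have r: "((\<lambda>h. flat P h / h) \<longlongrightarrow> 0) (at_right 0)"
    proof -
      \<comment> \<open>With y = 1/h the difference quotient at 0 is y P(y) exp(-y), and
        \<open>pCons 0 P\<close> is y P(y).\<close>
      have "((\<lambda>h. poly (pCons 0 P) (inverse h) * exp (- inverse h)) \<longlongrightarrow> 0) (at_right 0)"
        by (rule filterlim_compose[OF poly_exp_tendsto_0 filterlim_inverse_at_top_right])
      then show ?thesis
        by (rule Lim_transform_eventually)
          (auto simp: eventually_at_right_field flat_def divide_inverse mult_ac intro!: exI[of _ 1])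
    qed
    have l: "((\<lambda>h. flat P h / h) \<longlongrightarrow> 0) (at_left 0)"
      by (rule Lim_transform_eventually[OF tendsto_const])
        (auto simp: eventually_at_left_field flat_def intro!: exI[of _ "-1"])
    have "((\<lambda>h. flat P h / h) \<longlongrightarrow> 0) (at 0)"
      using l r by (simp add: filterlim_at_split)
    then show ?thesis by (simp add: DERIV_def 3 flat_def)
  qed
qed

lemma smooth_on_flat:
  assumes "open D" "smooth_on D f"
  shows "smooth_on D (\<lambda>z. flat P (f z))"
  using smooth_on_real_compose[OF assms, of UNIV "\<lambda>j. flat ((flat_deriv ^^ j) P)" 0]
  by (simp add: flat_has_derivative)

lemma flat_one_nonneg: "flat 1 x \<ge> 0" "x > 0 \<Longrightarrow> flat 1 x > 0"
  by (simp_all add: flat_def)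

definition cutoff :: "real \<Rightarrow> real" where
  "cutoff t = flat 1 (t - 1/4) / (flat 1 (t - 1/4) + flat 1 (1/2 - t))"

lemma cutoff_denominator: "flat 1 (t - 1/4) + flat 1 (1/2 - t) > 0"
proof (cases "t > 1/4")
  case True
  then show ?thesis using flat_one_nonneg(2)[of "t - 1/4"] flat_one_nonneg(1)[of "1/2 - t"] by simp
next
  case False
  then show ?thesis using flat_one_nonneg(2)[of "1/2 - t"] flat_one_nonneg(1)[of "t - 1/4"] by simp
qed

lemma cutoff_le: "0 \<le> cutoff t" "cutoff t \<le> 1"
  using cutoff_denominator[of t] flat_one_nonneg(1)[of "t - 1/4"] flat_one_nonneg(1)[of "1/2 - t"]
  by (simp_all add: cutoff_def divide_le_eq)

lemma cutoff_eq: "t \<le> 1/4 \<Longrightarrow> cutoff t = 0" "t \<ge> 1/2 \<Longrightarrow> cutoff t = 1"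
  using cutoff_denominator[of t] by (auto simp: cutoff_def flat_def)

lemma smooth_on_cutoff:
  assumes "open D" "smooth_on D f"
  shows "smooth_on D (\<lambda>z. cutoff (f z))"
  unfolding cutoff_def
  by (intro smooth_intros smooth_on_flat assms) (use cutoff_denominator less_imp_neq in \<open>metis\<close>)

lemma smooth_on_arcsin:
  assumes "open D" "smooth_on D f" "\<And>z. z \<in> D \<Longrightarrow> \<bar>f z\<bar> < 1"
  shows "smooth_on D (\<lambda>z. arcsin (f z))"
proof (rule smooth_onI[OF assms(1)])
  show "((\<lambda>z. arcsin (f z)) has_derivative
      (\<lambda>v. frechet_derivative f (at z) v * inverse (sqrt (1 - (f z)\<^sup>2)))) (at z)" if "z \<in> D" for z
    by (rule DERIV_compose_FDERIV[OF DERIV_arcsin smooth_on_has_derivative[OF assms(2) that]])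
      (use assms(3)[OF that] in auto)
  have "1 - (f z)\<^sup>2 > 0" if "z \<in> D" for z
    using assms(3)[OF that] by (simp add: abs_square_less_1)
  then show "smooth_on D (\<lambda>z. frechet_derivative f (at z) v * inverse (sqrt (1 - (f z)\<^sup>2)))" for v
    by (intro smooth_intros assms) force+
qed

text \<open>arcsin (sin x) is periodic and equals x near 0, but has corners where the cosine
  vanishes. The cutoff is zero near these corners and 1 where the cosine is at least 1/2.\<close>

definition sawtooth :: "real \<Rightarrow> real" where
  "sawtooth x = cutoff (cos x) * arcsin (sin x)"

lemma smooth_on_sawtooth:
  assumes "smooth_on UNIV f"
  shows "smooth_on UNIV (\<lambda>z. sawtooth (f z))"
proof (rule smooth_on_local)
  fix z :: complex
  have c: "continuous_on UNIV (\<lambda>z. cos (f z))"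
    by (intro continuous_on_cos smooth_on_continuous_on assms)
  \<comment> \<open>Two overlapping open sets that cover the plane: on \<open>?A\<close> the sine
    stays away from 1 and -1, so the arcsine is smooth, and on \<open>?B\<close> the cutoff makes
    the function zero.\<close>
  let ?A = "{z. cos (f z) > 1/8}" and ?B = "{z. cos (f z) < 1/4}"
  have A: "open ?A" and B: "open ?B" by (intro open_Collect_less c continuous_on_const)+
  have f: "smooth_on ?A f" by (rule smooth_on_subset[OF assms]) simp
  have "\<bar>sin (f z)\<bar> < 1" if "z \<in> ?A" for z
  proof -
    have "(cos (f z))\<^sup>2 > 0" using that by simp
    then have "(sin (f z))\<^sup>2 < 1" using sin_cos_squared_add[of "f z"] by linarith
    then show ?thesis by (simp add: abs_square_less_1)
  qed
  then have sA: "smooth_on ?A (\<lambda>z. sawtooth (f z))"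
    unfolding sawtooth_def using A f by (intro smooth_intros smooth_on_cutoff smooth_on_arcsin) auto
  have "smooth_on ?B (\<lambda>_. 0::real)" by simp
  then have sB: "smooth_on ?B (\<lambda>z. sawtooth (f z))"
    by (rule smooth_on_cong[OF B, rotated]) (auto simp: sawtooth_def cutoff_eq)
  show "\<exists>E. open E \<and> z \<in> E \<and> smooth_on E (\<lambda>z. sawtooth (f z))"
  proof (cases "z \<in> ?A")
    case False
    then have "z \<in> ?B" by simp
    then show ?thesis using sB B by blast
  qed (use sA A in blast)
qed

lemma abs_sawtooth_le: "\<bar>sawtooth x\<bar> \<le> 2"
proof -
  have "\<bar>arcsin (sin x)\<bar> \<le> pi / 2"
    using arcsin_lbound[of "sin x"] arcsin_ubound[of "sin x"] by (simp add: abs_le_iff)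
  then have "\<bar>arcsin (sin x)\<bar> \<le> 2" using pi_less_4 by linarith
  then have "\<bar>cutoff (cos x)\<bar> * \<bar>arcsin (sin x)\<bar> \<le> 1 * 2"
    by (intro mult_mono) (use cutoff_le[of "cos x"] in auto)
  then show ?thesis by (simp add: sawtooth_def abs_mult)
qed

lemma sawtooth_id:
  assumes "\<bar>x\<bar> \<le> 1"
  shows "sawtooth x = x"
proof -
  have "cos (pi / 3) \<le> cos \<bar>x\<bar>"
    by (rule cos_monotone_0_pi_le) (use assms pi_gt3 in auto)
  then have "cos x \<ge> 1/2" by (simp add: cos_60)
  moreover have "arcsin (sin x) = x" by (rule arcsin_sin) (use assms pi_gt3 in auto)
  ultimately show ?thesis by (simp add: sawtooth_def cutoff_eq)
qed

definition saw_map :: "complex \<Rightarrow> complex" where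
  "saw_map z = of_real (sawtooth (Re z)) + \<i> * of_real (sawtooth (Im z))"

lemma smooth_saw_map: "smooth_on UNIV saw_map"
  unfolding saw_map_def[abs_def]
  by (intro smooth_intros smooth_on_sawtooth open_UNIV)

lemma periodic_saw_map: "periodic saw_map"
  by (simp add: periodic_def saw_map_def sawtooth_def)

text \<open>The constant 4 explains the ball of radius 4 * r around p used in the zoom.\<close>

lemma norm_saw_map_le: "norm (saw_map z) \<le> 4"
  using abs_sawtooth_le[of "Re z"] abs_sawtooth_le[of "Im z"] cmod_le[of "saw_map z"]
  by (simp add: saw_map_def)

lemma saw_map_id: "norm z < 1 \<Longrightarrow> saw_map z = z"
  using abs_Re_le_cmod[of z] abs_Im_le_cmod[of z] by (simp add: saw_map_def sawtooth_id complex_eq_iff)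

section \<open>Derivative bounds uniform in a parameter\<close>

text \<open>The constants may depend on the order j but not on the parameter. Only the directions 1
  and i are followed, as \<open>bessel\<close> involves no others.\<close>

primrec unif_bdd :: "nat \<Rightarrow> real set \<Rightarrow> (real \<Rightarrow> complex \<Rightarrow> complex) \<Rightarrow> bool" where
  "unif_bdd 0 \<Delta> F \<longleftrightarrow> (\<exists>C. \<forall>\<delta>\<in>\<Delta>. \<forall>z. norm (F \<delta> z) \<le> C)"
| "unif_bdd (Suc j) \<Delta> F \<longleftrightarrow> (\<exists>C. \<forall>\<delta>\<in>\<Delta>. \<forall>z. norm (F \<delta> z) \<le> C) \<and>
     (\<forall>v\<in>{1, \<i>}. unif_bdd j \<Delta> (\<lambda>\<delta>. dd (F \<delta>) v))"

lemma unif_bdd_bound: "unif_bdd j \<Delta> F \<Longrightarrow> \<exists>C. \<forall>\<delta>\<in>\<Delta>. \<forall>z. norm (F \<delta> z) \<le> C"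
  by (cases j) auto

lemma unif_bdd_cong:
  assumes "\<And>\<delta>. \<delta> \<in> \<Delta> \<Longrightarrow> F \<delta> = G \<delta>" "unif_bdd j \<Delta> F"
  shows "unif_bdd j \<Delta> G"
  using assms
proof (induction j arbitrary: F G)
  case (Suc j)
  have "unif_bdd j \<Delta> (\<lambda>\<delta>. dd (G \<delta>) v)" if "v \<in> {1, \<i>}" for v
    by (rule Suc.IH[of "\<lambda>\<delta>. dd (F \<delta>) v"]) (use Suc.prems that in auto)
  then show ?case using Suc.prems by auto
qed auto

lemma unif_bdd_SucD: "unif_bdd (Suc j) \<Delta> F \<Longrightarrow> unif_bdd j \<Delta> F"
  by (induction j arbitrary: F) (simp, metis unif_bdd.simps(2))

lemma unif_bdd_add:
  assumes "unif_bdd j \<Delta> F" "unif_bdd j \<Delta> G"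
    and "\<And>\<delta>. \<delta> \<in> \<Delta> \<Longrightarrow> smooth_on UNIV (F \<delta>)" "\<And>\<delta>. \<delta> \<in> \<Delta> \<Longrightarrow> smooth_on UNIV (G \<delta>)"
  shows "unif_bdd j \<Delta> (\<lambda>\<delta> z. F \<delta> z + G \<delta> z)"
  using assms
proof (induction j arbitrary: F G)
  case 0
  then obtain C D where "\<forall>\<delta>\<in>\<Delta>. \<forall>z. norm (F \<delta> z) \<le> C" "\<forall>\<delta>\<in>\<Delta>. \<forall>z. norm (G \<delta> z) \<le> D" by auto
  then show ?case by (auto intro!: exI[of _ "C + D"] norm_triangle_mono)
next
  case (Suc j)
  have "unif_bdd j \<Delta> (\<lambda>\<delta>. dd (\<lambda>z. F \<delta> z + G \<delta> z) v)" if v: "v \<in> {1, \<i>}" for v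
  proof (rule unif_bdd_cong)
    show "unif_bdd j \<Delta> (\<lambda>\<delta> z. dd (F \<delta>) v z + dd (G \<delta>) v z)"
      by (rule Suc.IH) (use Suc.prems v in \<open>auto intro: smooth_on_dd\<close>)
  qed (simp add: fun_eq_iff dd_add[OF Suc.prems(3,4)])
  moreover obtain C D where "\<forall>\<delta>\<in>\<Delta>. \<forall>z. norm (F \<delta> z) \<le> C" "\<forall>\<delta>\<in>\<Delta>. \<forall>z. norm (G \<delta> z) \<le> D"
    using unif_bdd_bound[OF Suc.prems(1)] unif_bdd_bound[OF Suc.prems(2)] by auto
  ultimately show ?case by (auto intro!: exI[of _ "C + D"] norm_triangle_mono)
qed

lemma unif_bdd_mult:
  assumes "unif_bdd j \<Delta> F" "unif_bdd j \<Delta> G"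
    and "\<And>\<delta>. \<delta> \<in> \<Delta> \<Longrightarrow> smooth_on UNIV (F \<delta>)" "\<And>\<delta>. \<delta> \<in> \<Delta> \<Longrightarrow> smooth_on UNIV (G \<delta>)"
  shows "unif_bdd j \<Delta> (\<lambda>\<delta> z. F \<delta> z * G \<delta> z)"
  using assms
proof (induction j arbitrary: F G)
  case 0
  then obtain C D where CD: "\<forall>\<delta>\<in>\<Delta>. \<forall>z. norm (F \<delta> z) \<le> C" "\<forall>\<delta>\<in>\<Delta>. \<forall>z. norm (G \<delta> z) \<le> D" by auto
  have "norm (F \<delta> z * G \<delta> z) \<le> C * D" if "\<delta> \<in> \<Delta>" for \<delta> z
    unfolding norm_mult using CD that by (intro mult_mono) (auto intro: order_trans[OF norm_ge_zero])
  then show ?case by auto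
next
  case (Suc j)
  have "unif_bdd j \<Delta> (\<lambda>\<delta>. dd (\<lambda>z. F \<delta> z * G \<delta> z) v)" if v: "v \<in> {1, \<i>}" for v
  proof (rule unif_bdd_cong)
    have dF: "unif_bdd j \<Delta> (\<lambda>\<delta>. dd (F \<delta>) v)" and dG: "unif_bdd j \<Delta> (\<lambda>\<delta>. dd (G \<delta>) v)"
      using Suc.prems(1,2) v by auto
    show "unif_bdd j \<Delta> (\<lambda>\<delta> z. F \<delta> z * dd (G \<delta>) v z + dd (F \<delta>) v z * G \<delta> z)"
      by (rule unif_bdd_add[OF Suc.IH[OF unif_bdd_SucD[OF Suc.prems(1)] dG Suc.prems(3) smooth_on_dd[OF Suc.prems(4)]]
            Suc.IH[OF dF unif_bdd_SucD[OF Suc.prems(2)] smooth_on_dd[OF Suc.prems(3)] Suc.prems(4)]])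
        (auto intro!: smooth_on_mult smooth_on_dd Suc.prems(3,4))
  qed (simp add: fun_eq_iff dd_bilinear[OF bounded_bilinear_mult Suc.prems(3,4)])
  moreover obtain C D where CD: "\<forall>\<delta>\<in>\<Delta>. \<forall>z. norm (F \<delta> z) \<le> C" "\<forall>\<delta>\<in>\<Delta>. \<forall>z. norm (G \<delta> z) \<le> D"
    using unif_bdd_bound[OF Suc.prems(1)] unif_bdd_bound[OF Suc.prems(2)] by auto
  moreover have "norm (F \<delta> z * G \<delta> z) \<le> C * D" if "\<delta> \<in> \<Delta>" for \<delta> z
    unfolding norm_mult using CD that by (intro mult_mono) (auto intro: order_trans[OF norm_ge_zero])
  ultimately show ?case unfolding unif_bdd.simps by blast
qed

lemma unif_bdd_const:
  assumes "smooth_on UNIV g" "periodic g"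
  shows "unif_bdd j \<Delta> (\<lambda>_. g)"
  using assms
proof (induction j arbitrary: g)
  case 0
  obtain C where "\<And>z. norm (g z) \<le> C" using periodic_bounded[OF smooth_on_continuous_on[OF 0(1)] 0(2)] by blast
  then show ?case by auto
next
  case (Suc j)
  obtain C where "\<And>z. norm (g z) \<le> C"
    using periodic_bounded[OF smooth_on_continuous_on[OF Suc.prems(1)] Suc.prems(2)] by blast
  then show ?case using Suc.IH[OF smooth_on_dd[OF Suc.prems(1)] periodic_dd[OF Suc.prems(2,1)]] by auto
qed

lemma unif_bdd_parameter:
  assumes "\<Delta> \<subseteq> {0<..1}"
  shows "unif_bdd j \<Delta> (\<lambda>\<delta> _. of_real \<delta>)"
proof (cases j)
  case 0
  then show ?thesis using assms by (auto intro!: exI[of _ 1])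
next
  case (Suc i)
  have "unif_bdd i \<Delta> (\<lambda>\<delta>. dd (\<lambda>_. complex_of_real \<delta>) v)" for v
    by (rule unif_bdd_cong[OF _ unif_bdd_const[of "\<lambda>_. 0"]]) (auto simp: periodic_def)
  then show ?thesis using assms Suc by (auto intro!: exI[of _ 1])
qed

text \<open>Order four is needed because \<open>bessel\<close> differentiates twice in each of the
  two directions.\<close>

lemma unif_bdd_bessel:
  assumes "unif_bdd 4 \<Delta> F" "\<And>\<delta>. \<delta> \<in> \<Delta> \<Longrightarrow> smooth_on UNIV (F \<delta>)"
  shows "\<exists>C. \<forall>\<delta>\<in>\<Delta>. \<forall>z. norm (bessel (F \<delta>) z) \<le> C"
proof -
  have step: "unif_bdd j \<Delta> (\<lambda>\<delta> z. F \<delta> z - dd (dd (F \<delta>) v) v z)"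
    if "unif_bdd (Suc (Suc j)) \<Delta> F" "\<And>\<delta>. \<delta> \<in> \<Delta> \<Longrightarrow> smooth_on UNIV (F \<delta>)" "v \<in> {1, \<i>}" for j F v
  proof -
    have s: "smooth_on UNIV (\<lambda>z. dd (dd (F \<delta>) v) v z)" if "\<delta> \<in> \<Delta>" for \<delta>
      using that by (intro smooth_on_dd) (use \<open>\<And>\<delta>. \<delta> \<in> \<Delta> \<Longrightarrow> smooth_on UNIV (F \<delta>)\<close> in auto)
    have 1: "unif_bdd j \<Delta> (\<lambda>\<delta>. dd (dd (F \<delta>) v) v)"
      using that(1,3) by (auto simp del: unif_bdd.simps(1))
    have 2: "unif_bdd j \<Delta> (\<lambda>\<delta> z. (- 1) * dd (dd (F \<delta>) v) v z)"
      by (rule unif_bdd_mult[OF unif_bdd_const[of "\<lambda>_. - 1"] 1]) (auto simp: periodic_def s)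
    have "unif_bdd j \<Delta> (\<lambda>\<delta> z. F \<delta> z + (- 1) * dd (dd (F \<delta>) v) v z)"
      by (rule unif_bdd_add[OF unif_bdd_SucD[OF unif_bdd_SucD[OF that(1)]] 2 that(2)])
        (auto intro!: smooth_on_minus s)
    then show ?thesis by simp
  qed
  have h: "unif_bdd (Suc (Suc 0)) \<Delta> (\<lambda>\<delta> z. F \<delta> z - dd (dd (F \<delta>) 1) 1 z)"
    by (rule step) (use assms in \<open>auto simp: eval_nat_numeral simp del: unif_bdd.simps\<close>)
  have "unif_bdd 0 \<Delta> (\<lambda>\<delta> z. (F \<delta> z - dd (dd (F \<delta>) 1) 1 z)
      - dd (dd (\<lambda>z. F \<delta> z - dd (dd (F \<delta>) 1) 1 z) \<i>) \<i> z)"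
    by (rule step[OF h smooth_bessel_half]) (use assms(2) in auto)
  then show ?thesis by (simp add: bessel_def)
qed

section \<open>Zooming in on a point by a periodic map\<close>

context
  fixes U :: "complex set" and p :: complex and r :: real
  assumes U: "open U" "cball p (4 * r) \<subseteq> U" and r: "0 < r" "r \<le> 1"
begin

text \<open>Equals p + \<delta> z for |z| < 1, is periodic, and for \<delta> at most r stays in a
  fixed compact ball inside U. Composition with it makes a function on U periodic on the whole
  plane.\<close>

definition zoom :: "real \<Rightarrow> complex \<Rightarrow> complex" where
  "zoom \<delta> z = p + of_real \<delta> * saw_map z"

lemma dist_zoom: "0 \<le> \<delta> \<Longrightarrow> norm (zoom \<delta> z - p) \<le> 4 * \<delta>"
  using mult_left_mono[OF norm_saw_map_le[of z], of \<delta>] by (simp add: zoom_def norm_mult mult.commute)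

lemma zoom_in_cball: "\<delta> \<in> {0<..r} \<Longrightarrow> zoom \<delta> z \<in> cball p (4 * r)"
  using dist_zoom[of \<delta> z] by (auto simp: dist_norm norm_minus_commute)

lemma zoom_in: "\<delta> \<in> {0<..r} \<Longrightarrow> zoom \<delta> z \<in> U"
  using zoom_in_cball U by blast

lemma smooth_zoom: "smooth_on UNIV (zoom \<delta>)"
  unfolding zoom_def[abs_def] by (intro smooth_intros open_UNIV smooth_saw_map)

lemma dd_zoom: "dd (zoom \<delta>) v z = of_real \<delta> * dd saw_map v z"
proof -
  have "(zoom \<delta> has_derivative (\<lambda>v. of_real \<delta> * dd saw_map v z)) (at z)"
    unfolding zoom_def[abs_def]
    by (rule derivative_eq_intros smooth_on_has_derivative[OF smooth_saw_map] UNIV_I refl | simp)+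
  then show ?thesis using frechet_derivative_at by metis
qed

lemma smooth_comp_zoom:
  assumes "smooth_on U f" "\<delta> \<in> {0<..r}"
  shows "smooth_on UNIV (\<lambda>z. f (zoom \<delta> z))"
  by (rule smooth_on_compose[OF open_UNIV smooth_zoom zoom_in[OF assms(2)] assms(1)])

lemma dd_comp_zoom:
  assumes "smooth_on U f" "\<delta> \<in> {0<..r}"
  shows "dd (\<lambda>z. f (zoom \<delta> z)) v z = of_real \<delta> *
    (of_real (Re (dd saw_map v z)) * dd f 1 (zoom \<delta> z) + of_real (Im (dd saw_map v z)) * dd f \<i> (zoom \<delta> z))"
proof -
  have f: "(f has_derivative frechet_derivative f (at (zoom \<delta> z))) (at (zoom \<delta> z))"
    by (rule smooth_on_has_derivative[OF assms(1) zoom_in[OF assms(2)]])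
  have "dd (\<lambda>z. f (zoom \<delta> z)) v z = frechet_derivative f (at (zoom \<delta> z)) (dd (zoom \<delta>) v z)"
    by (rule dd_compose[OF smooth_zoom UNIV_I zoom_in[OF assms(2)] assms(1)])
  also have "\<dots> = of_real \<delta> *
    (of_real (Re (dd saw_map v z)) * dd f 1 (zoom \<delta> z) + of_real (Im (dd saw_map v z)) * dd f \<i> (zoom \<delta> z))"
    unfolding dd_zoom dd_expand[OF f, of "of_real \<delta> * dd saw_map v z"]
    by (simp add: scaleR_conv_of_real algebra_simps)
  finally show ?thesis .
qed

text \<open>This is the chain rule expression without its factor \<delta>. It is also the exact
  derivative of \<open>oscillation\<close>, whose division by \<delta> cancels that factor.\<close>

lemma unif_bdd_gradient:
  assumes "\<And>u. unif_bdd j {0<..r} (\<lambda>\<delta> z. dd f u (zoom \<delta> z))" "smooth_on U f"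
  shows "unif_bdd j {0<..r} (\<lambda>\<delta> z. of_real (Re (dd saw_map v z)) * dd f 1 (zoom \<delta> z)
    + of_real (Im (dd saw_map v z)) * dd f \<i> (zoom \<delta> z))"
proof -
  have sm: "smooth_on UNIV (\<lambda>z. complex_of_real (Re (dd saw_map v z)))" "smooth_on UNIV (\<lambda>z. complex_of_real (Im (dd saw_map v z)))"
    by (intro smooth_intros open_UNIV smooth_saw_map)+
  have pe: "periodic (\<lambda>z. complex_of_real (Re (dd saw_map v z)))" "periodic (\<lambda>z. complex_of_real (Im (dd saw_map v z)))"
    using periodic_dd[OF periodic_saw_map smooth_saw_map, of v] by (simp_all add: periodic_def)
  show ?thesis
    by (intro unif_bdd_add unif_bdd_mult unif_bdd_const sm pe assms smooth_on_mult[OF open_UNIV] smooth_comp_zoom smooth_on_dd)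
qed

text \<open>Values are bounded on the compact ball, and each derivative is \<delta>, at most 1,
  times derivatives of f composed with the zoom and derivatives of the fixed periodic map.\<close>

lemma unif_bdd_comp_zoom:
  assumes "smooth_on U f"
  shows "unif_bdd j {0<..r} (\<lambda>\<delta> z. f (zoom \<delta> z))"
  using assms
proof (induction j arbitrary: f)
  have bd: "\<exists>C. \<forall>\<delta>\<in>{0<..r}. \<forall>z. norm (f (zoom \<delta> z)) \<le> C" if "smooth_on U f" for f :: "complex \<Rightarrow> complex"
  proof -
    have "compact (f ` cball p (4 * r))"
      by (rule compact_continuous_image[OF continuous_on_subset[OF smooth_on_continuous_on[OF that] U(2)] compact_cball])
    then obtain C where "\<And>z. z \<in> cball p (4 * r) \<Longrightarrow> norm (f z) \<le> C"
      using compact_imp_bounded bounded_iff by (metis imageI)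
    then show ?thesis using zoom_in_cball by blast
  qed
  case 0
  then show ?case using bd by simp
  case (Suc j)
  have "unif_bdd j {0<..r} (\<lambda>\<delta>. dd (\<lambda>z. f (zoom \<delta> z)) v)" for v
  proof (rule unif_bdd_cong)
    show "unif_bdd j {0<..r} (\<lambda>\<delta> z. of_real \<delta> * (of_real (Re (dd saw_map v z)) * dd f 1 (zoom \<delta> z)
        + of_real (Im (dd saw_map v z)) * dd f \<i> (zoom \<delta> z)))"
      by (intro unif_bdd_mult unif_bdd_parameter unif_bdd_gradient Suc.IH[OF smooth_on_dd] Suc.prems smooth_on_const
          smooth_on_add[OF open_UNIV] smooth_on_mult[OF open_UNIV] smooth_comp_zoom smooth_on_dd smooth_intros open_UNIV
          smooth_saw_map)
        (use r in auto)
  qed (simp add: fun_eq_iff dd_comp_zoom[OF Suc.prems])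
  then show ?case using bd[OF Suc.prems] by simp
qed

definition oscillation :: "(complex \<Rightarrow> complex) \<Rightarrow> real \<Rightarrow> complex \<Rightarrow> complex" where
  "oscillation \<mu> \<delta> z = of_real (1 / \<delta>) * (\<mu> (zoom \<delta> z) - \<mu> p)"

lemma smooth_oscillation:
  assumes "smooth_on U \<mu>" "\<delta> \<in> {0<..r}"
  shows "smooth_on UNIV (oscillation \<mu> \<delta>)"
  unfolding oscillation_def[abs_def] by (intro smooth_intros smooth_comp_zoom assms open_UNIV)

lemma unif_bdd_oscillation:
  assumes "smooth_on U \<mu>"
  shows "unif_bdd j {0<..r} (oscillation \<mu>)"
proof -
  have "\<exists>C. \<forall>x\<in>cball p (4 * r). norm (dd \<mu> v x) \<le> C" for v
  proof -
    have "compact (dd \<mu> v ` cball p (4 * r))"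
      by (rule compact_continuous_image[OF continuous_on_subset[OF smooth_on_continuous_on[OF smooth_on_dd[OF assms]] U(2)] compact_cball])
    then show ?thesis by (auto dest!: compact_imp_bounded simp: bounded_iff)
  qed
  then obtain C1 C2 where C: "\<And>x. x \<in> cball p (4 * r) \<Longrightarrow> norm (dd \<mu> 1 x) \<le> C1"
    "\<And>x. x \<in> cball p (4 * r) \<Longrightarrow> norm (dd \<mu> \<i> x) \<le> C2" by blast
  have p: "p \<in> cball p (4 * r)" using r by simp
  have C0: "0 \<le> C1" "0 \<le> C2" using C[OF p] norm_ge_zero order_trans by blast+
  have bd: "norm (oscillation \<mu> \<delta> z) \<le> 4 * (C1 + C2)" if d: "\<delta> \<in> {0<..r}" for \<delta> z
  proof -
    have "norm (\<mu> (zoom \<delta> z) - \<mu> p) \<le> (C1 + C2) * norm (zoom \<delta> z - p)"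
    proof (rule differentiable_bound[OF convex_cball _ _ zoom_in_cball[OF d] p])
      fix x assume x: "x \<in> cball p (4 * r)"
      have D: "(\<mu> has_derivative frechet_derivative \<mu> (at x)) (at x)"
        using smooth_on_has_derivative[OF assms] U x by blast
      then show "(\<mu> has_derivative frechet_derivative \<mu> (at x)) (at x within cball p (4 * r))"
        by (rule has_derivative_at_withinI)
      show "onorm (frechet_derivative \<mu> (at x)) \<le> C1 + C2"
      proof (rule onorm_bound)
        fix v
        have "norm (frechet_derivative \<mu> (at x) v) \<le> \<bar>Re v\<bar> * norm (dd \<mu> 1 x) + \<bar>Im v\<bar> * norm (dd \<mu> \<i> x)"
          unfolding dd_expand[OF D, of v] by (rule order_trans[OF norm_triangle_ineq]) simp
        also have "\<dots> \<le> norm v * C1 + norm v * C2"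
          by (intro add_mono mult_mono C x abs_Re_le_cmod abs_Im_le_cmod) auto
        finally show "norm (frechet_derivative \<mu> (at x) v) \<le> (C1 + C2) * norm v" by (simp add: algebra_simps)
      qed (use C0 in simp)
    qed
    also have "\<dots> \<le> (C1 + C2) * (4 * \<delta>)" using dist_zoom[of \<delta> z] d C0 by (intro mult_left_mono) auto
    finally have *: "norm (\<mu> (zoom \<delta> z) - \<mu> p) \<le> (C1 + C2) * (4 * \<delta>)" .
    have "norm (oscillation \<mu> \<delta> z) = norm (\<mu> (zoom \<delta> z) - \<mu> p) / \<delta>"
      using d by (simp add: oscillation_def norm_divide)
    also have "\<dots> \<le> 4 * (C1 + C2)" using * d by (simp add: pos_divide_le_eq algebra_simps)
    finally show ?thesis .
  qed
  show ?thesis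
  proof (cases j)
    case 0
    then show ?thesis using bd unfolding 0 unif_bdd.simps by blast
  next
    case (Suc i)
    have "unif_bdd i {0<..r} (\<lambda>\<delta>. dd (oscillation \<mu> \<delta>) v)" for v
    proof (rule unif_bdd_cong)
      show "unif_bdd i {0<..r} (\<lambda>\<delta> z. of_real (Re (dd saw_map v z)) * dd \<mu> 1 (zoom \<delta> z)
        + of_real (Im (dd saw_map v z)) * dd \<mu> \<i> (zoom \<delta> z))"
        by (rule unif_bdd_gradient[OF unif_bdd_comp_zoom[OF smooth_on_dd[OF assms]] assms])
      fix \<delta> assume d: "\<delta> \<in> {0<..r}"
      have "dd (oscillation \<mu> \<delta>) v z = of_real (1 / \<delta>) * dd (\<lambda>z. \<mu> (zoom \<delta> z)) v z" for z
      proof -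
        have "(oscillation \<mu> \<delta> has_derivative (\<lambda>v. of_real (1 / \<delta>) * dd (\<lambda>z. \<mu> (zoom \<delta> z)) v z)) (at z)"
          unfolding oscillation_def[abs_def]
          by (rule derivative_eq_intros smooth_on_has_derivative[OF smooth_comp_zoom[OF assms d]] UNIV_I refl | simp)+
        then show ?thesis using frechet_derivative_at by metis
      qed
      then show "(\<lambda>z. of_real (Re (dd saw_map v z)) * dd \<mu> 1 (zoom \<delta> z)
        + of_real (Im (dd saw_map v z)) * dd \<mu> \<i> (zoom \<delta> z)) = dd (oscillation \<mu> \<delta>) v"
        unfolding dd_comp_zoom[OF assms d] using d by (simp add: fun_eq_iff)
    qed
    then show ?thesis using bd unfolding Suc unif_bdd.simps by blast
  qed
qed

text \<open>The coefficients of \<open>oscillation\<close> are bounded by C / wt with C independent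
  of \<delta>. Undoing the rescaling multiplies them by \<delta>, so their sum is at most \<delta> C
  S.\<close>

lemma fcoeff_oscillation_small:
  assumes "smooth_on U \<mu>" "\<epsilon> > 0"
  shows "\<exists>\<delta>\<in>{0<..r}. (\<Sum>\<^sub>\<infinity>k. norm (fcoeff (\<lambda>z. \<mu> (zoom \<delta> z) - \<mu> p) k)) < \<epsilon>"
proof -
  obtain C where C: "\<And>\<delta> z. \<delta> \<in> {0<..r} \<Longrightarrow> norm (bessel (oscillation \<mu> \<delta>) z) \<le> C"
    using unif_bdd_bessel[OF unif_bdd_oscillation[OF assms(1)] smooth_oscillation[OF assms(1)]] by blast
  have C0: "C \<ge> 0" using C[of r 0] r norm_ge_zero order_trans by (metis greaterThanAtMost_iff order_refl)
  define S where "S = (\<Sum>\<^sub>\<infinity>k. 1 / wt k)"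
  have S0: "S \<ge> 0" unfolding S_def using wt_ge_1 by (intro infsum_nonneg) (auto intro: order_trans[OF zero_le_one])
  \<comment> \<open>The summand 1 allows division by K when C S is zero.\<close>
  define K where "K = C * S + 1"
  define \<delta> where "\<delta> = min r (\<epsilon> / (2 * K))"
  have CS: "K > 0" using C0 S0 unfolding K_def by (intro add_nonneg_pos) auto
  have d: "\<delta> \<in> {0<..r}" using r assms(2) CS by (simp add: \<delta>_def)
  have per: "periodic (\<lambda>z. \<mu> (zoom \<delta> z))" "periodic (oscillation \<mu> \<delta>)"
    using periodic_saw_map by (simp_all add: periodic_def zoom_def oscillation_def)
  have le: "norm (fcoeff (\<lambda>z. \<mu> (zoom \<delta> z) - \<mu> p) k) \<le> (\<delta> * C) * (1 / wt k)" for k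
  proof -
    have "fcoeff (\<lambda>z. \<mu> (zoom \<delta> z) - \<mu> p) k = fcoeff (\<lambda>z. of_real \<delta> * oscillation \<mu> \<delta> z) k"
      using d by (simp add: oscillation_def)
    also have "\<dots> = of_real \<delta> * fcoeff (oscillation \<mu> \<delta>) k"
      unfolding fcoeff_def mult.assoc cell_integral_cmult by simp
    finally have "norm (fcoeff (\<lambda>z. \<mu> (zoom \<delta> z) - \<mu> p) k) = \<delta> * norm (fcoeff (oscillation \<mu> \<delta>) k)"
      using d by (simp add: norm_mult)
    also have "\<dots> \<le> \<delta> * (C * (1 / wt k))"
      using d by (intro mult_left_mono norm_fcoeff_bessel_le smooth_oscillation assms(1) per C) auto
    finally show ?thesis by simp
  qed
  have s: "(\<lambda>k. (\<delta> * C) * (1 / wt k)) summable_on UNIV"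
    by (rule summable_on_cmult_right[OF summable_inverse_wt])
  have "(\<Sum>\<^sub>\<infinity>k. norm (fcoeff (\<lambda>z. \<mu> (zoom \<delta> z) - \<mu> p) k)) \<le> (\<Sum>\<^sub>\<infinity>k. (\<delta> * C) * (1 / wt k))"
    by (rule infsum_mono[OF summable_on_comparison_test[OF s le] s le]) simp
  also have "\<dots> = \<delta> * (C * S)" unfolding S_def infsum_cmult_right' by (simp add: mult.assoc)
  also have "\<dots> \<le> \<delta> * K" using d by (simp add: K_def)
  also have "\<dots> \<le> \<epsilon> / (2 * K) * K"
    using CS by (intro mult_right_mono) (auto simp: \<delta>_def)
  also have "\<dots> < \<epsilon>" using CS assms(2) by simp
  finally show ?thesis using d by blast
qed

lemma zoom_inverse:
  assumes "\<delta> > 0" "norm (z - p) < \<delta>"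
  shows "zoom \<delta> ((z - p) / of_real \<delta>) = z"
  using assms by (simp add: zoom_def saw_map_id norm_divide)

end

section \<open>Isothermal coordinates\<close>

text \<open>On the ball of radius \<delta> around p the periodized coefficient is \<mu> itself, so
  the torus construction, scaled back, solves the original equation there. The final neighbourhood
  omits the zeros of the z-derivative.\<close>

lemma beltrami_local:
  assumes U: "open U" "p \<in> U" and \<mu>: "smooth_on U \<mu>" "norm (\<mu> p) < 1"
  shows "\<exists>V w. open V \<and> p \<in> V \<and> V \<subseteq> U \<and> smooth_on V w \<and>
    (\<forall>z\<in>V. deriv_zbar w z = \<mu> z * deriv_z w z \<and> deriv_z w z \<noteq> 0)"
proof -
  obtain e where e: "e > 0" "cball p e \<subseteq> U" using U open_contains_cball by blast
  define r where "r = min 1 (e / 4)"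
  have r: "0 < r" "r \<le> 1" and Ur: "cball p (4 * r) \<subseteq> U" using e by (auto simp: r_def)
  note z = U(1) Ur r
  have pos: "(1 - norm (\<mu> p)) / 2 > 0" using \<mu> by simp
  obtain \<delta> where d: "\<delta> \<in> {0<..r}"
    and small: "(\<Sum>\<^sub>\<infinity>k. norm (fcoeff (\<lambda>z. \<mu> (zoom p \<delta> z) - \<mu> p) k)) < (1 - norm (\<mu> p)) / 2"
    using fcoeff_oscillation_small[OF z \<mu>(1) pos] by blast
  let ?\<kappa> = "\<lambda>z. \<mu> (zoom p \<delta> z) - \<mu> p"
  have sm: "smooth_on UNIV ?\<kappa>"
    by (intro smooth_intros open_UNIV smooth_comp_zoom[OF z \<mu>(1) d])
  have per: "periodic ?\<kappa>" using periodic_saw_map by (simp add: periodic_def zoom_def[OF z])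
  interpret W: neumann "fcoeff ?\<kappa>" torus_freq "\<mu> p"
    by unfold_locales
      (use \<mu>(2) small rapid_fcoeff[OF sm per] in \<open>auto simp: torus_freq_def case_prod_beta'\<close>)
  let ?t = "\<lambda>z. (z - p) / of_real \<delta>"
  define w where "w = (\<lambda>z. W.w (?t z))"
  have d0: "\<delta> > 0" using d by simp
  have t: "(?t has_derivative (\<lambda>v. v / of_real \<delta>)) (at z)" for z
    using d0 by (auto intro!: derivative_eq_intros)
  have dw: "dd w v z = of_real (1 / \<delta>) * dd W.w v (?t z)" for v z
  proof -
    have W: "(W.w has_derivative frechet_derivative W.w (at (?t z))) (at (?t z))"
      by (rule smooth_on_has_derivative[OF W.smooth_w]) simp
    have "(w has_derivative (\<lambda>v. frechet_derivative W.w (at (?t z)) (v / of_real \<delta>))) (at z)"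
      unfolding w_def by (rule has_derivative_compose[OF t W])
    from fun_cong[OF frechet_derivative_at[OF this], of v]
    have "dd w v z = frechet_derivative W.w (at (?t z)) (v / of_real \<delta>)" by simp
    also have "v / of_real \<delta> = (1 / \<delta>) *\<^sub>R v" by (simp add: scaleR_conv_of_real)
    also have "frechet_derivative W.w (at (?t z)) ((1 / \<delta>) *\<^sub>R v) = (1 / \<delta>) *\<^sub>R dd W.w v (?t z)"
      by (rule linear_scale[OF has_derivative_linear[OF W]])
    finally show ?thesis by (simp add: scaleR_conv_of_real)
  qed
  have dz: "deriv_z w z = of_real (1 / \<delta>) * deriv_z W.w (?t z)"
    "deriv_zbar w z = of_real (1 / \<delta>) * deriv_zbar W.w (?t z)" for z
    unfolding deriv_z_def deriv_zbar_def dw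
    by (simp_all add: algebra_simps diff_divide_distrib add_divide_distrib del: of_real_divide)
  have sw: "smooth_on UNIV w"
    unfolding w_def
    by (rule smooth_on_compose[OF open_UNIV _ _ W.smooth_w])
      (use d0 in \<open>auto intro!: smooth_on_divide[OF open_UNIV] smooth_on_diff[OF open_UNIV]\<close>)
  have eq: "deriv_zbar w z = \<mu> z * deriv_z w z" if "z \<in> ball p \<delta>" for z
  proof -
    have n: "norm (z - p) < \<delta>" using that by (simp add: dist_norm norm_minus_commute)
    then have n1: "norm (?t z) < 1" using d0 by (simp add: norm_divide)
    have "\<bar>Re (?t z)\<bar> \<le> pi" "\<bar>Im (?t z)\<bar> \<le> pi"
      using abs_Re_le_cmod[of "?t z"] abs_Im_le_cmod[of "?t z"] n1 pi_gt3 by linarith+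
    then have "?\<kappa> (Complex (Re (?t z)) (Im (?t z))) = wave_sum (fcoeff ?\<kappa>) torus_freq (Complex (Re (?t z)) (Im (?t z)))"
      by (intro fourier_inversion[OF sm per]) linarith+
    then have "wave_sum (fcoeff ?\<kappa>) torus_freq (?t z) = \<mu> z - \<mu> p"
      using zoom_inverse[OF z d0 n] by (simp only: complex_surj)
    then show ?thesis unfolding dz W.deriv_zbar_w by simp
  qed
  have c: "continuous_on UNIV (\<lambda>z. deriv_z w z)"
    unfolding deriv_z_def
    by (intro smooth_on_continuous_on smooth_intros open_UNIV sw) simp
  define V where "V = ball p \<delta> \<inter> {z. deriv_z w z \<noteq> 0}"
  have "open {z. deriv_z w z \<noteq> 0}" by (intro open_Collect_neq c continuous_on_const)
  then have "open V" by (simp add: V_def open_Int)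
  moreover have "p \<in> V" using d0 W.P_0 by (simp add: V_def dz W.deriv_z_w)
  moreover have "V \<subseteq> U" using Ur d by (auto simp: V_def)
  ultimately show ?thesis using eq smooth_on_subset[OF sw] by (auto simp: V_def intro!: exI[of _ V] exI[of _ w])
qed

text \<open>The form E dx^2 + 2 F dx dy + G dy^2 is a positive multiple of |dz + \<mu> dzbar|^2 for
  \<mu> = (E - G + 2 i F) / (E + G + 2 sqrt (E G - F^2)). A solution of the Beltrami equation has dw
  = w_z (dz + \<mu> dzbar), so |dw|^2 is a multiple of the form.\<close>

lemma isothermal_map:
  fixes E F G :: "complex \<Rightarrow> real"
  assumes U: "open U" "p \<in> U" and sm: "smooth_on U E" "smooth_on U F" "smooth_on U G"
    and pos: "\<And>z. z \<in> U \<Longrightarrow> E z > 0" "\<And>z. z \<in> U \<Longrightarrow> G z > 0" "\<And>z. z \<in> U \<Longrightarrow> E z * G z - (F z)\<^sup>2 > 0"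
  shows "\<exists>V (w :: complex \<Rightarrow> complex). open V \<and> p \<in> V \<and> V \<subseteq> U \<and> smooth_on V w \<and>
    (\<forall>z\<in>V. \<exists>\<rho>>0. E z = \<rho> * (dd w 1 z \<bullet> dd w 1 z) \<and> F z = \<rho> * (dd w 1 z \<bullet> dd w \<i> z)
      \<and> G z = \<rho> * (dd w \<i> z \<bullet> dd w \<i> z))"
proof -
  define S where "S = (\<lambda>z. sqrt (E z * G z - (F z)\<^sup>2))"
  define M where "M = (\<lambda>z. E z + G z + 2 * S z)"
  define a where "a = (\<lambda>z. (E z - G z) / M z)"
  define b where "b = (\<lambda>z. 2 * F z / M z)"
  define \<mu> where "\<mu> = (\<lambda>z. complex_of_real (a z) + \<i> * of_real (b z))"
  have S: "S z > 0" "(S z)\<^sup>2 = E z * G z - (F z)\<^sup>2" if "z \<in> U" for z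
    using pos[OF that] by (simp_all add: S_def)
  have M: "M z > 0" if "z \<in> U" for z using pos[OF that] S[OF that] by (simp add: M_def)
  have sS: "smooth_on U S" unfolding S_def by (intro smooth_intros U sm) (use pos in auto)
  have sM: "smooth_on U M" unfolding M_def by (intro smooth_intros U sm sS)
  have s\<mu>: "smooth_on U \<mu>"
    unfolding \<mu>_def a_def b_def by (intro smooth_intros U sm sM) (use M in force)+
  have cancel: "X = Y / m" if "m > 0" "X * m\<^sup>2 = Y * m" for X Y m :: real
    using that by (auto simp: power2_eq_square eq_divide_eq)
  \<comment> \<open>The three quantities are |1 + \<mu>|^2, |1 - \<mu>|^2 and |\<mu>|^2; each is
    checked after multiplication by M^2.\<close>
  have alg: "(1 + a z)\<^sup>2 + (b z)\<^sup>2 = 4 * E z / M z" "(1 - a z)\<^sup>2 + (b z)\<^sup>2 = 4 * G z / M z"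
    "(a z)\<^sup>2 + (b z)\<^sup>2 < 1" if z: "z \<in> U" for z
  proof -
    have aM: "a z * M z = E z - G z" "b z * M z = 2 * F z" using M[OF z] by (simp_all add: a_def b_def)
    have "((1 + a z)\<^sup>2 + (b z)\<^sup>2) * (M z)\<^sup>2 = (M z + a z * M z)\<^sup>2 + (b z * M z)\<^sup>2"
      by (simp add: power2_eq_square algebra_simps)
    also have "\<dots> = (2 * E z + 2 * S z)\<^sup>2 + 4 * (F z)\<^sup>2" unfolding aM by (simp add: M_def power2_eq_square algebra_simps)
    also have "\<dots> = 4 * (E z)\<^sup>2 + 8 * E z * S z + 4 * ((S z)\<^sup>2 + (F z)\<^sup>2)" by (simp add: power2_eq_square algebra_simps)
    also have "\<dots> = (4 * E z) * M z" unfolding S(2)[OF z] by (simp add: M_def power2_eq_square algebra_simps)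
    finally show "(1 + a z)\<^sup>2 + (b z)\<^sup>2 = 4 * E z / M z" by (rule cancel[OF M[OF z]])
    have "((1 - a z)\<^sup>2 + (b z)\<^sup>2) * (M z)\<^sup>2 = (M z - a z * M z)\<^sup>2 + (b z * M z)\<^sup>2"
      by (simp add: power2_eq_square algebra_simps)
    also have "\<dots> = (2 * G z + 2 * S z)\<^sup>2 + 4 * (F z)\<^sup>2" unfolding aM by (simp add: M_def power2_eq_square algebra_simps)
    also have "\<dots> = 4 * (G z)\<^sup>2 + 8 * G z * S z + 4 * ((S z)\<^sup>2 + (F z)\<^sup>2)" by (simp add: power2_eq_square algebra_simps)
    also have "\<dots> = (4 * G z) * M z" unfolding S(2)[OF z] by (simp add: M_def power2_eq_square algebra_simps)
    finally show "(1 - a z)\<^sup>2 + (b z)\<^sup>2 = 4 * G z / M z" by (rule cancel[OF M[OF z]])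
    have "((a z)\<^sup>2 + (b z)\<^sup>2) * (M z)\<^sup>2 = (a z * M z)\<^sup>2 + (b z * M z)\<^sup>2"
      by (simp add: power2_eq_square algebra_simps)
    also have "\<dots> = (E z + G z)\<^sup>2 - 4 * ((S z)\<^sup>2)" unfolding aM S(2)[OF z] by (simp add: power2_eq_square algebra_simps)
    also have "\<dots> < 1 * (M z)\<^sup>2"
      using S[OF z] pos[OF z] by (simp add: M_def power2_eq_square algebra_simps add_pos_pos)
    finally show "(a z)\<^sup>2 + (b z)\<^sup>2 < 1" using M[OF z] by (simp only: mult_less_cancel_right) auto
  qed
  have "norm (\<mu> p) < 1" using alg(3)[OF U(2)] by (simp add: \<mu>_def cmod_def)
  then obtain V w where V: "open V" "p \<in> V" "V \<subseteq> U" "smooth_on V w"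
    and w: "\<And>z. z \<in> V \<Longrightarrow> deriv_zbar w z = \<mu> z * deriv_z w z" "\<And>z. z \<in> V \<Longrightarrow> deriv_z w z \<noteq> 0"
    using beltrami_local[OF U s\<mu>] by blast
  have "\<exists>\<rho>>0. E z = \<rho> * (dd w 1 z \<bullet> dd w 1 z) \<and> F z = \<rho> * (dd w 1 z \<bullet> dd w \<i> z)
      \<and> G z = \<rho> * (dd w \<i> z \<bullet> dd w \<i> z)" if z: "z \<in> V" for z
  proof -
    have zU: "z \<in> U" using z V by blast
    define P where "P = deriv_z w z"
    have P: "P \<noteq> 0" using w(2)[OF z] by (simp add: P_def)
    have d1: "dd w 1 z = P * (1 + \<mu> z)"
      using w(1)[OF z] unfolding P_def deriv_z_def deriv_zbar_def by (simp add: field_simps) algebra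
    have d2: "dd w \<i> z = P * (\<i> * (1 - \<mu> z))"
    proof -
      have "dd w \<i> z = \<i> * (deriv_z w z - deriv_zbar w z)"
        unfolding deriv_z_def deriv_zbar_def by (simp add: field_simps)
      then show ?thesis using w(1)[OF z] by (simp add: P_def algebra_simps)
    qed
    have inn: "(P * x) \<bullet> (P * y) = (norm P)\<^sup>2 * (x \<bullet> y)" for x y
      unfolding cmod_power2 by (simp add: inner_complex_def power2_eq_square algebra_simps)
    have 1: "dd w 1 z \<bullet> dd w 1 z = (norm P)\<^sup>2 * (4 * E z / M z)"
      unfolding d1 inn alg(1)[OF zU, symmetric] by (simp add: \<mu>_def inner_complex_def power2_eq_square)
    have 2: "dd w \<i> z \<bullet> dd w \<i> z = (norm P)\<^sup>2 * (4 * G z / M z)"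
      unfolding d2 inn alg(2)[OF zU, symmetric] by (simp add: \<mu>_def inner_complex_def power2_eq_square)
    have "dd w 1 z \<bullet> dd w \<i> z = (norm P)\<^sup>2 * (2 * b z)"
      unfolding d1 d2 inn by (simp add: \<mu>_def inner_complex_def power2_eq_square algebra_simps)
    then have 3: "dd w 1 z \<bullet> dd w \<i> z = (norm P)\<^sup>2 * (4 * F z / M z)" by (simp add: b_def)
    show ?thesis
      by (rule exI[of _ "M z / (4 * (norm P)\<^sup>2)"]) (use P M[OF zU] in \<open>simp add: 1 2 3\<close>)
  qed
  with V show ?thesis by blast
qed

lemma smooth_local_inverse:
  fixes w :: "complex \<Rightarrow> complex"
  assumes "open V" "p \<in> V" "smooth_on V w" "inj (frechet_derivative w (at p))"
  shows "\<exists>U' V' g. open U' \<and> p \<in> U' \<and> U' \<subseteq> V \<and> open V' \<and> homeomorphism U' V' w g \<and> smooth_on V' g"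
proof -
  define f' where "f' = (\<lambda>x. Blinfun (frechet_derivative w (at x)))"
  have D: "(w has_derivative frechet_derivative w (at x)) (at x)" if "x \<in> V" for x
    by (rule smooth_on_has_derivative[OF assms(3) that])
  have f': "blinfun_apply (f' x) = frechet_derivative w (at x)" if "x \<in> V" for x
    unfolding f'_def by (rule bounded_linear_Blinfun_apply[OF has_derivative_bounded_linear[OF D[OF that]]])
  \<comment> \<open>The inverse function theorem asks for continuity in the operator norm, which in
    finite dimension is continuity in every direction.\<close>
  have cont: "continuous_on V f'"
  proof (rule continuous_on_blinfun_componentwise)
    fix i :: complex
    have "continuous_on V (\<lambda>x. frechet_derivative w (at x) i)"
      by (rule smooth_on_continuous_on[OF smooth_on_dd[OF assms(3)]])
    then show "continuous_on V (\<lambda>x. blinfun_apply (f' x) i)" by (simp add: f' cong: continuous_on_cong)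
  qed
  obtain L where L: "linear L" "L \<circ> frechet_derivative w (at p) = id"
    using linear_injective_left_inverse[OF has_derivative_linear[OF D[OF assms(2)]] assms(4)] by blast
  have "Blinfun L o\<^sub>L f' p = id_blinfun"
    by (rule blinfun_eqI)
      (use L in \<open>simp add: f'[OF assms(2)] bounded_linear_Blinfun_apply linear_conv_bounded_linear fun_eq_iff\<close>)
  then obtain U' V' g g' where *: "open U'" "U' \<subseteq> V" "p \<in> U'" "open V'" "w p \<in> V'" "homeomorphism U' V' w g"
    "\<And>y. y \<in> V' \<Longrightarrow> (g has_derivative (g' y)) (at y)"
    using inverse_function_theorem[OF assms(1) _ cont assms(2)] D f' by (metis (no_types, lifting))
  have "smooth_on V' g"
    by (rule smooth_on_inverse_map[OF *(4,7) _ _ assms(3)]) (use *(2,6) in \<open>auto simp: homeomorphism_def\<close>)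
  then show ?thesis using * by blast
qed

section \<open>Quaternions\<close>

definition qcnj :: "quat \<Rightarrow> quat" where
  "qcnj p = (cnj (fst p), - snd p)"

lemma qmult_assoc: "qmult (qmult p q) r = qmult p (qmult q r)"
  by (simp add: qmult_def algebra_simps)

lemma qmult_add_left: "qmult (p + q) r = qmult p r + qmult q r"
  by (simp add: qmult_def algebra_simps)

lemma qmult_add_right: "qmult p (q + r) = qmult p q + qmult p r"
  by (simp add: qmult_def algebra_simps)

lemma qmult_scaleR_left: "qmult (c *\<^sub>R p) q = c *\<^sub>R qmult p q"
  by (simp add: qmult_def scaleR_conv_of_real algebra_simps)

lemma qmult_scaleR_right: "qmult p (c *\<^sub>R q) = c *\<^sub>R qmult p q"
  by (simp add: qmult_def scaleR_conv_of_real algebra_simps)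

lemma bounded_bilinear_qmult: "bounded_bilinear qmult"
proof -
  have "bounded_linear (\<lambda>p. qmult p q)" "bounded_linear (qmult q)" for q
    by (intro linear_conv_bounded_linear[THEN iffD1] linearI
        qmult_add_left qmult_scaleR_left qmult_add_right qmult_scaleR_right)+
  then show ?thesis
    by (simp add: bilinear_conv_bounded_bilinear[symmetric] bilinear_def linear_conv_bounded_linear)
qed

lemma qmult_one [simp]: "qmult qone p = p" "qmult p qone = p"
  by (simp_all add: qmult_def qone_def)

lemma inner_quat: "p \<bullet> q = Re (fst p) * Re (fst q) + Im (fst p) * Im (fst q)
    + (Re (snd p) * Re (snd q) + Im (snd p) * Im (snd q))" for p q :: quat
  by (simp add: inner_prod_def inner_complex_def)

lemma qmult_qcnj: "qmult (qcnj p) p = (p \<bullet> p) *\<^sub>R qone" "qmult p (qcnj p) = (p \<bullet> p) *\<^sub>R qone"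
  by (simp_all add: inner_quat qmult_def qcnj_def qone_def complex_eq_iff algebra_simps prod_eq_iff)

lemma qmult_qcnj_cancel:
  assumes "norm X = 1"
  shows "qmult X (qmult (qcnj X) w) = w"
proof -
  have "X \<bullet> X = 1" using assms by (simp add: dot_square_norm)
  then show ?thesis by (simp add: qmult_assoc[symmetric] qmult_qcnj)
qed

lemma inner_qmult_left: "qmult p q \<bullet> r = q \<bullet> qmult (qcnj p) r"
  by (simp add: inner_quat qmult_def qcnj_def algebra_simps)

lemma inner_qmult_self: "u \<bullet> qmult u y = (u \<bullet> u) * (qone \<bullet> y)" "u \<bullet> qmult y u = (u \<bullet> u) * (qone \<bullet> y)"
  by (simp_all add: inner_quat qmult_def qone_def algebra_simps)

lemma qone_inner: "qone \<bullet> qmult (qcnj X) w = X \<bullet> w" "qone \<bullet> qmult v (qcnj X) = v \<bullet> X"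
  by (simp_all add: inner_quat qmult_def qone_def qcnj_def algebra_simps)

text \<open>Left translated to the identity, the product of tangent vectors \<open>X\<alpha>\<close> and \<open>X\<beta>\<close> is
  \<open>X\<alpha>\<beta>\<close>; its part tangent to the sphere is the cross product, so the following form is
  the volume form on the tangent space at \<open>X\<close>.\<close>

definition triple :: "quat \<Rightarrow> quat \<Rightarrow> quat \<Rightarrow> quat \<Rightarrow> real" where
  "triple X u v w = u \<bullet> qmult v (qmult (qcnj X) w)"

lemma triple_linear:
  "triple X (u + u') v w = triple X u v w + triple X u' v w"
  "triple X u (v + v') w = triple X u v w + triple X u v' w"
  "triple X u v (w + w') = triple X u v w + triple X u v w'"
  "triple X (c *\<^sub>R u) v w = c * triple X u v w"
  "triple X u (c *\<^sub>R v) w = c * triple X u v w"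
  "triple X u v (c *\<^sub>R w) = c * triple X u v w"
  by (simp_all add: triple_def inner_add_left inner_add_right qmult_add_left qmult_add_right
      qmult_scaleR_left qmult_scaleR_right)

lemma triple_eq_12: "triple X u u w = (u \<bullet> u) * (X \<bullet> w)"
  by (simp add: triple_def inner_qmult_self qone_inner)

lemma triple_eq_13: "triple X u v u = (u \<bullet> u) * (v \<bullet> X)"
  by (simp add: triple_def inner_qmult_self qone_inner qmult_assoc[symmetric])

text \<open>The polarization of v (cnj X) v = 2 (v \<bullet> X) v - (v \<bullet> v) X. For v and w
  orthogonal to X only a multiple of X remains, which makes \<open>triple\<close> alternating on
  tangent vectors.\<close>

lemma qmult_swap: "qmult v (qmult (qcnj X) w) + qmult w (qmult (qcnj X) v)
    = (2 * (v \<bullet> X)) *\<^sub>R w + (2 * (w \<bullet> X)) *\<^sub>R v - (2 * (v \<bullet> w)) *\<^sub>R X"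
  by (simp add: inner_quat qmult_def qcnj_def complex_eq_iff algebra_simps prod_eq_iff)

lemma triple_swap_23:
  assumes "u \<bullet> X = 0" "v \<bullet> X = 0" "w \<bullet> X = 0"
  shows "triple X u v w = - triple X u w v"
proof -
  have "triple X u v w + triple X u w v = 0"
    unfolding triple_def inner_add_right[symmetric] qmult_swap using assms
    by (simp add: inner_diff_right inner_add_right)
  then show ?thesis by simp
qed

text \<open>Otherwise there would be five nonzero pairwise orthogonal vectors in dimension
  four.\<close>

lemma orthogonal_to_frame:
  fixes a b c d y :: quat
  assumes "a \<noteq> 0" "b \<noteq> 0" "c \<noteq> 0" "d \<noteq> 0"
    and "a \<bullet> b = 0" "a \<bullet> c = 0" "a \<bullet> d = 0" "b \<bullet> c = 0" "b \<bullet> d = 0" "c \<bullet> d = 0"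
    and "y \<bullet> a = 0" "y \<bullet> b = 0" "y \<bullet> c = 0" "y \<bullet> d = 0"
  shows "y = 0"
proof (rule ccontr)
  assume y: "y \<noteq> 0"
  have ne: "p \<noteq> q" if "p \<bullet> q = 0" "p \<noteq> 0" for p q :: quat using that by auto
  have d: "y \<noteq> a" "y \<noteq> b" "y \<noteq> c" "y \<noteq> d" "a \<noteq> b" "a \<noteq> c" "a \<noteq> d" "b \<noteq> c" "b \<noteq> d" "c \<noteq> d"
    using ne assms y by blast+
  have "pairwise orthogonal {y, a, b, c, d}"
    using assms(5-) by (auto simp: pairwise_def orthogonal_def inner_commute)
  then have "independent {y, a, b, c, d}"
    by (rule pairwise_orthogonal_independent) (use assms y in auto)
  then have "card {y, a, b, c, d} \<le> DIM(quat)"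
    using independent_bound by blast
  moreover have "card {y, a, b, c, d} = 5" using d by simp
  ultimately show False by simp
qed

section \<open>Surface patches in the sphere\<close>

lemma dd_eqI: "(f has_derivative f') (at z) \<Longrightarrow> dd f v z = f' v"
  using frechet_derivative_at[of f f' z] by simp

definition gram :: "(complex \<Rightarrow> quat) \<Rightarrow> complex \<Rightarrow> complex \<Rightarrow> complex \<Rightarrow> real" where
  "gram X z u v = dd X u z \<bullet> dd X v z"

definition sform :: "(complex \<Rightarrow> quat) \<Rightarrow> (complex \<Rightarrow> quat) \<Rightarrow> complex \<Rightarrow> complex \<Rightarrow> complex \<Rightarrow> real" where
  "sform X n z u v = - dd n u z \<bullet> dd X v z"

definition form_det :: "(complex \<Rightarrow> complex \<Rightarrow> real) \<Rightarrow> real" where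
  "form_det Q = Q 1 1 * Q \<i> \<i> - Q 1 \<i> * Q \<i> 1"

text \<open>Gauss's quotient of the determinants of the second and first fundamental forms.
  \<open>shape_det\<close> identifies it with the determinant of the shape operator, and unlike the
  latter it involves no \<open>THE\<close>.\<close>

definition curv :: "(complex \<Rightarrow> quat) \<Rightarrow> (complex \<Rightarrow> quat) \<Rightarrow> complex \<Rightarrow> real" where
  "curv X n z = form_det (sform X n z) / form_det (gram X z)"

definition lap :: "(complex \<Rightarrow> 'b::real_normed_vector) \<Rightarrow> complex \<Rightarrow> 'b" where
  "lap f z = dd (dd f 1) 1 z + dd (dd f \<i>) \<i> z"

locale patch =
  fixes X n :: "complex \<Rightarrow> quat" and V :: "complex set"
  assumes open_V: "open V"
    and smooth_X: "smooth_on V X" and smooth_n: "smooth_on V n"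
    and norm_X: "\<And>z. z \<in> V \<Longrightarrow> norm (X z) = 1" and norm_n: "\<And>z. z \<in> V \<Longrightarrow> norm (n z) = 1"
    and n_X: "\<And>z. z \<in> V \<Longrightarrow> n z \<bullet> X z = 0"
    and n_dX: "\<And>z v. z \<in> V \<Longrightarrow> n z \<bullet> dd X v z = 0"
    and inj_dX: "\<And>z. z \<in> V \<Longrightarrow> inj (frechet_derivative X (at z))"
begin

lemma dd_inner:
  fixes f g :: "complex \<Rightarrow> quat"
  assumes "smooth_on V f" "smooth_on V g" "z \<in> V"
  shows "dd (\<lambda>z. f z \<bullet> g z) v z = f z \<bullet> dd g v z + dd f v z \<bullet> g z"
  by (rule dd_bilinear[OF bounded_bilinear_inner assms])

lemma dd_locally_const:
  fixes f :: "complex \<Rightarrow> real"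
  assumes "\<And>z. z \<in> V \<Longrightarrow> f z = c" "z \<in> V"
  shows "dd f v z = 0"
proof -
  have "dd f v z = dd (\<lambda>_. c) v z"
    using frechet_derivative_cong_open[OF open_V assms(2), of f "\<lambda>_. c"] assms(1) by simp
  then show ?thesis by simp
qed

lemmas smooth = smooth_X smooth_n smooth_on_dd[OF smooth_X] smooth_on_dd[OF smooth_n]
  smooth_on_dd[OF smooth_on_dd[OF smooth_X]] smooth_on_dd[OF smooth_on_dd[OF smooth_n]]

lemma X_dX: "z \<in> V \<Longrightarrow> dd X v z \<bullet> X z = 0"
proof -
  assume z: "z \<in> V"
  have "dd (\<lambda>z. X z \<bullet> X z) v z = 0"
    by (rule dd_locally_const[OF _ z]) (use norm_X in \<open>simp add: dot_square_norm\<close>)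
  then show ?thesis using dd_inner[OF smooth(1,1) z] by (simp add: inner_commute)
qed

lemma n_dn: "z \<in> V \<Longrightarrow> dd n v z \<bullet> n z = 0"
proof -
  assume z: "z \<in> V"
  have "dd (\<lambda>z. n z \<bullet> n z) v z = 0"
    by (rule dd_locally_const[OF _ z]) (use norm_n in \<open>simp add: dot_square_norm\<close>)
  then show ?thesis using dd_inner[OF smooth(2,2) z] by (simp add: inner_commute)
qed

lemma X_dn: "z \<in> V \<Longrightarrow> dd n v z \<bullet> X z = 0"
proof -
  assume z: "z \<in> V"
  have "dd (\<lambda>z. n z \<bullet> X z) v z = 0" by (rule dd_locally_const[OF _ z]) (rule n_X)
  then show ?thesis using dd_inner[OF smooth(2,1) z] n_dX[OF z] by simp
qed

text \<open>Obtained by differentiating the orthogonality of n and \<open>dd X v\<close>. Symmetry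
  of the second form then is symmetry of second derivatives.\<close>

lemma sform_normal: "z \<in> V \<Longrightarrow> sform X n z u v = n z \<bullet> dd (dd X v) u z"
proof -
  assume z: "z \<in> V"
  have "dd (\<lambda>z. n z \<bullet> dd X v z) u z = 0" by (rule dd_locally_const[OF _ z]) (rule n_dX)
  then show ?thesis using dd_inner[OF smooth(2,3) z] by (simp add: sform_def)
qed

lemma sform_sym: "z \<in> V \<Longrightarrow> sform X n z u v = sform X n z v u"
  by (simp add: sform_normal dd_commute[OF open_V smooth_X, of z u v])

lemma has_derivative_X: "z \<in> V \<Longrightarrow> (X has_derivative frechet_derivative X (at z)) (at z)"
  by (rule smooth_on_has_derivative[OF smooth_X])

lemma has_derivative_n: "z \<in> V \<Longrightarrow> (n has_derivative frechet_derivative n (at z)) (at z)"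
  by (rule smooth_on_has_derivative[OF smooth_n])

lemma dX_nonzero:
  assumes "z \<in> V" "v \<noteq> 0"
  shows "dd X v z \<noteq> 0"
proof
  have lin: "linear (frechet_derivative X (at z))" by (rule has_derivative_linear[OF has_derivative_X[OF assms(1)]])
  assume "dd X v z = 0"
  then have "frechet_derivative X (at z) v = frechet_derivative X (at z) 0" by (simp add: linear_0[OF lin])
  then show False using inj_dX[OF assms(1)] assms(2) by (simp add: inj_eq)
qed

lemma gram_pos: "z \<in> V \<Longrightarrow> v \<noteq> 0 \<Longrightarrow> gram X z v v > 0"
  using dX_nonzero by (simp add: gram_def)

lemma gram_sym: "gram X z u v = gram X z v u"
  by (simp add: gram_def inner_commute)

text \<open>Gram-Schmidt without division. The squared norm of this vector is
  \<open>gram X z 1 1\<close> times the Gram determinant, and the vector completes X, n and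
  \<open>dd X 1\<close> to an orthogonal frame.\<close>

lemma orthogonalized:
  assumes z: "z \<in> V"
  shows "gram X z 1 1 *\<^sub>R dd X \<i> z - gram X z 1 \<i> *\<^sub>R dd X 1 z \<noteq> 0"
proof -
  let ?v = "gram X z 1 1 *\<^sub>R \<i> - gram X z 1 \<i> *\<^sub>R 1"
  have lin: "linear (frechet_derivative X (at z))" by (rule has_derivative_linear[OF has_derivative_X[OF z]])
  have "?v \<noteq> 0" using gram_pos[OF z, of 1] by (auto simp: complex_eq_iff)
  then have "frechet_derivative X (at z) ?v \<noteq> 0" using dX_nonzero[OF z] by blast
  then show ?thesis by (simp only: linear_diff[OF lin] linear_scale[OF lin] not_False_eq_True)
qed

lemma gram_det_pos:
  assumes z: "z \<in> V"
  shows "form_det (gram X z) > 0"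
proof -
  let ?y = "gram X z 1 1 *\<^sub>R dd X \<i> z - gram X z 1 \<i> *\<^sub>R dd X 1 z"
  have "?y \<bullet> ?y = gram X z 1 1 * form_det (gram X z)"
    by (simp add: form_det_def gram_def inner_diff_left inner_diff_right inner_commute algebra_simps)
  moreover have "?y \<bullet> ?y > 0" using orthogonalized[OF z] by simp
  ultimately show ?thesis using gram_pos[OF z, of 1] by (simp add: zero_less_mult_iff)
qed

lemma frame_complete:
  assumes z: "z \<in> V" and y: "y \<bullet> X z = 0" "y \<bullet> n z = 0" "y \<bullet> dd X 1 z = 0" "y \<bullet> dd X \<i> z = 0"
  shows "y = 0"
proof (rule orthogonal_to_frame)
  let ?y = "gram X z 1 1 *\<^sub>R dd X \<i> z - gram X z 1 \<i> *\<^sub>R dd X 1 z"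
  show "X z \<noteq> 0" "n z \<noteq> 0" using norm_X[OF z] norm_n[OF z] by auto
  show "dd X 1 z \<noteq> 0" "?y \<noteq> 0" using dX_nonzero[OF z] orthogonalized[OF z] by auto
  show "X z \<bullet> n z = 0" "X z \<bullet> dd X 1 z = 0" "n z \<bullet> dd X 1 z = 0" "X z \<bullet> ?y = 0" "n z \<bullet> ?y = 0"
    using n_X[OF z] X_dX[OF z] n_dX[OF z] by (simp_all add: inner_commute inner_diff_right)
  show "dd X 1 z \<bullet> ?y = 0" by (simp add: gram_def inner_diff_right inner_commute)
  show "y \<bullet> X z = 0" "y \<bullet> n z = 0" "y \<bullet> dd X 1 z = 0" by fact+
  show "y \<bullet> ?y = 0" using y by (simp add: inner_diff_right)
qed

lemma frame_expansion:
  assumes z: "z \<in> V"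
  obtains a b where "y = (y \<bullet> X z) *\<^sub>R X z + (y \<bullet> n z) *\<^sub>R n z + a *\<^sub>R dd X 1 z + b *\<^sub>R dd X \<i> z"
proof -
  let ?E = "gram X z 1 1" and ?F = "gram X z 1 \<i>" and ?G = "gram X z \<i> \<i>" and ?D = "form_det (gram X z)"
  have D: "?D > 0" by (rule gram_det_pos[OF z])
  have DE: "?D = ?E * ?G - ?F * ?F" by (simp add: form_det_def gram_sym[of z \<i> 1])
  define p q where "p = y \<bullet> dd X 1 z" and "q = y \<bullet> dd X \<i> z"
  \<comment> \<open>Cramer's rule for the Gram system with right-hand side p, q.\<close>
  define a b where "a = (?G * p - ?F * q) / ?D" and "b = (?E * q - ?F * p) / ?D"
  have ab: "a * ?E + b * ?F = p" "a * ?F + b * ?G = q"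
  proof -
    have "a * ?D = ?G * p - ?F * q" "b * ?D = ?E * q - ?F * p" using D by (simp_all add: a_def b_def)
    then have "(a * ?E + b * ?F) * ?D = p * ?D" "(a * ?F + b * ?G) * ?D = q * ?D"
      unfolding DE by algebra+
    then show "a * ?E + b * ?F = p" "a * ?F + b * ?G = q" using D by auto
  qed
  have XX: "X z \<bullet> X z = 1" "n z \<bullet> n z = 1" using norm_X[OF z] norm_n[OF z] by (simp_all add: dot_square_norm)
  let ?y = "y - ((y \<bullet> X z) *\<^sub>R X z + (y \<bullet> n z) *\<^sub>R n z + a *\<^sub>R dd X 1 z + b *\<^sub>R dd X \<i> z)"
  have "?y = 0"
  proof (rule frame_complete[OF z])
    show "?y \<bullet> X z = 0" "?y \<bullet> n z = 0"
      using XX n_X[OF z] X_dX[OF z] n_dX[OF z]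
      by (simp_all add: inner_diff_left inner_add_left inner_diff_right inner_add_right inner_commute)
    show "?y \<bullet> dd X 1 z = 0" "?y \<bullet> dd X \<i> z = 0"
      using ab X_dX[OF z] n_dX[OF z]
      by (simp_all add: inner_diff_left inner_add_left inner_diff_right inner_add_right inner_commute
          gram_def p_def q_def)
  qed
  then show ?thesis using that[of a b] by simp
qed

text \<open>\<open>THE\<close> is well defined because the derivative of n is tangent to the surface
  and that of X is injective. As matrices, the second form is the product of the shape operator with
  the Gram matrix, and determinants multiply.\<close>

lemma shape_det:
  assumes z: "z \<in> V"
  shows "plane_det (\<lambda>v. THE w. frechet_derivative X (at z) w = - frechet_derivative n (at z) v) = curv X n z"
proof -
  define L where "L = (\<lambda>v. THE w. frechet_derivative X (at z) w = - frechet_derivative n (at z) v)"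
  have L: "frechet_derivative X (at z) (L v) = - frechet_derivative n (at z) v" for v
    unfolding L_def
  proof (rule theI')
    obtain a b where "- dd n v z = a *\<^sub>R dd X 1 z + b *\<^sub>R dd X \<i> z"
      using frame_expansion[OF z, of "- dd n v z"] X_dn[OF z] n_dn[OF z] by auto
    then have "frechet_derivative X (at z) (Complex a b) = - dd n v z"
      using dd_expand[OF has_derivative_X[OF z], of "Complex a b"] by simp
    then show "\<exists>!w. frechet_derivative X (at z) w = - frechet_derivative n (at z) v"
      using inj_dX[OF z] by (metis injD)
  qed
  have s: "sform X n z v u = Re (L v) * gram X z 1 u + Im (L v) * gram X z \<i> u" for u v
  proof -
    have e: "- dd n v z = Re (L v) *\<^sub>R dd X 1 z + Im (L v) *\<^sub>R dd X \<i> z"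
      using L[of v] dd_expand[OF has_derivative_X[OF z], of "L v"] by simp
    show ?thesis by (simp only: sform_def gram_def e inner_add_left inner_scaleR_left)
  qed
  have "form_det (sform X n z) = plane_det L * form_det (gram X z)"
    unfolding form_det_def s plane_det_def det_2 by (simp add: vector_2) algebra
  then show ?thesis using gram_det_pos[OF z] by (simp add: curv_def L_def)
qed

end

section \<open>Codazzi and Weingarten equations in a conformal parameter\<close>

locale conformal_patch = patch +
  fixes \<rho> :: "complex \<Rightarrow> real"
  assumes \<rho>_pos: "\<And>z. z \<in> V \<Longrightarrow> \<rho> z > 0"
    and conformal: "\<And>z u v. z \<in> V \<Longrightarrow> sform X n z u v = \<rho> z * (u \<bullet> v)"
begin

lemma dn_dX: "z \<in> V \<Longrightarrow> dd n u z \<bullet> dd X v z = - \<rho> z * (u \<bullet> v)"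
  using conformal[of z u v] by (simp add: sform_def)

lemma smooth_\<rho>: "smooth_on V \<rho>"
proof -
  have "smooth_on V (\<lambda>z. - dd n 1 z \<bullet> dd X 1 z)" by (intro smooth_intros open_V smooth)
  then show ?thesis
    by (rule smooth_on_cong[OF open_V, rotated]) (use conformal[of _ 1 1] in \<open>simp add: sform_def\<close>)
qed

lemma dd_dn_dX:
  assumes z: "z \<in> V"
  shows "dd n u z \<bullet> dd (dd X v) a z + dd (dd n u) a z \<bullet> dd X v z = - (u \<bullet> v) * dd \<rho> a z"
proof -
  have "dd n u z \<bullet> dd (dd X v) a z + dd (dd n u) a z \<bullet> dd X v z = dd (\<lambda>z. dd n u z \<bullet> dd X v z) a z"
    by (rule dd_inner[OF smooth(4,3) z, symmetric])
  also have "\<dots> = dd (\<lambda>z. (- (u \<bullet> v)) *\<^sub>R \<rho> z) a z"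
    using frechet_derivative_cong_open[OF open_V z, of "\<lambda>z. dd n u z \<bullet> dd X v z" "\<lambda>z. (- (u \<bullet> v)) *\<^sub>R \<rho> z"]
    by (simp add: dn_dX)
  also have "\<dots> = - (u \<bullet> v) * dd \<rho> a z"
    using dd_bounded_linear[OF bounded_linear_scaleR_right smooth_\<rho> z] by (simp only: real_scaleR_def)
  finally show ?thesis .
qed

text \<open>Two instances of \<open>dd_dn_dX\<close> with u and v exchanged are subtracted, and the
  mixed second derivative of n cancels.\<close>

lemma codazzi:
  assumes z: "z \<in> V"
  shows "dd n u z \<bullet> dd (dd X c) v z - dd n v z \<bullet> dd (dd X c) u z = (v \<bullet> c) * dd \<rho> u z - (u \<bullet> c) * dd \<rho> v z"
  using dd_dn_dX[OF z, of u c v] dd_dn_dX[OF z, of v c u] dd_commute[OF open_V smooth_n z, of u v]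
  by (simp add: inner_commute)

text \<open>Codazzi trades the terms containing mixed derivatives of X for terms with the Laplacian,
  and the derivatives of \<rho> cancel.\<close>

lemma lap_n:
  assumes z: "z \<in> V" and b: "b \<in> {1, \<i>}"
  shows "lap n z \<bullet> dd X b z = - (dd n b z \<bullet> lap X z)"
  using b dd_dn_dX[OF z, of 1 b 1] dd_dn_dX[OF z, of \<i> b \<i>] codazzi[OF z, of 1 1 \<i>] codazzi[OF z, of 1 \<i> \<i>]
    dd_commute[OF open_V smooth_X z, of 1 \<i>]
  by (auto simp: lap_def inner_add_left inner_add_right)

definition gdet :: "complex \<Rightarrow> real" where
  "gdet z = form_det (gram X z)"

lemma curv_eq: "z \<in> V \<Longrightarrow> curv X n z = (\<rho> z)\<^sup>2 / gdet z"
  by (simp add: curv_def gdet_def form_det_def[of "sform _ _ _"] conformal power2_eq_square)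

lemma gdet_pos: "z \<in> V \<Longrightarrow> gdet z > 0"
  by (simp add: gdet_def gram_det_pos)

lemma gdet_expand: "gdet z = (dd X 1 z \<bullet> dd X 1 z) * (dd X \<i> z \<bullet> dd X \<i> z) - (dd X 1 z \<bullet> dd X \<i> z) * (dd X 1 z \<bullet> dd X \<i> z)"
  by (simp add: gdet_def form_det_def gram_def inner_commute)

lemma smooth_gdet: "smooth_on V gdet"
  unfolding gdet_expand[abs_def] by (intro smooth_intros open_V smooth)

lemma dd_gdet:
  assumes z: "z \<in> V"
  shows "dd gdet a z = 2 * ((dd X \<i> z \<bullet> dd X \<i> z) * (dd (dd X 1) a z \<bullet> dd X 1 z)
      + (dd X 1 z \<bullet> dd X 1 z) * (dd (dd X \<i>) a z \<bullet> dd X \<i> z)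
      - (dd X 1 z \<bullet> dd X \<i> z) * (dd (dd X 1) a z \<bullet> dd X \<i> z + dd (dd X \<i>) a z \<bullet> dd X 1 z))"
proof -
  have s: "smooth_on V (\<lambda>z. dd X u z \<bullet> dd X v z)" for u v by (intro smooth_intros open_V smooth)
  have m: "dd (\<lambda>z. f z * g z) a z = f z * dd g a z + dd f a z * g z"
    if "smooth_on V f" "smooth_on V g" for f g :: "complex \<Rightarrow> real"
    by (rule dd_bilinear[OF bounded_bilinear_mult that z])
  have mm: "smooth_on V (\<lambda>z. f z * g z)" if "smooth_on V f" "smooth_on V g" for f g :: "complex \<Rightarrow> real"
    by (rule smooth_on_mult[OF open_V that])
  have "dd gdet a z = dd (\<lambda>z. (dd X 1 z \<bullet> dd X 1 z) * (dd X \<i> z \<bullet> dd X \<i> z)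
      + (- 1) * ((dd X 1 z \<bullet> dd X \<i> z) * (dd X 1 z \<bullet> dd X \<i> z))) a z"
    unfolding gdet_expand[abs_def] by simp
  also have "\<dots> = dd (\<lambda>z. (dd X 1 z \<bullet> dd X 1 z) * (dd X \<i> z \<bullet> dd X \<i> z)) a z
      + dd (\<lambda>z. (- 1) * ((dd X 1 z \<bullet> dd X \<i> z) * (dd X 1 z \<bullet> dd X \<i> z))) a z"
    by (rule dd_add[OF mm[OF s s] mm[OF smooth_on_const mm[OF s s]] z])
  also have "dd (\<lambda>z. (- 1) * ((dd X 1 z \<bullet> dd X \<i> z) * (dd X 1 z \<bullet> dd X \<i> z))) a z
      = (- 1) * dd (\<lambda>z. (dd X 1 z \<bullet> dd X \<i> z) * (dd X 1 z \<bullet> dd X \<i> z)) a z"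
    using m[OF smooth_on_const mm[OF s s], of "- 1"] by simp
  finally show ?thesis
    unfolding m[OF s s] dd_inner[OF smooth(3,3) z] by (simp add: inner_commute algebra_simps)
qed

text \<open>The Weingarten equations for a second form \<rho> times the identity, with the adjugate
  of the Gram matrix instead of its inverse.\<close>

lemma dn_expand:
  assumes z: "z \<in> V"
  shows "gdet z *\<^sub>R dd n 1 z = (- \<rho> z) *\<^sub>R ((dd X \<i> z \<bullet> dd X \<i> z) *\<^sub>R dd X 1 z - (dd X 1 z \<bullet> dd X \<i> z) *\<^sub>R dd X \<i> z)"
    and "gdet z *\<^sub>R dd n \<i> z = (- \<rho> z) *\<^sub>R ((dd X 1 z \<bullet> dd X 1 z) *\<^sub>R dd X \<i> z - (dd X 1 z \<bullet> dd X \<i> z) *\<^sub>R dd X 1 z)"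
proof -
  let ?y = "gdet z *\<^sub>R dd n 1 z + \<rho> z *\<^sub>R ((dd X \<i> z \<bullet> dd X \<i> z) *\<^sub>R dd X 1 z - (dd X 1 z \<bullet> dd X \<i> z) *\<^sub>R dd X \<i> z)"
  have "?y = 0"
    by (rule frame_complete[OF z])
      (use X_dn[OF z] n_dn[OF z] X_dX[OF z] n_dX[OF z] dn_dX[OF z] in
        \<open>simp_all add: inner_add_left inner_diff_left inner_add_right inner_diff_right
          inner_commute gdet_expand algebra_simps\<close>)
  then show "gdet z *\<^sub>R dd n 1 z = (- \<rho> z) *\<^sub>R ((dd X \<i> z \<bullet> dd X \<i> z) *\<^sub>R dd X 1 z - (dd X 1 z \<bullet> dd X \<i> z) *\<^sub>R dd X \<i> z)"
    by (simp only: scaleR_minus_left eq_neg_iff_add_eq_0)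
  let ?y = "gdet z *\<^sub>R dd n \<i> z + \<rho> z *\<^sub>R ((dd X 1 z \<bullet> dd X 1 z) *\<^sub>R dd X \<i> z - (dd X 1 z \<bullet> dd X \<i> z) *\<^sub>R dd X 1 z)"
  have "?y = 0"
    by (rule frame_complete[OF z])
      (use X_dn[OF z] n_dn[OF z] X_dX[OF z] n_dX[OF z] dn_dX[OF z] in
        \<open>simp_all add: inner_add_left inner_diff_left inner_add_right inner_diff_right
          inner_commute gdet_expand algebra_simps\<close>)
  then show "gdet z *\<^sub>R dd n \<i> z = (- \<rho> z) *\<^sub>R ((dd X 1 z \<bullet> dd X 1 z) *\<^sub>R dd X \<i> z - (dd X 1 z \<bullet> dd X \<i> z) *\<^sub>R dd X 1 z)"
    by (simp only: scaleR_minus_left eq_neg_iff_add_eq_0)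
qed

text \<open>Codazzi rewrites the Laplacian so that every second derivative of X has b as one of its
  directions, ready for comparison with the b-derivative of the Gram determinant.\<close>

lemma lap_X_trace:
  assumes z: "z \<in> V" and b: "b \<in> {1, \<i>}"
  shows "dd n b z \<bullet> lap X z = dd n 1 z \<bullet> dd (dd X 1) b z + dd n \<i> z \<bullet> dd (dd X \<i>) b z + dd \<rho> b z"
  using b codazzi[OF z, of 1 \<i> \<i>] codazzi[OF z, of \<i> 1 1]
  by (auto simp: lap_def inner_add_left inner_add_right)

text \<open>By \<open>dn_expand\<close> the trace is a contraction of the inverse Gram matrix with
  the b-derivative of the Gram matrix. By Jacobi's formula it is the logarithmic derivative of
  \<open>gdet\<close>, times -\<rho>/2.\<close>

lemma lap_X_gdet:
  assumes z: "z \<in> V" and b: "b \<in> {1, \<i>}"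
  shows "2 * gdet z * (dd n b z \<bullet> lap X z) = 2 * gdet z * dd \<rho> b z - \<rho> z * dd gdet b z"
proof -
  have "2 * gdet z * (dd n b z \<bullet> lap X z) = 2 * ((gdet z *\<^sub>R dd n 1 z) \<bullet> dd (dd X 1) b z
      + (gdet z *\<^sub>R dd n \<i> z) \<bullet> dd (dd X \<i>) b z) + 2 * gdet z * dd \<rho> b z"
    unfolding lap_X_trace[OF assms] by (simp add: algebra_simps)
  also have "\<dots> = 2 * gdet z * dd \<rho> b z - \<rho> z * dd gdet b z"
    unfolding dn_expand[OF z] dd_gdet[OF z]
    by (simp add: inner_diff_left inner_diff_right inner_commute algebra_simps)
  finally show ?thesis .
qed

text \<open>Since the curvature is \<rho>^2 / gdet, its b-derivative is \<rho> / gdet^2 times the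
  expression computed in \<open>lap_X_gdet\<close>.\<close>

lemma curv_critical:
  assumes z: "z \<in> V" and b: "b \<in> {1, \<i>}"
  shows "dd (curv X n) b z = 0 \<longleftrightarrow> dd n b z \<bullet> lap X z = 0"
proof -
  have 1: "((\<lambda>z. (\<rho> z)\<^sup>2 / gdet z) has_derivative (\<lambda>v. (2 * \<rho> z * dd \<rho> v z * gdet z - (\<rho> z)\<^sup>2 * dd gdet v z) / (gdet z)\<^sup>2)) (at z)"
    using gdet_pos[OF z]
    by (auto intro!: derivative_eq_intros smooth_on_has_derivative[OF smooth_\<rho> z]
        smooth_on_has_derivative[OF smooth_gdet z] simp: field_simps power2_eq_square)
  have "dd (curv X n) b z = dd (\<lambda>z. (\<rho> z)\<^sup>2 / gdet z) b z"
    using frechet_derivative_cong_open[OF open_V z, of "curv X n" "\<lambda>z. (\<rho> z)\<^sup>2 / gdet z"] curv_eq by simp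
  also have "\<dots> = (2 * \<rho> z * dd \<rho> b z * gdet z - (\<rho> z)\<^sup>2 * dd gdet b z) / (gdet z)\<^sup>2"
    by (rule dd_eqI[OF 1])
  also have "\<dots> = \<rho> z * (2 * gdet z * (dd n b z \<bullet> lap X z)) / (gdet z)\<^sup>2"
    unfolding lap_X_gdet[OF assms] by (simp add: power2_eq_square algebra_simps)
  finally show ?thesis using gdet_pos[OF z] \<rho>_pos[OF z] by simp
qed

end

section \<open>The Gauss map\<close>

locale imaginary_frame =
  fixes e1 e2 e3 :: quat
  assumes frame_norm: "norm e1 = 1" "norm e2 = 1" "norm e3 = 1"
    and frame_orth: "e1 \<bullet> e2 = 0" "e2 \<bullet> e3 = 0" "e3 \<bullet> e1 = 0"
    and frame_imaginary: "e1 \<bullet> qone = 0" "e2 \<bullet> qone = 0" "e3 \<bullet> qone = 0"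
begin

lemma inner_translate:
  assumes "norm X = 1"
  shows "qmult X p \<bullet> qmult X q = p \<bullet> q" "X \<bullet> qmult X p = qone \<bullet> p"
proof -
  have X: "X \<bullet> X = 1" using assms by (simp add: dot_square_norm)
  then show "qmult X p \<bullet> qmult X q = p \<bullet> q"
    by (simp add: inner_qmult_left qmult_assoc[symmetric] qmult_qcnj)
  show "X \<bullet> qmult X p = qone \<bullet> p" by (simp add: inner_qmult_self X)
qed

lemma translated_frame_expansion:
  assumes "norm X = 1"
  shows "y = (y \<bullet> X) *\<^sub>R X + (y \<bullet> qmult X e1) *\<^sub>R qmult X e1 + (y \<bullet> qmult X e2) *\<^sub>R qmult X e2
    + (y \<bullet> qmult X e3) *\<^sub>R qmult X e3" (is "y = ?r")
proof -
  have X: "X \<bullet> X = 1" using assms by (simp add: dot_square_norm)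
  have e: "e1 \<bullet> e1 = 1" "e2 \<bullet> e2 = 1" "e3 \<bullet> e3 = 1" using frame_norm by (simp_all add: dot_square_norm)
  have i: "qmult X p \<bullet> X = qone \<bullet> p" for p using inner_translate(2)[OF assms] by (simp add: inner_commute)
  have o: "qmult X e1 \<bullet> qmult X e2 = 0" "qmult X e1 \<bullet> qmult X e3 = 0" "qmult X e2 \<bullet> qmult X e3 = 0"
    "qmult X e2 \<bullet> qmult X e1 = 0" "qmult X e3 \<bullet> qmult X e1 = 0" "qmult X e3 \<bullet> qmult X e2 = 0"
    "X \<bullet> qmult X e1 = 0" "X \<bullet> qmult X e2 = 0" "X \<bullet> qmult X e3 = 0"
    "qmult X e1 \<bullet> X = 0" "qmult X e2 \<bullet> X = 0" "qmult X e3 \<bullet> X = 0"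
    "qmult X e1 \<bullet> qmult X e1 = 1" "qmult X e2 \<bullet> qmult X e2 = 1" "qmult X e3 \<bullet> qmult X e3 = 1"
    using frame_orth frame_imaginary by (simp_all add: inner_translate[OF assms] i e inner_commute)
  have "y - ?r = 0"
  proof (rule orthogonal_to_frame[of X "qmult X e1" "qmult X e2" "qmult X e3"])
    show "X \<noteq> 0" "qmult X e1 \<noteq> 0" "qmult X e2 \<noteq> 0" "qmult X e3 \<noteq> 0"
      using X o(13-15) by auto
  qed (simp_all add: o X inner_diff_left inner_add_left)
  then show ?thesis by simp
qed

text \<open>For y orthogonal to X, the translated frame reproduces y, so a sum over e1, e2, e3
  becomes one product free of them. Taking for X' a derivative of the immersion covers the terms in
  which the translation is differentiated.\<close>

lemma sum_translated_frame:
  assumes "norm X = 1" "y \<bullet> X = 0"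
  shows "(y \<bullet> qmult X e1) * (v \<bullet> qmult X' e1) + (y \<bullet> qmult X e2) * (v \<bullet> qmult X' e2)
    + (y \<bullet> qmult X e3) * (v \<bullet> qmult X' e3) = triple X v X' y"
proof -
  have "y = qmult X ((y \<bullet> qmult X e1) *\<^sub>R e1 + (y \<bullet> qmult X e2) *\<^sub>R e2 + (y \<bullet> qmult X e3) *\<^sub>R e3)"
    (is "y = qmult X ?t")
    using translated_frame_expansion[OF assms(1), of y] assms(2) by (simp add: qmult_add_right qmult_scaleR_right)
  then have "qmult (qcnj X) y = qmult (qmult (qcnj X) X) ?t" using qmult_assoc by metis
  also have "\<dots> = ?t" using assms(1) by (simp add: qmult_qcnj dot_square_norm)
  finally show ?thesis
    by (simp add: triple_def qmult_add_right qmult_scaleR_right inner_add_right)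
qed

end

locale gauss_patch = conformal_patch + imaginary_frame
begin

definition gauss_comp :: "quat \<Rightarrow> complex \<Rightarrow> real" where
  "gauss_comp e z = n z \<bullet> qmult (X z) e"

lemma smooth_mult_const: "smooth_on V Y \<Longrightarrow> smooth_on V (\<lambda>z. qmult (Y z) e)"
  by (rule smooth_on_bounded_linear[OF open_V bounded_bilinear.bounded_linear_left[OF bounded_bilinear_qmult]])

lemma smooth_comp: "smooth_on V (gauss_comp e)"
  unfolding gauss_comp_def[abs_def] by (intro smooth_on_inner[OF open_V] smooth_mult_const smooth)

lemma dd_inner_mult:
  assumes "smooth_on V f" "smooth_on V Y" "z \<in> V"
  shows "dd (\<lambda>z. f z \<bullet> qmult (Y z) e) v z = f z \<bullet> qmult (dd Y v z) e + dd f v z \<bullet> qmult (Y z) e"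
  using dd_inner[OF assms(1) smooth_mult_const[OF assms(2)] assms(3)]
    dd_bounded_linear[OF bounded_bilinear.bounded_linear_left[OF bounded_bilinear_qmult] assms(2,3)]
  by simp

lemma dd_comp: "z \<in> V \<Longrightarrow> dd (gauss_comp e) v z = n z \<bullet> qmult (dd X v z) e + dd n v z \<bullet> qmult (X z) e"
  unfolding gauss_comp_def[abs_def] by (rule dd_inner_mult[OF smooth(2,1)])

lemma dd2_comp:
  assumes z: "z \<in> V"
  shows "dd (dd (gauss_comp e) v) v z = n z \<bullet> qmult (dd (dd X v) v z) e + 2 * (dd n v z \<bullet> qmult (dd X v z) e)
    + dd (dd n v) v z \<bullet> qmult (X z) e"
proof -
  have "dd (dd (gauss_comp e) v) v z = dd (\<lambda>z. n z \<bullet> qmult (dd X v z) e + dd n v z \<bullet> qmult (X z) e) v z"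
    using frechet_derivative_cong_open[OF open_V z, of "dd (gauss_comp e) v"
        "\<lambda>z. n z \<bullet> qmult (dd X v z) e + dd n v z \<bullet> qmult (X z) e"] dd_comp by simp
  also have "\<dots> = dd (\<lambda>z. n z \<bullet> qmult (dd X v z) e) v z + dd (\<lambda>z. dd n v z \<bullet> qmult (X z) e) v z"
    by (rule dd_add[OF _ _ z]; intro smooth_on_inner[OF open_V] smooth_mult_const smooth)
  finally show ?thesis
    unfolding dd_inner_mult[OF smooth(2,3) z] dd_inner_mult[OF smooth(4,1) z] by simp
qed

lemma lap_comp:
  assumes z: "z \<in> V"
  shows "lap (gauss_comp e) z = n z \<bullet> qmult (lap X z) e + 2 * (dd n 1 z \<bullet> qmult (dd X 1 z) e)
    + 2 * (dd n \<i> z \<bullet> qmult (dd X \<i> z) e) + lap n z \<bullet> qmult (X z) e"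
  by (simp add: lap_def[of "gauss_comp e"] dd2_comp[OF z])
    (simp add: lap_def inner_add_left inner_add_right qmult_add_left)

text \<open>The Laplacian of the Gauss map, as a map into the unit sphere of R^3, paired with the
  left translate of \<open>dd X b\<close>. For b = 1 and b = i these translates span the tangent
  plane of that sphere.\<close>

definition tension :: "complex \<Rightarrow> complex \<Rightarrow> real" where
  "tension b z = (dd X b z \<bullet> qmult (X z) e1) * lap (gauss_comp e1) z + (dd X b z \<bullet> qmult (X z) e2) * lap (gauss_comp e2) z
    + (dd X b z \<bullet> qmult (X z) e3) * lap (gauss_comp e3) z"

text \<open>Among three vectors drawn from two, two coincide, and \<open>triple\<close> is
  alternating on vectors orthogonal to X.\<close>

lemma triple_tangent:
  assumes z: "z \<in> V" and ab: "a \<in> {1, \<i>}" "b \<in> {1, \<i>}" "c \<in> {1, \<i>}"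
  shows "triple (X z) (dd X c z) (dd X a z) (dd X b z) = 0"
proof -
  have o: "dd X v z \<bullet> X z = 0" "X z \<bullet> dd X v z = 0" for v using X_dX[OF z] by (simp_all add: inner_commute)
  have "c = a \<or> c = b \<or> a = b" using ab by auto
  then show ?thesis
    using triple_swap_23[of "dd X c z" "X z" "dd X a z" "dd X a z"]
    by (auto simp: triple_eq_12 triple_eq_13 o)
qed

lemma triple_dn_tangent:
  assumes z: "z \<in> V" and ab: "a \<in> {1, \<i>}" "b \<in> {1, \<i>}" "c \<in> {1, \<i>}"
  shows "triple (X z) (dd n c z) (dd X a z) (dd X b z) = 0"
proof -
  obtain p q where pq: "dd n c z = p *\<^sub>R dd X 1 z + q *\<^sub>R dd X \<i> z"
    using frame_expansion[OF z, of "dd n c z"] X_dn[OF z] n_dn[OF z] by auto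
  show ?thesis unfolding pq triple_linear using triple_tangent[OF z ab(1,2)] by simp
qed

text \<open>The mixed terms of the product rule are volumes of three vectors tangent to the surface
  and vanish by \<open>triple_dn_tangent\<close>. In the term with the Laplacian of n the
  translation cancels.\<close>

lemma tension_eq:
  assumes z: "z \<in> V" and b: "b \<in> {1, \<i>}"
  shows "tension b z = lap n z \<bullet> dd X b z + triple (X z) (n z) (lap X z) (dd X b z)"
proof -
  note sf = sum_translated_frame[OF norm_X[OF z] X_dX[OF z]]
  have "tension b z = triple (X z) (n z) (lap X z) (dd X b z) + 2 * triple (X z) (dd n 1 z) (dd X 1 z) (dd X b z)
    + 2 * triple (X z) (dd n \<i> z) (dd X \<i> z) (dd X b z) + triple (X z) (lap n z) (X z) (dd X b z)"
    unfolding tension_def lap_comp[OF z] sf[symmetric] by (simp add: algebra_simps)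
  also have "triple (X z) (lap n z) (X z) (dd X b z) = lap n z \<bullet> dd X b z"
    by (simp add: triple_def qmult_qcnj_cancel[OF norm_X[OF z]])
  finally show ?thesis using triple_dn_tangent[OF z _ b] by simp
qed

text \<open>With \<open>w\<close> the coordinates of the tangential part of the Laplacian of \<open>X\<close>, the tangential
  part of the Laplacian of the Gauss map is \<open>w\<close> scaled by \<open>\<rho>\<close> plus \<open>w\<close> rotated.\<close>

lemma tension_zero_iff:
  assumes z: "z \<in> V"
  shows "tension 1 z = 0 \<and> tension \<i> z = 0 \<longleftrightarrow> dd n 1 z \<bullet> lap X z = 0 \<and> dd n \<i> z \<bullet> lap X z = 0"
proof -
  obtain p q where L: "lap X z = (lap X z \<bullet> X z) *\<^sub>R X z + (lap X z \<bullet> n z) *\<^sub>R n z + p *\<^sub>R dd X 1 z + q *\<^sub>R dd X \<i> z"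
    using frame_expansion[OF z] by metis
  have o: "dd X v z \<bullet> X z = 0" "X z \<bullet> dd X v z = 0" "n z \<bullet> dd X v z = 0" "dd X v z \<bullet> n z = 0"
    "n z \<bullet> X z = 0" "X z \<bullet> n z = 0" for v
    using X_dX[OF z] n_dX[OF z] n_X[OF z] by (simp_all add: inner_commute)
  \<comment> \<open>The signed area spanned by \<open>dd X 1\<close> and \<open>dd X \<i>\<close>;
    it is the coefficient of the rotated part.\<close>
  define J where "J = triple (X z) (n z) (dd X 1 z) (dd X \<i> z)"
  have J: "triple (X z) (n z) (dd X \<i> z) (dd X 1 z) = - J"
    unfolding J_def by (rule triple_swap_23) (simp_all add: o)
  have same: "triple (X z) (n z) (dd X v z) (dd X v z) = 0" for v
    using triple_swap_23[of "n z" "X z" "dd X v z" "dd X v z"] by (simp add: o)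
  have XX: "triple (X z) (n z) (X z) (dd X v z) = 0" for v
    by (simp add: triple_def qmult_qcnj_cancel[OF norm_X[OF z]] o)
  have nn: "triple (X z) (n z) (n z) (dd X v z) = 0" for v by (simp add: triple_eq_12 o)
  have t1: "triple (X z) (n z) (lap X z) (dd X 1 z) = - (q * J)"
    by (subst L) (simp add: triple_linear XX nn same J)
  have ti: "triple (X z) (n z) (lap X z) (dd X \<i> z) = p * J"
    by (subst L) (simp add: triple_linear XX nn same J_def)
  have n: "dd n v z \<bullet> X z = 0" "dd n v z \<bullet> n z = 0" for v using X_dn[OF z] n_dn[OF z] by auto
  have d1: "dd n 1 z \<bullet> lap X z = - \<rho> z * p"
    by (subst L) (simp add: inner_add_right n dn_dX[OF z])
  have di: "dd n \<i> z \<bullet> lap X z = - \<rho> z * q"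
    by (subst L) (simp add: inner_add_right n dn_dX[OF z])
  have T: "tension 1 z = \<rho> z * p - J * q" "tension \<i> z = \<rho> z * q + J * p"
    using tension_eq[OF z] lap_n[OF z] by (simp_all add: t1 ti d1 di)
  have r: "\<rho> z > 0" by (rule \<rho>_pos[OF z])
  \<comment> \<open>The linear system \<open>T\<close> in p and q has determinant \<rho>^2 + J^2,
    which is positive.\<close>
  have "p = 0 \<and> q = 0" if "tension 1 z = 0" "tension \<i> z = 0"
  proof -
    have "((\<rho> z)\<^sup>2 + J\<^sup>2) * p = 0" "((\<rho> z)\<^sup>2 + J\<^sup>2) * q = 0"
      using that unfolding T by algebra+
    moreover have "(\<rho> z)\<^sup>2 + J\<^sup>2 > 0" using r by (simp add: add_pos_nonneg)
    ultimately show ?thesis by auto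
  qed
  then show ?thesis using r by (auto simp: d1 di T)
qed

text \<open>Absence of tension says that the Laplacian is orthogonal to the tangent plane of the
  unit sphere at the Gauss map; the orthogonal complement of that plane in R^3 is the line of the
  Gauss map.\<close>

lemma parallel_iff_tension:
  assumes z: "z \<in> V"
  shows "(\<exists>l. lap (gauss_comp e1) z = l * gauss_comp e1 z \<and> lap (gauss_comp e2) z = l * gauss_comp e2 z \<and> lap (gauss_comp e3) z = l * gauss_comp e3 z)
    \<longleftrightarrow> tension 1 z = 0 \<and> tension \<i> z = 0"
proof
  assume "\<exists>l. lap (gauss_comp e1) z = l * gauss_comp e1 z \<and> lap (gauss_comp e2) z = l * gauss_comp e2 z \<and> lap (gauss_comp e3) z = l * gauss_comp e3 z"
  then obtain l where l: "lap (gauss_comp e1) z = l * gauss_comp e1 z" "lap (gauss_comp e2) z = l * gauss_comp e2 z" "lap (gauss_comp e3) z = l * gauss_comp e3 z"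
    by blast
  have "tension b z = 0" for b
  proof -
    have "tension b z = l * triple (X z) (n z) (X z) (dd X b z)"
      unfolding tension_def l gauss_comp_def sum_translated_frame[OF norm_X[OF z] X_dX[OF z], symmetric]
      by (simp add: algebra_simps)
    then show ?thesis by (simp add: triple_def qmult_qcnj_cancel[OF norm_X[OF z]] n_dX[OF z])
  qed
  then show "tension 1 z = 0 \<and> tension \<i> z = 0" by blast
next
  assume t: "tension 1 z = 0 \<and> tension \<i> z = 0"
  \<comment> \<open>The Laplacian of the Gauss map translated back to X, where
    \<open>frame_complete\<close> applies.\<close>
  define R where "R = qmult (X z) (lap (gauss_comp e1) z *\<^sub>R e1 + lap (gauss_comp e2) z *\<^sub>R e2 + lap (gauss_comp e3) z *\<^sub>R e3)"
  have Re: "R \<bullet> qmult (X z) e1 = lap (gauss_comp e1) z" "R \<bullet> qmult (X z) e2 = lap (gauss_comp e2) z"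
    "R \<bullet> qmult (X z) e3 = lap (gauss_comp e3) z"
    unfolding R_def inner_translate(1)[OF norm_X[OF z]] using frame_norm frame_orth
    by (simp_all add: inner_add_left inner_add_right dot_square_norm inner_commute)
  have RX: "R \<bullet> X z = 0"
    using inner_translate(2)[OF norm_X[OF z]] frame_imaginary unfolding R_def
    by (simp add: inner_commute inner_add_right inner_add_left)
  have Rb: "R \<bullet> dd X b z = tension b z" for b
    unfolding R_def tension_def qmult_add_right qmult_scaleR_right
    by (simp add: inner_add_left inner_commute algebra_simps)
  have nn: "n z \<bullet> n z = 1" using norm_n[OF z] by (simp add: dot_square_norm)
  have "R - (R \<bullet> n z) *\<^sub>R n z = 0"
    by (rule frame_complete[OF z])
      (use RX Rb t n_X[OF z] n_dX[OF z] nn in \<open>simp_all add: inner_diff_left\<close>)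
  then have R: "R = (R \<bullet> n z) *\<^sub>R n z" by simp
  have "R \<bullet> qmult (X z) e = (R \<bullet> n z) * gauss_comp e z" for e
    by (subst R) (simp add: gauss_comp_def nn)
  then show "\<exists>l. lap (gauss_comp e1) z = l * gauss_comp e1 z \<and> lap (gauss_comp e2) z = l * gauss_comp e2 z \<and> lap (gauss_comp e3) z = l * gauss_comp e3 z"
    using Re by (intro exI[of _ "R \<bullet> n z"]) simp
qed

lemma comp_sphere:
  assumes z: "z \<in> V"
  shows "(gauss_comp e1 z)\<^sup>2 + (gauss_comp e2 z)\<^sup>2 + (gauss_comp e3 z)\<^sup>2 = 1"
proof -
  have "triple (X z) (n z) (X z) (n z) = 1"
    using norm_n[OF z] by (simp add: triple_def qmult_qcnj_cancel[OF norm_X[OF z]] dot_square_norm)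
  then show ?thesis
    unfolding sum_translated_frame[OF norm_X[OF z] n_X[OF z], symmetric] gauss_comp_def by (simp add: power2_eq_square)
qed

theorem parallel_iff_critical:
  assumes z: "z \<in> V"
  shows "(\<exists>l. lap (gauss_comp e1) z = l * gauss_comp e1 z \<and> lap (gauss_comp e2) z = l * gauss_comp e2 z \<and> lap (gauss_comp e3) z = l * gauss_comp e3 z)
    \<longleftrightarrow> dd (curv X n) 1 z = 0 \<and> dd (curv X n) \<i> z = 0"
  unfolding parallel_iff_tension[OF z] tension_zero_iff[OF z] using curv_critical[OF z] by simp

end

section \<open>Stereographic projection\<close>

text \<open>Both terms are a quarter of their real counterparts: the mixed derivative of the
  Laplacian, and the product of the two derivatives of f_x^2 + f_y^2, with complex squares rather
  than moduli.\<close>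

lemma harmonic_equation_real:
  assumes "open D" "smooth_on D f" "z \<in> D"
  shows "harmonic_equation f z \<longleftrightarrow>
    lap f z - 2 * cnj (f z) / (1 + of_real ((cmod (f z))\<^sup>2)) * ((dd f 1 z)\<^sup>2 + (dd f \<i> z)\<^sup>2) = 0"
proof -
  have d: "(dd f u has_derivative frechet_derivative (dd f u) (at z)) (at z)" for u
    by (rule smooth_on_has_derivative[OF smooth_on_dd[OF assms(2)] assms(3)])
  have "(deriv_z f has_derivative (\<lambda>v. (dd (dd f 1) v z - \<i> * dd (dd f \<i>) v z) / 2)) (at z)"
    unfolding deriv_z_def[abs_def] by (auto intro!: derivative_eq_intros d)
  note dz = dd_eqI[OF this]
  have "deriv_zbar (deriv_z f) z = lap f z / 4"
    unfolding deriv_zbar_def dz lap_def using dd_commute[OF assms, of 1 \<i>] by (simp add: field_simps)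
  moreover have "deriv_z f z * deriv_zbar f z = ((dd f 1 z)\<^sup>2 + (dd f \<i> z)\<^sup>2) / 4"
    unfolding deriv_z_def deriv_zbar_def by (simp add: field_simps power2_eq_square)
  ultimately have "deriv_zbar (deriv_z f) z - 2 * cnj (f z) / (1 + of_real ((cmod (f z))\<^sup>2)) * deriv_z f z * deriv_zbar f z
     = (lap f z - 2 * cnj (f z) / (1 + of_real ((cmod (f z))\<^sup>2)) * ((dd f 1 z)\<^sup>2 + (dd f \<i> z)\<^sup>2)) / 4"
    by (simp only: mult.assoc diff_divide_distrib times_divide_eq_right)
  then show ?thesis unfolding harmonic_equation_def by (simp only: divide_eq_0_iff) simp
qed

lemma sphere_derivatives:
  fixes N1 N2 N3 :: "complex \<Rightarrow> real"
  assumes D: "open D" and sm: "smooth_on D N1" "smooth_on D N2" "smooth_on D N3"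
    and sph: "\<And>z. z \<in> D \<Longrightarrow> (N1 z)\<^sup>2 + (N2 z)\<^sup>2 + (N3 z)\<^sup>2 = 1" and z: "z \<in> D"
  shows "N1 z * dd N1 v z + N2 z * dd N2 v z + N3 z * dd N3 v z = 0"
    and "N1 z * dd (dd N1 v) v z + N2 z * dd (dd N2 v) v z + N3 z * dd (dd N3 v) v z
      + ((dd N1 v z)\<^sup>2 + (dd N2 v z)\<^sup>2 + (dd N3 v z)\<^sup>2) = 0"
proof -
  note h = smooth_on_has_derivative
  have lc: "dd f v z = 0" if "\<And>z. z \<in> D \<Longrightarrow> f z = c" "z \<in> D" for f :: "complex \<Rightarrow> real" and c z
    using frechet_derivative_cong_open[OF D that(2), of f "\<lambda>_. c"] that(1) by simp
  have 1: "N1 z * dd N1 v z + N2 z * dd N2 v z + N3 z * dd N3 v z = 0" if z: "z \<in> D" for z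
  proof -
    have "((\<lambda>z. (N1 z)\<^sup>2 + (N2 z)\<^sup>2 + (N3 z)\<^sup>2) has_derivative
        (\<lambda>v. 2 * (N1 z * dd N1 v z + N2 z * dd N2 v z + N3 z * dd N3 v z))) (at z)"
      by (auto intro!: derivative_eq_intros h[OF sm(1) z] h[OF sm(2) z] h[OF sm(3) z] simp: algebra_simps)
    from dd_eqI[OF this, of v] lc[OF sph z] show ?thesis by simp
  qed
  show "N1 z * dd N1 v z + N2 z * dd N2 v z + N3 z * dd N3 v z = 0" by (rule 1[OF z])
  have "((\<lambda>z. N1 z * dd N1 v z + N2 z * dd N2 v z + N3 z * dd N3 v z) has_derivative
      (\<lambda>u. N1 z * dd (dd N1 v) u z + dd N1 u z * dd N1 v z + (N2 z * dd (dd N2 v) u z + dd N2 u z * dd N2 v z)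
        + (N3 z * dd (dd N3 v) u z + dd N3 u z * dd N3 v z))) (at z)"
    by (intro has_derivative_add has_derivative_mult h[OF sm(1) z] h[OF sm(2) z] h[OF sm(3) z] h[OF smooth_on_dd z] sm)
  from dd_eqI[OF this, of v] lc[OF 1 z]
  show "N1 z * dd (dd N1 v) v z + N2 z * dd (dd N2 v) v z + N3 z * dd (dd N3 v) v z
      + ((dd N1 v z)\<^sup>2 + (dd N2 v z)\<^sup>2 + (dd N3 v z)\<^sup>2) = 0"
    by (simp add: power2_eq_square)
qed

definition stereo :: "(complex \<Rightarrow> real) \<Rightarrow> (complex \<Rightarrow> real) \<Rightarrow> (complex \<Rightarrow> real) \<Rightarrow> complex \<Rightarrow> complex" where
  "stereo N1 N2 N3 z = (of_real (N1 z) + \<i> * of_real (N2 z)) / (1 - of_real (N3 z))"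

lemma smooth_on_stereo:
  assumes "open D" "smooth_on D N1" "smooth_on D N2" "smooth_on D N3" "\<And>z. z \<in> D \<Longrightarrow> N3 z \<noteq> 1"
  shows "smooth_on D (stereo N1 N2 N3)"
  unfolding stereo_def[abs_def]
  by (intro smooth_intros assms) (use assms(5) in \<open>auto simp: complex_eq_iff\<close>)

text \<open>A map into the sphere is harmonic if its Laplacian is normal to the sphere. The
  computation differentiates the product nu = f (1 - T) rather than the quotient that defines
  f.\<close>

lemma stereo_harmonic_iff:
  fixes N1 N2 N3 :: "complex \<Rightarrow> real"
  assumes D: "open D" and sm: "smooth_on D N1" "smooth_on D N2" "smooth_on D N3"
    and sph: "\<And>z. z \<in> D \<Longrightarrow> (N1 z)\<^sup>2 + (N2 z)\<^sup>2 + (N3 z)\<^sup>2 = 1" and ne: "\<And>z. z \<in> D \<Longrightarrow> N3 z \<noteq> 1"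
    and z: "z \<in> D"
  shows "harmonic_equation (stereo N1 N2 N3) z \<longleftrightarrow>
    (\<exists>l. lap N1 z = l * N1 z \<and> lap N2 z = l * N2 z \<and> lap N3 z = l * N3 z)"
proof -
  let ?f = "stereo N1 N2 N3"
  define nu where "nu = (\<lambda>z. complex_of_real (N1 z) + \<i> * of_real (N2 z))"
  define T where "T = (\<lambda>z. complex_of_real (N3 z))"
  have sf: "smooth_on D ?f" by (rule smooth_on_stereo[OF D sm ne])
  have sT: "smooth_on D T" unfolding T_def by (intro smooth_intros D sm)
  note h = smooth_on_has_derivative
  have ddT: "dd T v z = of_real (dd N3 v z)" if "z \<in> D" for v z
    unfolding T_def by (rule dd_bounded_linear[OF bounded_linear_of_real sm(3) that])
  have ddT2: "dd (dd T v) u z = of_real (dd (dd N3 v) u z)" for v u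
  proof -
    have "dd (dd T v) u z = dd (\<lambda>z. of_real (dd N3 v z)) u z"
      using frechet_derivative_cong_open[OF D z, of "dd T v" "\<lambda>z. of_real (dd N3 v z)"] ddT by simp
    then show ?thesis using dd_bounded_linear[OF bounded_linear_of_real smooth_on_dd[OF sm(3)] z] by simp
  qed
  have hnu: "((\<lambda>z. complex_of_real (A z) + \<i> * of_real (B z)) has_derivative
      (\<lambda>v. of_real (dd A v z) + \<i> * of_real (dd B v z))) (at z)"
    if "smooth_on D A" "smooth_on D B" "z \<in> D" for A B :: "complex \<Rightarrow> real" and z
    by (intro has_derivative_add has_derivative_mult_right has_derivative_of_real h[OF that(1,3)] h[OF that(2,3)])
  have ddnu: "dd nu v z = of_real (dd N1 v z) + \<i> * of_real (dd N2 v z)" if "z \<in> D" for v z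
    unfolding nu_def by (rule dd_eqI[OF hnu[OF sm(1,2) that]])
  have ddnu2: "dd (dd nu v) u z = of_real (dd (dd N1 v) u z) + \<i> * of_real (dd (dd N2 v) u z)" for v u
  proof -
    have "dd (dd nu v) u z = dd (\<lambda>z. of_real (dd N1 v z) + \<i> * of_real (dd N2 v z)) u z"
      using frechet_derivative_cong_open[OF D z, of "dd nu v" "\<lambda>z. of_real (dd N1 v z) + \<i> * of_real (dd N2 v z)"]
        ddnu by simp
    then show ?thesis using dd_eqI[OF hnu[OF smooth_on_dd[OF sm(1)] smooth_on_dd[OF sm(2)] z]] by simp
  qed
  have T1: "1 - T z \<noteq> 0" if "z \<in> D" for z using ne[OF that] by (auto simp: T_def complex_eq_iff)
  have f0: "nu z = ?f z * (1 - T z)" if "z \<in> D" for z using T1[OF that] by (simp add: stereo_def nu_def T_def)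
  have f1: "dd nu v z = dd ?f v z * (1 - T z) - ?f z * dd T v z" if z: "z \<in> D" for v z
  proof -
    have der: "((\<lambda>z. ?f z * (1 - T z)) has_derivative (\<lambda>v. ?f z * (0 - dd T v z) + dd ?f v z * (1 - T z))) (at z)"
      by (intro has_derivative_mult has_derivative_diff has_derivative_const h[OF sf z] h[OF sT z])
    have e: "dd nu v z = dd (\<lambda>z. ?f z * (1 - T z)) v z"
      using frechet_derivative_cong_open[OF D z, of nu "\<lambda>z. ?f z * (1 - T z)"] f0 by simp
    show ?thesis unfolding e dd_eqI[OF der] by (simp add: algebra_simps)
  qed
  have f2: "dd (dd nu v) v z = dd (dd ?f v) v z * (1 - T z) - 2 * (dd ?f v z * dd T v z) - ?f z * dd (dd T v) v z" for v
  proof -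
    have der: "((\<lambda>z. dd ?f v z * (1 - T z) - ?f z * dd T v z) has_derivative
        (\<lambda>u. (dd ?f v z * (0 - dd T u z) + dd (dd ?f v) u z * (1 - T z)) - (?f z * dd (dd T v) u z + dd ?f u z * dd T v z))) (at z)"
      by (intro has_derivative_mult has_derivative_diff has_derivative_const h[OF sf z] h[OF sT z]
          h[OF smooth_on_dd[OF sf] z] h[OF smooth_on_dd[OF sT] z])
    have e: "dd (dd nu v) v z = dd (\<lambda>z. dd ?f v z * (1 - T z) - ?f z * dd T v z) v z"
      using frechet_derivative_cong_open[OF D z, of "dd nu v" "\<lambda>z. dd ?f v z * (1 - T z) - ?f z * dd T v z"] f1 by simp
    show ?thesis unfolding e dd_eqI[OF der] by (simp add: algebra_simps)
  qed
  define t where "t = N3 z"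
  define m where "m = cnj (nu z)"
  have Tz: "T z = of_real t" by (simp add: T_def t_def)
  have t1: "1 - complex_of_real t \<noteq> 0" using T1[OF z] by (simp add: Tz)
  have num: "nu z * m = 1 - (of_real t)\<^sup>2"
    using sph[OF z] by (simp add: nu_def m_def t_def complex_eq_iff power2_eq_square algebra_simps)
  \<comment> \<open>The nonlinear coefficient simplifies because 1 + |f|^2 = 2 / (1 - t) on the unit
    sphere.\<close>
  have coef: "2 * cnj (?f z) / (1 + of_real ((cmod (?f z))\<^sup>2)) = m"
  proof -
    have cf: "cnj (?f z) * (1 - of_real t) = m" using f0[OF z] by (simp add: m_def Tz)
    have "(1 + ?f z * cnj (?f z)) * (1 - of_real t)\<^sup>2 = (1 - of_real t)\<^sup>2 + nu z * m"
      unfolding cf[symmetric] f0[OF z] Tz by (simp add: power2_eq_square algebra_simps)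
    also have "\<dots> = 2 * (1 - of_real t)" unfolding num by (simp add: power2_eq_square algebra_simps)
    finally have "((1 + ?f z * cnj (?f z)) * (1 - of_real t)) * (1 - of_real t) = 2 * (1 - of_real t)"
      by (simp add: power2_eq_square mult.assoc)
    then have e: "(1 + ?f z * cnj (?f z)) * (1 - of_real t) = 2"
      by (rule mult_right_cancel[OF t1, THEN iffD1])
    then have "1 + ?f z * cnj (?f z) \<noteq> 0" by auto
    moreover have "2 * cnj (?f z) = m * (1 + ?f z * cnj (?f z))"
      unfolding cf[symmetric] e[symmetric] by (simp add: algebra_simps)
    ultimately show ?thesis unfolding complex_norm_square by (simp only: nonzero_mult_div_cancel_right not_False_eq_True)
  qed
  define S where "S = (\<lambda>v. (dd N1 v z)\<^sup>2 + (dd N2 v z)\<^sup>2 + (dd N3 v z)\<^sup>2)"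
  \<comment> \<open>All quadratic first-order terms collapse to f times the energy density
    \<open>S v\<close>. Tangency of the derivative to the sphere enters as \<open>C\<close>.\<close>
  have br: "2 * (dd ?f v z * dd T v z) - (1 - of_real t) * m * (dd ?f v z)\<^sup>2 = ?f z * of_real (S v)" for v
  proof -
    define a b where "a = dd nu v z" and "b = dd T v z"
    have b: "b = of_real (dd N3 v z)" by (simp add: b_def ddT[OF z])
    have a: "a = of_real (dd N1 v z) + \<i> * of_real (dd N2 v z)" by (simp add: a_def ddnu[OF z])
    have C: "m * a + nu z * cnj a = - 2 * of_real t * b"
      using sphere_derivatives(1)[OF D sm sph z, of v] unfolding m_def a b nu_def t_def
      by (simp add: complex_eq_iff algebra_simps)
    have S: "of_real (S v) = a * cnj a + b\<^sup>2"
      by (simp add: S_def a b complex_eq_iff power2_eq_square)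
    define u where "u = 1 - complex_of_real t"
    have u: "u \<noteq> 0" using t1 by (simp add: u_def)
    have tu: "complex_of_real t = 1 - u" by (simp add: u_def)
    have fa: "dd ?f v z * u = a + ?f z * b" using f1[OF z, of v] by (simp add: a_def b_def Tz u_def algebra_simps)
    have fz: "?f z * u = nu z" using f0[OF z] by (simp add: Tz u_def)
    have num': "nu z * m = u * (2 - u)" unfolding num tu by (simp add: power2_eq_square algebra_simps)
    have C': "m * a + nu z * cnj a = - 2 * (1 - u) * b" using C unfolding tu by simp
    have fa2: "dd ?f v z * u\<^sup>2 = a * u + nu z * b" using fa fz by (simp add: power2_eq_square algebra_simps)
    have "(2 * (dd ?f v z * b) - u * m * (dd ?f v z)\<^sup>2) * u\<^sup>2 * u = 
        2 * (dd ?f v z * u\<^sup>2) * b * u - m * (dd ?f v z * u\<^sup>2)\<^sup>2"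
      by (simp add: power2_eq_square algebra_simps)
    also have "\<dots> = (nu z * (a * cnj a + b\<^sup>2)) * u\<^sup>2"
      unfolding fa2 using num' C' by algebra
    also have "\<dots> = (?f z * of_real (S v)) * u\<^sup>2 * u" unfolding fz[symmetric] S by (simp add: algebra_simps)
    finally show ?thesis using u by (simp add: u_def[symmetric] b_def)
  qed
  define P1 P2 P3 s where "P1 = lap N1 z" and "P2 = lap N2 z" and "P3 = lap N3 z" and "s = S 1 + S \<i>"
  have NP: "N1 z * P1 + N2 z * P2 + t * P3 = - s"
    using sphere_derivatives(2)[OF D sm sph z, of 1] sphere_derivatives(2)[OF D sm sph z, of \<i>]
    by (simp add: P1_def P2_def P3_def s_def S_def t_def lap_def algebra_simps)
  have lapnu: "lap nu z = of_real P1 + \<i> * of_real P2" "lap T z = of_real P3"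
    by (simp_all add: lap_def ddnu2 ddT2 P1_def P2_def P3_def algebra_simps)
  have key: "(1 - of_real t) * (lap ?f z - m * ((dd ?f 1 z)\<^sup>2 + (dd ?f \<i> z)\<^sup>2))
      = of_real P1 + \<i> * of_real P2 + ?f z * of_real (P3 + s)"
  proof -
    have "(1 - of_real t) * lap ?f z = lap nu z + 2 * (dd ?f 1 z * dd T 1 z) + 2 * (dd ?f \<i> z * dd T \<i> z) + ?f z * lap T z"
      unfolding lap_def f2 Tz by (simp add: algebra_simps)
    then have "(1 - of_real t) * (lap ?f z - m * ((dd ?f 1 z)\<^sup>2 + (dd ?f \<i> z)\<^sup>2)) =
      lap nu z + ?f z * lap T z + (2 * (dd ?f 1 z * dd T 1 z) - (1 - of_real t) * m * (dd ?f 1 z)\<^sup>2)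
       + (2 * (dd ?f \<i> z * dd T \<i> z) - (1 - of_real t) * m * (dd ?f \<i> z)\<^sup>2)"
      by (simp add: algebra_simps)
    also have "\<dots> = of_real P1 + \<i> * of_real P2 + ?f z * of_real (P3 + s)"
      unfolding br lapnu by (simp add: s_def algebra_simps)
    finally show ?thesis .
  qed
  have "harmonic_equation ?f z \<longleftrightarrow> (1 - of_real t) * (lap ?f z - m * ((dd ?f 1 z)\<^sup>2 + (dd ?f \<i> z)\<^sup>2)) = 0"
    unfolding harmonic_equation_real[OF D sf z] coef using t1 by simp
  also have "\<dots> \<longleftrightarrow> (1 - of_real t) * (of_real P1 + \<i> * of_real P2 + ?f z * of_real (P3 + s)) = 0"
    unfolding key using t1 by simp
  also have "(1 - of_real t) * (of_real P1 + \<i> * of_real P2 + ?f z * of_real (P3 + s))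
      = (1 - of_real t) * (of_real P1 + \<i> * of_real P2) + nu z * of_real (P3 + s)"
    unfolding f0[OF z] Tz by (simp add: algebra_simps)
  also have "\<dots> = 0 \<longleftrightarrow> (1 - t) * P1 + N1 z * (P3 + s) = 0 \<and> (1 - t) * P2 + N2 z * (P3 + s) = 0"
    by (simp add: nu_def complex_eq_iff)
  also have "\<dots> \<longleftrightarrow> (\<exists>l. P1 = l * N1 z \<and> P2 = l * N2 z \<and> P3 = l * t)"
  proof
    have tr: "1 - t \<noteq> 0" using ne[OF z] by (simp add: t_def)
    have sp: "(N1 z)\<^sup>2 + (N2 z)\<^sup>2 + t\<^sup>2 = 1" using sph[OF z] by (simp add: t_def)
    {
      assume a: "(1 - t) * P1 + N1 z * (P3 + s) = 0 \<and> (1 - t) * P2 + N2 z * (P3 + s) = 0"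
      \<comment> \<open>The two equations are multiplied by the first two components and added;
        \<open>NP\<close> eliminates P1 and P2 and yields the third component.\<close>
      have "(1 - t) * (P3 + s * t) = 0" using a NP sp by algebra
      then have 3: "P3 = - s * t" using tr by simp
      have "(1 - t) * (P1 + s * N1 z) = 0" "(1 - t) * (P2 + s * N2 z) = 0" using a unfolding 3 by algebra+
      then have "P1 = - s * N1 z" "P2 = - s * N2 z" using tr by auto
      then show "\<exists>l. P1 = l * N1 z \<and> P2 = l * N2 z \<and> P3 = l * t" using 3 by blast
    next
      assume "\<exists>l. P1 = l * N1 z \<and> P2 = l * N2 z \<and> P3 = l * t"
      then obtain l where l: "P1 = l * N1 z" "P2 = l * N2 z" "P3 = l * t" by blast
      have s: "s = - l" using NP sp unfolding l by algebra
      show "(1 - t) * P1 + N1 z * (P3 + s) = 0 \<and> (1 - t) * P2 + N2 z * (P3 + s) = 0"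
        unfolding l s by (simp add: algebra_simps)
    }
  qed
  finally show ?thesis by (simp add: P1_def P2_def P3_def t_def)
qed

section \<open>Change of parameters\<close>

lemma form_det_bilinear:
  fixes Q :: "complex \<Rightarrow> complex \<Rightarrow> real"
  assumes "\<And>u v. Q u v = Re u * (Re v * Q 1 1 + Im v * Q 1 \<i>) + Im u * (Re v * Q \<i> 1 + Im v * Q \<i> \<i>)"
  shows "form_det (\<lambda>u v. Q (T u) (T v)) = (Re (T 1) * Im (T \<i>) - Im (T 1) * Re (T \<i>))\<^sup>2 * form_det Q"
proof -
  define a b c d e f g h where "a = Re (T 1)" "b = Im (T 1)" "c = Re (T \<i>)" "d = Im (T \<i>)"
    "e = Q 1 1" "f = Q 1 \<i>" "g = Q \<i> 1" "h = Q \<i> \<i>"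
  note abbr = this
  have "Q (T 1) (T 1) = a * (a * e + b * f) + b * (a * g + b * h)"
    "Q (T 1) (T \<i>) = a * (c * e + d * f) + b * (c * g + d * h)"
    "Q (T \<i>) (T 1) = c * (a * e + b * f) + d * (a * g + b * h)"
    "Q (T \<i>) (T \<i>) = c * (c * e + d * f) + d * (c * g + d * h)"
    unfolding abbr by (rule assms)+
  then show ?thesis unfolding form_det_def abbr(1-8)[symmetric] by algebra
qed

lemma patch_subset: "patch X n V \<Longrightarrow> open W \<Longrightarrow> W \<subseteq> V \<Longrightarrow> patch X n W"
  unfolding patch_def using smooth_on_subset by blast

lemma patch_local:
  assumes "open V" "\<And>z. z \<in> V \<Longrightarrow> \<exists>W. z \<in> W \<and> patch X n W"
  shows "patch X n V"
proof -
  have "smooth_on V X" "smooth_on V n"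
    by (rule smooth_on_local, use assms(2) in \<open>fastforce simp: patch_def\<close>)+
  then show ?thesis using assms unfolding patch_def by meson
qed

lemma patch_cong:
  assumes "patch X n V" "\<And>z. z \<in> V \<Longrightarrow> X z = X' z" "\<And>z. z \<in> V \<Longrightarrow> n z = n' z"
  shows "patch X' n' V"
proof -
  interpret patch X n V by fact
  have dX: "frechet_derivative X' (at z) = frechet_derivative X (at z)" if "z \<in> V" for z
    by (rule frechet_derivative_cong_open[OF open_V that]) (simp add: assms(2))
  show ?thesis
  proof
    show "smooth_on V X'" "smooth_on V n'"
      using smooth_on_cong[OF open_V] assms(2,3) smooth_X smooth_n by blast+
    fix z v assume z: "z \<in> V"
    show "norm (X' z) = 1" "norm (n' z) = 1" "n' z \<bullet> X' z = 0" "n' z \<bullet> dd X' v z = 0"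
      "inj (frechet_derivative X' (at z))"
      using norm_X[OF z] norm_n[OF z] n_X[OF z] n_dX[OF z] inj_dX[OF z] assms(2,3)[OF z] dX[OF z] by simp_all
  qed (rule open_V)
qed

context patch
begin

lemma sform_bilinear:
  assumes z: "z \<in> V"
  shows "sform X n z u v = Re u * (Re v * sform X n z 1 1 + Im v * sform X n z 1 \<i>)
    + Im u * (Re v * sform X n z \<i> 1 + Im v * sform X n z \<i> \<i>)"
  using dd_expand[OF has_derivative_X[OF z], of v] dd_expand[OF has_derivative_n[OF z], of u]
  by (simp add: sform_def inner_add_left inner_add_right algebra_simps)

lemma gram_bilinear:
  assumes z: "z \<in> V"
  shows "gram X z u v = Re u * (Re v * gram X z 1 1 + Im v * gram X z 1 \<i>)
    + Im u * (Re v * gram X z \<i> 1 + Im v * gram X z \<i> \<i>)"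
  using dd_expand[OF has_derivative_X[OF z], of v] dd_expand[OF has_derivative_X[OF z], of u]
  by (simp add: gram_def inner_add_left inner_add_right algebra_simps)

text \<open>Under a change of parameters both determinants in \<open>curv\<close> are multiplied by
  the same squared Jacobian, so the quotient is unchanged.\<close>

lemma reparam:
  assumes W: "open W" and \<tau>: "smooth_on W \<tau>" "\<And>z. z \<in> W \<Longrightarrow> \<tau> z \<in> V"
    and inj\<tau>: "\<And>z. z \<in> W \<Longrightarrow> inj (frechet_derivative \<tau> (at z))"
    and X': "\<And>z. z \<in> W \<Longrightarrow> X' z = X (\<tau> z)" and n': "\<And>z. z \<in> W \<Longrightarrow> n' z = n (\<tau> z)"
  shows "patch X' n' W"
    and "\<And>z u v. z \<in> W \<Longrightarrow> sform X' n' z u v = sform X n (\<tau> z) (dd \<tau> u z) (dd \<tau> v z)"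
    and "\<And>z. z \<in> W \<Longrightarrow> curv X' n' z = curv X n (\<tau> z)"
proof -
  have dX: "dd X' v z = frechet_derivative X (at (\<tau> z)) (dd \<tau> v z)"
    and dn: "dd n' v z = frechet_derivative n (at (\<tau> z)) (dd \<tau> v z)" if z: "z \<in> W" for z v
  proof -
    have "frechet_derivative X' (at z) = frechet_derivative (\<lambda>z. X (\<tau> z)) (at z)"
      "frechet_derivative n' (at z) = frechet_derivative (\<lambda>z. n (\<tau> z)) (at z)"
      by (rule frechet_derivative_cong_open[OF W z], simp add: X' n')+
    then show "dd X' v z = frechet_derivative X (at (\<tau> z)) (dd \<tau> v z)"
      "dd n' v z = frechet_derivative n (at (\<tau> z)) (dd \<tau> v z)"
      using dd_compose[OF \<tau>(1) z \<tau>(2)[OF z] smooth_X] dd_compose[OF \<tau>(1) z \<tau>(2)[OF z] smooth_n] by simp_all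
  qed
  show s: "sform X' n' z u v = sform X n (\<tau> z) (dd \<tau> u z) (dd \<tau> v z)" if "z \<in> W" for z u v
    by (simp add: sform_def dX[OF that] dn[OF that])
  show p: "patch X' n' W"
  proof
    show "smooth_on W X'" "smooth_on W n'"
      using smooth_on_cong[OF W] smooth_on_compose[OF W \<tau>(1,2) smooth_X] smooth_on_compose[OF W \<tau>(1,2) smooth_n] X' n'
      by (metis (no_types, lifting))+
    fix z v assume z: "z \<in> W"
    note tz = \<tau>(2)[OF z]
    show "norm (X' z) = 1" "norm (n' z) = 1" "n' z \<bullet> X' z = 0" "n' z \<bullet> dd X' v z = 0"
      using norm_X[OF tz] norm_n[OF tz] n_X[OF tz] n_dX[OF tz] by (simp_all add: X'[OF z] n'[OF z] dX[OF z])
    have "frechet_derivative X' (at z) = frechet_derivative X (at (\<tau> z)) \<circ> frechet_derivative \<tau> (at z)"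
      using dX[OF z] by auto
    then show "inj (frechet_derivative X' (at z))" using inj_dX[OF tz] inj\<tau>[OF z] by (simp add: inj_compose)
  qed (rule W)
  fix z assume z: "z \<in> W"
  interpret P': patch X' n' W by (rule p)
  let ?d = "(Re (dd \<tau> 1 z) * Im (dd \<tau> \<i> z) - Im (dd \<tau> 1 z) * Re (dd \<tau> \<i> z))\<^sup>2"
  have g: "gram X' z u v = gram X (\<tau> z) (dd \<tau> u z) (dd \<tau> v z)" for u v
    by (simp add: gram_def dX[OF z])
  have 1: "form_det (sform X' n' z) = ?d * form_det (sform X n (\<tau> z))"
    using form_det_bilinear[OF sform_bilinear[OF \<tau>(2)[OF z]], of "frechet_derivative \<tau> (at z)"] s[OF z]
    by (simp add: form_det_def)
  have 2: "form_det (gram X' z) = ?d * form_det (gram X (\<tau> z))"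
    using form_det_bilinear[OF gram_bilinear[OF \<tau>(2)[OF z]], of "frechet_derivative \<tau> (at z)"] g
    by (simp add: form_det_def)
  have "?d \<noteq> 0" using 2 P'.gram_det_pos[OF z] by auto
  then show "curv X' n' z = curv X n (\<tau> z)" unfolding curv_def 1 2 by simp
qed

text \<open>The vectors orthogonal to X and to the surface form a line, so two unit normals differ
  by a sign. The curvature is quadratic in that sign.\<close>

lemma other_normal:
  assumes "patch X n' W" "z \<in> V" "z \<in> W"
  obtains \<epsilon> where "\<epsilon>\<^sup>2 = 1" "n' z = \<epsilon> *\<^sub>R n z" "\<And>u v. sform X n' z u v = \<epsilon> * sform X n z u v"
    "curv X n' z = curv X n z"
proof -
  interpret P': patch X n' W by fact
  define \<epsilon> where "\<epsilon> = n' z \<bullet> n z"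
  have nn: "n z \<bullet> n z = 1" using norm_n[OF assms(2)] by (simp add: dot_square_norm)
  have "n' z - \<epsilon> *\<^sub>R n z = 0"
    by (rule frame_complete[OF assms(2)])
      (use P'.n_X[OF assms(3)] P'.n_dX[OF assms(3)] n_X[OF assms(2)] n_dX[OF assms(2)] nn in
        \<open>simp_all add: inner_diff_left \<epsilon>_def\<close>)
  then have e: "n' z = \<epsilon> *\<^sub>R n z" by simp
  have e2: "\<epsilon>\<^sup>2 = 1"
    using P'.norm_n[OF assms(3)] norm_n[OF assms(2)] unfolding e by (simp add: abs_square_eq_1)
  have s: "sform X n' z u v = \<epsilon> * sform X n z u v" for u v
    by (simp add: P'.sform_normal[OF assms(3)] sform_normal[OF assms(2)] e)
  have "form_det (sform X n' z) = \<epsilon>\<^sup>2 * form_det (sform X n z)"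
    unfolding form_det_def s by (simp add: power2_eq_square algebra_simps)
  then have "curv X n' z = curv X n z" using e2 by (simp add: curv_def)
  with e2 e s show ?thesis by (rule that)
qed

section \<open>The normal with positive second form\<close>

definition posdef :: "complex \<Rightarrow> bool" where
  "posdef z \<longleftrightarrow> (\<forall>v. v \<noteq> 0 \<longrightarrow> sform X n z v v > 0)"

text \<open>Sylvester's criterion in dimension two, by completing the square.\<close>

lemma posdef_if_det_pos:
  assumes z: "z \<in> V" and pos: "sform X n z 1 1 > 0" "curv X n z > 0"
  shows "posdef z"
  unfolding posdef_def
proof (intro allI impI)
  fix v :: complex assume v: "v \<noteq> 0"
  define a b c where "a = sform X n z 1 1" "b = sform X n z 1 \<i>" "c = sform X n z \<i> \<i>"
  note abc = this
  have ib: "sform X n z \<i> 1 = b" unfolding abc by (rule sform_sym[OF z])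
  have d: "a * c - b * b > 0"
    using pos(2) gram_det_pos[OF z] by (simp add: curv_def zero_less_divide_iff form_det_def abc ib[unfolded abc])
  have "sform X n z v v = Re v * (Re v * a + Im v * b) + Im v * (Re v * b + Im v * c)"
    unfolding sform_bilinear[OF z, of v v] ib abc[symmetric] ..
  then have "a * sform X n z v v = (a * Re v + b * Im v)\<^sup>2 + (a * c - b * b) * (Im v)\<^sup>2"
    by (simp add: power2_eq_square algebra_simps)
  also have "\<dots> > 0"
  proof (cases "Im v = 0")
    case True
    then have "Re v \<noteq> 0" using v by (simp add: complex_eq_iff)
    then show ?thesis using True pos(1) by (simp add: abc)
  next
    case False
    then show ?thesis using d by (simp add: add_nonneg_pos)
  qed
  finally show "sform X n z v v > 0" using pos(1) by (simp add: abc zero_less_mult_iff)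
qed

lemma sform_nonzero:
  assumes z: "z \<in> V" and "curv X n z > 0"
  shows "sform X n z 1 1 \<noteq> 0"
proof
  assume 0: "sform X n z 1 1 = 0"
  have "form_det (sform X n z) > 0" using assms(2) gram_det_pos[OF z] by (simp add: curv_def zero_less_divide_iff)
  then show False by (simp add: form_det_def 0 sform_sym[OF z, of \<i> 1] not_less[symmetric])
qed

lemma smooth_sform: "smooth_on V (\<lambda>z. sform X n z u v)"
  unfolding sform_def by (intro smooth_intros open_V smooth)

text \<open>Flipping the normal where the second form is negative keeps it smooth, as the sign is
  locally constant.\<close>

lemma positive_patch:
  assumes pos: "\<And>z. z \<in> V \<Longrightarrow> curv X n z > 0"
  obtains n' where "patch X n' V" "\<And>z. z \<in> V \<Longrightarrow> patch.posdef X n' z"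
proof -
  define h where "h = (\<lambda>z. sform X n z 1 1)"
  have h0: "h z \<noteq> 0" if "z \<in> V" for z unfolding h_def by (rule sform_nonzero[OF that pos[OF that]])
  have c: "continuous_on V h" unfolding h_def by (rule smooth_on_continuous_on[OF smooth_sform])
  define n' where "n' = (\<lambda>z. sgn (h z) *\<^sub>R n z)"
  have dX: "patch X (\<lambda>z. s *\<^sub>R n z) W" if "s = 1 \<or> s = - 1" "open W" "W \<subseteq> V" for s :: real and W
  proof -
    interpret W: patch X n W by (rule patch_subset[OF _ that(2,3)]) unfold_locales
    show ?thesis
    proof
      show "smooth_on W (\<lambda>z. s *\<^sub>R n z)" by (intro smooth_intros that W.smooth)
    qed (use that W.norm_X W.norm_n W.n_X W.n_dX W.inj_dX W.smooth_X in auto)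
  qed
  have p: "patch X n' V"
  proof (rule patch_local[OF open_V])
    fix z assume z: "z \<in> V"
    let ?P = "V \<inter> h -` {0<..}" and ?N = "V \<inter> h -` {..<0}"
    have o: "open ?P" "open ?N" by (intro continuous_open_preimage[OF c open_V] open_greaterThan open_lessThan)+
    have P: "patch X n' ?P" by (rule patch_cong[OF dX[OF _ o(1)], of 1]) (auto simp: n'_def)
    have N: "patch X n' ?N" by (rule patch_cong[OF dX[OF _ o(2)], of "- 1"]) (auto simp: n'_def)
    show "\<exists>W. z \<in> W \<and> patch X n' W"
    proof (cases "h z > 0")
      case True
      then show ?thesis using z P by (intro exI[of _ ?P] conjI) auto
    next
      case False
      then show ?thesis using z h0[OF z] N by (intro exI[of _ ?N] conjI) auto
    qed
  qed
  interpret P': patch X n' V by (rule p)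
  have "P'.posdef z" if z: "z \<in> V" for z
  proof (rule P'.posdef_if_det_pos[OF z])
    have "sform X n' z 1 1 = sgn (h z) * h z"
      by (simp only: P'.sform_normal[OF z]) (simp add: n'_def h_def sform_normal[OF z])
    then show "sform X n' z 1 1 > 0" using h0[OF z] by (simp add: sgn_mult_self_eq sgn_if)
    obtain \<epsilon> where "curv X n' z = curv X n z" using other_normal[OF p z z] by metis
    then show "curv X n' z > 0" using pos[OF z] by simp
  qed
  then show ?thesis using that p by blast
qed

lemma positive_normal_unique:
  assumes "patch X n' W" "z \<in> V" "z \<in> W" "posdef z" "patch.posdef X n' z"
  shows "n' z = n z"
proof -
  interpret P': patch X n' W by fact
  obtain \<epsilon> where e: "\<epsilon>\<^sup>2 = 1" "n' z = \<epsilon> *\<^sub>R n z" "\<And>u v. sform X n' z u v = \<epsilon> * sform X n z u v"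
    using other_normal[OF assms(1-3)] by metis
  have "sform X n z 1 1 > 0" "\<epsilon> * sform X n z 1 1 > 0"
    using assms(4,5) e(3) by (simp_all add: posdef_def P'.posdef_def)
  then have "\<epsilon> > 0" by (simp add: zero_less_mult_iff)
  then have "\<epsilon> = 1" using e(1) by (simp add: power2_eq_1_iff)
  then show ?thesis using e(2) by simp
qed

end

text \<open>The vector c is the cross product of the two partial derivatives in the tangent space of
  the sphere at X: their translated quaternion product, corrected by its component along X.
  Normalizing it gives n.\<close>

lemma unit_normal_exists:
  fixes X :: "complex \<Rightarrow> quat"
  assumes V: "open V" and X: "smooth_on V X" "\<And>z. z \<in> V \<Longrightarrow> norm (X z) = 1"
    and inj: "\<And>z. z \<in> V \<Longrightarrow> inj (frechet_derivative X (at z))"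
  obtains n where "patch X n V"
proof -
  define c where "c = (\<lambda>z. qmult (dd X 1 z) (qmult (qcnj (X z)) (dd X \<i> z)) + (dd X 1 z \<bullet> dd X \<i> z) *\<^sub>R X z)"
  have o: "dd X v z \<bullet> X z = 0" "X z \<bullet> dd X v z = 0" if z: "z \<in> V" for z v
  proof -
    have "dd (\<lambda>z. X z \<bullet> X z) v z = dd (\<lambda>_. 1) v z"
      using frechet_derivative_cong_open[OF V z, of "\<lambda>z. X z \<bullet> X z" "\<lambda>_. 1"] X(2) by (simp add: dot_square_norm)
    then show "dd X v z \<bullet> X z = 0" "X z \<bullet> dd X v z = 0"
      using dd_bilinear[OF bounded_bilinear_inner X(1,1) z, of v] by (simp_all add: inner_commute)
  qed
  have XX: "X z \<bullet> X z = 1" if "z \<in> V" for z using X(2)[OF that] by (simp add: dot_square_norm)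
  have cX: "c z \<bullet> X z = 0" if z: "z \<in> V" for z
  proof -
    have "X z \<bullet> qmult (dd X 1 z) (qmult (qcnj (X z)) (dd X \<i> z)) = triple (X z) (X z) (dd X 1 z) (dd X \<i> z)"
      by (simp add: triple_def)
    also have "\<dots> + triple (X z) (X z) (dd X \<i> z) (dd X 1 z) = - 2 * (dd X 1 z \<bullet> dd X \<i> z)"
      unfolding triple_def inner_add_right[symmetric] qmult_swap using o[OF z] XX[OF z]
      by (simp add: inner_diff_right inner_add_right)
    moreover have "triple (X z) (X z) (dd X \<i> z) (dd X 1 z) = triple (X z) (X z) (dd X 1 z) (dd X \<i> z)"
      unfolding triple_def inner_quat qmult_def qcnj_def by (simp add: algebra_simps)
    ultimately show ?thesis using XX[OF z] by (simp add: c_def inner_add_left inner_add_right inner_commute)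
  qed
  have cb: "c z \<bullet> dd X b z = 0" if z: "z \<in> V" and b: "b \<in> {1, \<i>}" for z b
  proof -
    have "triple (X z) (dd X b z) (dd X 1 z) (dd X \<i> z) = 0"
      using b o[OF z] by (auto simp: triple_eq_12 triple_eq_13)
    then show ?thesis using o[OF z] by (simp add: c_def inner_add_left inner_add_right inner_commute triple_def)
  qed
  have cv: "c z \<bullet> dd X v z = 0" if z: "z \<in> V" for z v
    using cb[OF z, of 1] cb[OF z, of \<i>] dd_expand[OF smooth_on_has_derivative[OF X(1) z], of v]
    by (simp add: inner_add_right)
  have c0: "c z \<noteq> 0" if z: "z \<in> V" for z
  proof
    assume "c z = 0"
    then have eq: "qmult (dd X 1 z) (qmult (qcnj (X z)) (dd X \<i> z)) = (- (dd X 1 z \<bullet> dd X \<i> z)) *\<^sub>R X z"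
      by (simp add: c_def eq_neg_iff_add_eq_0)
    have D: "(X has_derivative frechet_derivative X (at z)) (at z)" by (rule smooth_on_has_derivative[OF X(1) z])
    have lin: "linear (frechet_derivative X (at z))" by (rule has_derivative_linear[OF D])
    have nz: "dd X v z \<noteq> 0" if "v \<noteq> 0" for v
    proof
      assume "dd X v z = 0"
      then have "frechet_derivative X (at z) v = frechet_derivative X (at z) 0" by (simp add: linear_0[OF lin])
      then show False using inj[OF z] that by (simp add: inj_eq)
    qed
    \<comment> \<open>If c vanished, multiplying the relation \<open>eq\<close> on the left by X and
      the conjugate of \<open>dd X 1\<close> would make the two partial derivatives linearly
      dependent.\<close>
    have "qmult (X z) (qmult (qcnj (dd X 1 z)) (qmult (dd X 1 z) (qmult (qcnj (X z)) (dd X \<i> z))))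
        = (dd X 1 z \<bullet> dd X 1 z) *\<^sub>R dd X \<i> z"
      unfolding qmult_assoc[of "qcnj (dd X 1 z)" "dd X 1 z", symmetric] qmult_qcnj
      by (simp add: qmult_scaleR_left qmult_scaleR_right qmult_qcnj_cancel[OF X(2)[OF z]])
    moreover have "qmult (X z) (qmult (qcnj (dd X 1 z)) (X z)) = - dd X 1 z"
    proof -
      have "qmult (X z) (qcnj (dd X 1 z)) + qmult (dd X 1 z) (qcnj (X z)) = (2 * (X z \<bullet> dd X 1 z)) *\<^sub>R qone"
        by (simp add: inner_quat qmult_def qcnj_def qone_def complex_eq_iff algebra_simps prod_eq_iff)
      then have "qmult (X z) (qcnj (dd X 1 z)) = - qmult (dd X 1 z) (qcnj (X z))"
        using o[OF z] by (simp add: eq_neg_iff_add_eq_0)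
      then have "qmult (qmult (X z) (qcnj (dd X 1 z))) (X z) = qmult (- qmult (dd X 1 z) (qcnj (X z))) (X z)" by simp
      also have "\<dots> = (- 1) *\<^sub>R qmult (dd X 1 z) (qmult (qcnj (X z)) (X z))"
        by (metis qmult_assoc qmult_scaleR_left scaleR_minus1_left)
      finally show ?thesis using XX[OF z] by (simp add: qmult_assoc qmult_qcnj)
    qed
    ultimately have "(dd X 1 z \<bullet> dd X 1 z) *\<^sub>R dd X \<i> z = (dd X 1 z \<bullet> dd X \<i> z) *\<^sub>R dd X 1 z"
      by (simp only: eq qmult_scaleR_right) simp
    then have "frechet_derivative X (at z) ((dd X 1 z \<bullet> dd X 1 z) *\<^sub>R \<i> - (dd X 1 z \<bullet> dd X \<i> z) *\<^sub>R 1) = 0"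
      by (simp only: linear_diff[OF lin] linear_scale[OF lin]) simp
    moreover have "(dd X 1 z \<bullet> dd X 1 z) *\<^sub>R \<i> - (dd X 1 z \<bullet> dd X \<i> z) *\<^sub>R 1 \<noteq> 0"
      using nz[of 1] by (auto simp: complex_eq_iff)
    ultimately show False using nz by blast
  qed
  have lq: "bounded_linear qcnj"
    unfolding linear_conv_bounded_linear[symmetric] qcnj_def
    by (intro linearI) (simp_all add: complex_eq_iff prod_eq_iff)
  have sc: "smooth_on V c"
    unfolding c_def
    by (intro smooth_intros V X smooth_on_bilinear[OF V bounded_bilinear_qmult] smooth_on_bounded_linear[OF V lq])
  define n where "n = (\<lambda>z. inverse (sqrt (c z \<bullet> c z)) *\<^sub>R c z)"
  have "patch X n V"
  proof
    show "smooth_on V n" unfolding n_def by (intro smooth_intros V sc) (use c0 in auto)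
    fix z v assume z: "z \<in> V"
    show "norm (n z) = 1" using c0[OF z] by (simp add: n_def norm_eq_sqrt_inner[symmetric])
    show "n z \<bullet> X z = 0" "n z \<bullet> dd X v z = 0" using cX[OF z] cv[OF z] by (simp_all add: n_def)
  qed (use V X inj in auto)
  then show ?thesis using that by blast
qed

section \<open>Harmonicity in a conformal parameter\<close>

lemma harmonic_equation_cong:
  assumes "open D" "\<And>z. z \<in> D \<Longrightarrow> f z = g z" "z \<in> D"
  shows "harmonic_equation f z \<longleftrightarrow> harmonic_equation g z"
proof -
  have d: "frechet_derivative f (at w) = frechet_derivative g (at w)" if "w \<in> D" for w
    by (rule frechet_derivative_cong_open[OF assms(1) that assms(2)])
  have z: "deriv_z f w = deriv_z g w" if "w \<in> D" for w using d[OF that] by (simp add: deriv_z_def)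
  have "frechet_derivative (deriv_z f) (at z) = frechet_derivative (deriv_z g) (at z)"
    by (rule frechet_derivative_cong_open[OF assms(1,3) z])
  then show ?thesis
    using d[OF assms(3)] z[OF assms(3)] assms(2)[OF assms(3)]
    by (simp add: harmonic_equation_def deriv_zbar_def)
qed

lemma lap_uminus:
  fixes f :: "complex \<Rightarrow> real"
  assumes "open D" "smooth_on D f" "z \<in> D"
  shows "lap (\<lambda>z. - f z) z = - lap f z"
proof -
  have L: "bounded_linear (\<lambda>x::real. - x)" by (intro bounded_linear_minus bounded_linear_ident)
  have 1: "dd (\<lambda>z. - f z) v w = - dd f v w" if "w \<in> D" for v w by (rule dd_bounded_linear[OF L assms(2) that])
  have "dd (dd (\<lambda>z. - f z) v) v z = - dd (dd f v) v z" for v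
    using frechet_derivative_cong_open[OF assms(1,3), of "dd (\<lambda>z. - f z) v" "\<lambda>z. - dd f v z"] 1
      dd_bounded_linear[OF L smooth_on_dd[OF assms(2)] assms(3)] by simp
  then show ?thesis by (simp add: lap_def)
qed

lemma open_level_complement:
  fixes f :: "complex \<Rightarrow> real"
  assumes "open V" "smooth_on V f"
  shows "open {z \<in> V. f z \<noteq> a}"
proof -
  have "{z \<in> V. f z \<noteq> a} = V \<inter> f -` (- {a})" by auto
  then show ?thesis
    using continuous_open_preimage[OF smooth_on_continuous_on[OF assms(2)] assms(1) open_Compl[OF closed_singleton[of a]]]
    by simp
qed

context gauss_patch
begin

text \<open>Inversion of the Riemann sphere is the rotation (N1, N2, N3) to (N1, -N2, -N3), so the
  coordinate 1/g is again a stereographic projection. The domains of the two coordinates cover the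
  patch.\<close>

lemma harmonic_patch_iff:
  fixes g :: "complex \<Rightarrow> riemann_sphere"
  assumes g: "\<And>z. z \<in> V \<Longrightarrow> g z = (if gauss_comp e3 z = 1 then None
      else Some ((of_real (gauss_comp e1 z) + \<i> * of_real (gauss_comp e2 z)) / (1 - of_real (gauss_comp e3 z))))"
  shows "(\<forall>s\<in>{id, sphere_inversion}.
      let D = {z \<in> V. s (g z) \<noteq> None}; f = (\<lambda>z. the (s (g z)))
      in open D \<and> smooth_on D f \<and> (\<forall>z\<in>D. harmonic_equation f z))
    \<longleftrightarrow> (\<forall>z\<in>V. dd (curv X n) 1 z = 0 \<and> dd (curv X n) \<i> z = 0)"
proof -
  let ?N1 = "gauss_comp e1" and ?N2 = "gauss_comp e2" and ?N3 = "gauss_comp e3"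
  let ?M2 = "\<lambda>z. - ?N2 z" and ?M3 = "\<lambda>z. - ?N3 z"
  let ?crit = "\<lambda>z. dd (curv X n) 1 z = 0 \<and> dd (curv X n) \<i> z = 0"
  define D where "D = {z \<in> V. ?N3 z \<noteq> 1}"
  define D' where "D' = {z \<in> V. ?N3 z \<noteq> - 1}"
  have D: "open D" "D \<subseteq> V" and D': "open D'" "D' \<subseteq> V"
    unfolding D_def D'_def using open_level_complement[OF open_V smooth_comp] by auto
  note sD = smooth_on_subset[OF smooth_comp D(2)] and sD' = smooth_on_subset[OF smooth_comp D'(2)]
  have sM: "smooth_on D' ?M2" "smooth_on D' ?M3" by (intro smooth_on_minus[OF D'(1)] sD')+
  have i1: "id (g z) \<noteq> None \<longleftrightarrow> ?N3 z \<noteq> 1" if "z \<in> V" for z using g[OF that] by simp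
  have fD: "the (id (g z)) = stereo ?N1 ?N2 ?N3 z" if "z \<in> D" for z
    using g[of z] that by (simp add: D_def stereo_def)
  have sph: "(?N1 z)\<^sup>2 + (?N2 z)\<^sup>2 = (1 - ?N3 z) * (1 + ?N3 z)" if "z \<in> V" for z
    using comp_sphere[OF that] by (simp add: power2_eq_square algebra_simps)
  have N12: "?N1 z = 0 \<and> ?N2 z = 0 \<longleftrightarrow> ?N3 z = 1 \<or> ?N3 z = - 1" if "z \<in> V" for z
    using sph[OF that] by (auto simp: sum_power2_eq_zero_iff eq_neg_iff_add_eq_0 add.commute)
  have zero: "of_real (?N1 z) + \<i> * of_real (?N2 z) = 0 \<longleftrightarrow> ?N3 z = 1 \<or> ?N3 z = - 1" if "z \<in> V" for z
    using N12[OF that] by (simp add: complex_eq_iff)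
  \<comment> \<open>g = 0 occurs exactly where N3 = -1; at N3 = 1 the value \<open>None\<close> is
    inverted to \<open>Some 0\<close>.\<close>
  have i2: "sphere_inversion (g z) \<noteq> None \<longleftrightarrow> ?N3 z \<noteq> - 1" if "z \<in> V" for z
  proof (cases "?N3 z = 1")
    case False
    then have "1 - complex_of_real (?N3 z) \<noteq> 0" by (simp add: complex_eq_iff)
    then show ?thesis using g[OF that] zero[OF that] False by simp
  qed (use g[OF that] in simp)
  have fD': "the (sphere_inversion (g z)) = stereo ?N1 ?M2 ?M3 z" if z: "z \<in> D'" for z
  proof (cases "?N3 z = 1")
    case True
    then have "?N1 z = 0" "?N2 z = 0" using N12[of z] z by (auto simp: D'_def)
    then show ?thesis using g[of z] z True by (simp add: D'_def stereo_def)
  next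
    case False
    have zV: "z \<in> V" using z by (simp add: D'_def)
    have u: "1 - complex_of_real (?N3 z) \<noteq> 0" "1 + complex_of_real (?N3 z) \<noteq> 0"
      using False z by (auto simp: complex_eq_iff D'_def)
    have nz: "complex_of_real (?N1 z) + \<i> * of_real (?N2 z) \<noteq> 0" using zero[OF zV] False z by (simp add: D'_def)
    have "(complex_of_real (?N1 z) - \<i> * of_real (?N2 z)) * (of_real (?N1 z) + \<i> * of_real (?N2 z))
        = of_real ((?N1 z)\<^sup>2 + (?N2 z)\<^sup>2)"
      by (simp add: power2_eq_square algebra_simps)
    also have "\<dots> = (1 - of_real (?N3 z)) * (1 + of_real (?N3 z))" unfolding sph[OF zV] by simp
    finally have "(1 - complex_of_real (?N3 z)) / (of_real (?N1 z) + \<i> * of_real (?N2 z))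
        = (of_real (?N1 z) - \<i> * of_real (?N2 z)) / (1 + of_real (?N3 z))"
      using u nz by (simp add: frac_eq_eq mult.commute)
    then show ?thesis using g[OF zV] False u nz by (simp add: stereo_def)
  qed
  have DD: "{z \<in> V. id (g z) \<noteq> None} = D" "{z \<in> V. sphere_inversion (g z) \<noteq> None} = D'"
    using i1 i2 by (auto simp: D_def D'_def)
  have H: "harmonic_equation (\<lambda>z. the (id (g z))) z \<longleftrightarrow> ?crit z" if z: "z \<in> D" for z
  proof -
    have zV: "z \<in> V" using z D by blast
    have "harmonic_equation (\<lambda>z. the (id (g z))) z \<longleftrightarrow> harmonic_equation (stereo ?N1 ?N2 ?N3) z"
      by (rule harmonic_equation_cong[OF D(1) fD z])
    also have "\<dots> \<longleftrightarrow> (\<exists>l. lap ?N1 z = l * ?N1 z \<and> lap ?N2 z = l * ?N2 z \<and> lap ?N3 z = l * ?N3 z)"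
      by (rule stereo_harmonic_iff[OF D(1) sD sD sD _ _ z]) (use D comp_sphere in \<open>auto simp: D_def\<close>)
    also have "\<dots> \<longleftrightarrow> ?crit z" by (rule parallel_iff_critical[OF zV])
    finally show ?thesis .
  qed
  have H': "harmonic_equation (\<lambda>z. the (sphere_inversion (g z))) z \<longleftrightarrow> ?crit z" if z: "z \<in> D'" for z
  proof -
    have zV: "z \<in> V" using z D' by blast
    have "harmonic_equation (\<lambda>z. the (sphere_inversion (g z))) z \<longleftrightarrow> harmonic_equation (stereo ?N1 ?M2 ?M3) z"
      by (rule harmonic_equation_cong[OF D'(1) fD' z])
    also have "\<dots> \<longleftrightarrow> (\<exists>l. lap ?N1 z = l * ?N1 z \<and> lap ?M2 z = l * ?M2 z \<and> lap ?M3 z = l * ?M3 z)"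
      by (rule stereo_harmonic_iff[OF D'(1) sD' sM _ _ z]) (use D' comp_sphere in \<open>auto simp: D'_def\<close>)
    also have "\<dots> \<longleftrightarrow> (\<exists>l. lap ?N1 z = l * ?N1 z \<and> lap ?N2 z = l * ?N2 z \<and> lap ?N3 z = l * ?N3 z)"
      unfolding lap_uminus[OF D'(1) sD' z] by simp
    also have "\<dots> \<longleftrightarrow> ?crit z" by (rule parallel_iff_critical[OF zV])
    finally show ?thesis .
  qed
  have S: "smooth_on D (\<lambda>z. the (id (g z)))"
    by (rule smooth_on_cong[OF D(1) fD[symmetric] smooth_on_stereo[OF D(1) sD sD sD]]) (auto simp: D_def)
  have S': "smooth_on D' (\<lambda>z. the (sphere_inversion (g z)))"
    by (rule smooth_on_cong[OF D'(1) fD'[symmetric] smooth_on_stereo[OF D'(1) sD' sM]]) (auto simp: D'_def)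
  have "V = D \<union> D'" using D D' by (auto simp: D_def D'_def)
  then have "(\<forall>z\<in>V. ?crit z) \<longleftrightarrow> (\<forall>z\<in>D. ?crit z) \<and> (\<forall>z\<in>D'. ?crit z)" by blast
  moreover have two: "(\<forall>s\<in>{id, sphere_inversion}. Q s) \<longleftrightarrow> Q id \<and> Q sphere_inversion"
    for Q :: "(riemann_sphere \<Rightarrow> riemann_sphere) \<Rightarrow> bool" by blast
  ultimately show ?thesis
    unfolding two Let_def DD using D(1) D'(1) S S' H H' by simp
qed

end

section \<open>Charts\<close>

lemma chart_facts:
  assumes "is_chart c"
  shows "open (fst c)" "open (chart_image c)"
    and "continuous_on (fst c) (snd c)" "continuous_on (chart_image c) (inv_into (fst c) (snd c))"
    and "\<And>p. p \<in> fst c \<Longrightarrow> inv_into (fst c) (snd c) (snd c p) = p"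
    and "\<And>p. p \<in> fst c \<Longrightarrow> snd c p \<in> chart_image c"
    and "\<And>z. z \<in> chart_image c \<Longrightarrow> inv_into (fst c) (snd c) z \<in> fst c"
    and "\<And>z. z \<in> chart_image c \<Longrightarrow> snd c (inv_into (fst c) (snd c) z) = z"
proof -
  have h: "homeomorphism (fst c) (chart_image c) (snd c) (inv_into (fst c) (snd c))"
    using assms by (simp add: is_chart_def)
  show "open (fst c)" "open (chart_image c)" using assms by (simp_all add: is_chart_def)
  show "continuous_on (fst c) (snd c)" "continuous_on (chart_image c) (inv_into (fst c) (snd c))"
    by (rule homeomorphism_cont1[OF h] homeomorphism_cont2[OF h])+
  show "inv_into (fst c) (snd c) (snd c p) = p" "snd c p \<in> chart_image c" if "p \<in> fst c" for p
    using homeomorphism_apply1[OF h that] homeomorphism_image1[OF h] that by auto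
  show "inv_into (fst c) (snd c) z \<in> fst c" "snd c (inv_into (fst c) (snd c) z) = z" if "z \<in> chart_image c" for z
    using homeomorphism_apply2[OF h that] homeomorphism_image2[OF h] that by auto
qed

lemma in_chart_at: "is_chart c \<Longrightarrow> p \<in> fst c \<Longrightarrow> in_chart c f (snd c p) = f p"
  by (simp add: in_chart_def chart_facts(5))

lemma open_chart_subimage:
  assumes "is_chart c" "open U"
  shows "open (snd c ` (fst c \<inter> U))"
proof -
  have "snd c ` (fst c \<inter> U) = chart_image c \<inter> inv_into (fst c) (snd c) -` U"
    using chart_facts(5-8)[OF assms(1)] by (force simp: image_iff)
  then show ?thesis
    using continuous_open_preimage[OF chart_facts(4)[OF assms(1)] chart_facts(2)[OF assms(1)] assms(2)] by simp
qed

text \<open>Injectivity of the derivative follows from the chain rule: the reverse transition map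
  provides a left inverse.\<close>

lemma transition:
  fixes c d :: "'a::topological_space chart"
  assumes c: "is_chart c" and d: "is_chart d" and cd: "smooth_transition c d" and dc: "smooth_transition d c"
  defines "W \<equiv> snd c ` (fst c \<inter> fst d)" and "\<tau> \<equiv> in_chart c (snd d)"
  shows "open W" "smooth_on W \<tau>" "\<And>z. z \<in> W \<Longrightarrow> \<tau> z \<in> chart_image d"
    and "\<And>z. z \<in> W \<Longrightarrow> inj (frechet_derivative \<tau> (at z))"
    and "\<And>z (f :: 'a \<Rightarrow> 'b). z \<in> W \<Longrightarrow> in_chart c f z = in_chart d f (\<tau> z)"
proof -
  show W: "open W" unfolding W_def by (rule open_chart_subimage[OF c chart_facts(1)[OF d]])
  show sm: "smooth_on W \<tau>" using cd by (simp add: smooth_transition_def W_def \<tau>_def)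
  have \<tau>p: "\<tau> (snd c p) = snd d p" if "p \<in> fst c" for p
    using in_chart_at[OF c that] by (simp add: \<tau>_def)
  show "\<tau> z \<in> chart_image d" if "z \<in> W" for z
    using that \<tau>p chart_facts(6)[OF d] by (auto simp: W_def)
  show "in_chart c f z = in_chart d f (\<tau> z)" if "z \<in> W" for z and f :: "'a \<Rightarrow> 'b"
    using that by (auto simp: W_def \<tau>p in_chart_at[OF c] in_chart_at[OF d])
  show "inj (frechet_derivative \<tau> (at z))" if z: "z \<in> W" for z
  proof (rule injI)
    fix u v assume uv: "frechet_derivative \<tau> (at z) u = frechet_derivative \<tau> (at z) v"
    define \<sigma> where "\<sigma> = in_chart d (snd c)"
    define W' where "W' = snd d ` (fst d \<inter> fst c)"
    have s\<sigma>: "smooth_on W' \<sigma>" using dc by (simp add: smooth_transition_def W'_def \<sigma>_def)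
    have tW: "\<tau> z \<in> W'" using z \<tau>p by (auto simp: W_def W'_def)
    have \<sigma>\<tau>: "\<sigma> (\<tau> z) = z" if "z \<in> W" for z
      using that \<tau>p in_chart_at[OF d] by (auto simp: W_def \<sigma>_def)
    have "dd (\<lambda>z. \<sigma> (\<tau> z)) x z = x" for x
    proof -
      have "dd (\<lambda>z. \<sigma> (\<tau> z)) x z = dd (\<lambda>z. z) x z"
        using frechet_derivative_cong_open[OF W z, of "\<lambda>z. \<sigma> (\<tau> z)" "\<lambda>z. z"] \<sigma>\<tau> by simp
      then show ?thesis by simp
    qed
    then have "x = frechet_derivative \<sigma> (at (\<tau> z)) (dd \<tau> x z)" for x
      using dd_compose[OF sm z tW s\<sigma>] by simp
    then show "u = v" using uv by metis
  qed
qed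

lemma patch_transition:
  assumes c: "is_chart c" and d: "is_chart d" and cd: "smooth_transition c d" and dc: "smooth_transition d c"
    and p: "patch (in_chart d \<psi>) (in_chart d n) (chart_image d)"
  shows "patch (in_chart c \<psi>) (in_chart c n) (snd c ` (fst c \<inter> fst d))"
    and "\<And>q u v. q \<in> fst c \<Longrightarrow> q \<in> fst d \<Longrightarrow>
      sform (in_chart c \<psi>) (in_chart c n) (snd c q) u v = sform (in_chart d \<psi>) (in_chart d n) (snd d q)
        (dd (in_chart c (snd d)) u (snd c q)) (dd (in_chart c (snd d)) v (snd c q))"
    and "\<And>q. q \<in> fst c \<Longrightarrow> q \<in> fst d \<Longrightarrow>
      curv (in_chart c \<psi>) (in_chart c n) (snd c q) = curv (in_chart d \<psi>) (in_chart d n) (snd d q)"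
proof -
  interpret patch "in_chart d \<psi>" "in_chart d n" "chart_image d" by (rule p)
  note t = transition[OF c d cd dc]
  note r = reparam[OF t(1-4) t(5) t(5)]
  show "patch (in_chart c \<psi>) (in_chart c n) (snd c ` (fst c \<inter> fst d))" by (rule r(1))
  fix q u v assume q: "q \<in> fst c" "q \<in> fst d"
  have W: "snd c q \<in> snd c ` (fst c \<inter> fst d)" using q by blast
  have \<tau>q: "in_chart c (snd d) (snd c q) = snd d q" by (rule in_chart_at[OF c q(1)])
  show "sform (in_chart c \<psi>) (in_chart c n) (snd c q) u v = sform (in_chart d \<psi>) (in_chart d n) (snd d q)
        (dd (in_chart c (snd d)) u (snd c q)) (dd (in_chart c (snd d)) v (snd c q))"
    unfolding \<tau>q[symmetric] by (rule r(2)) (use W in auto)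
  show "curv (in_chart c \<psi>) (in_chart c n) (snd c q) = curv (in_chart d \<psi>) (in_chart d n) (snd d q)"
    unfolding \<tau>q[symmetric] by (rule r(3)) (use W in auto)
qed

section \<open>Immersed surfaces\<close>

locale convex_surface =
  fixes A :: "'a::{t2_space,second_countable_topology} chart set" and \<psi> :: "'a \<Rightarrow> quat"
  assumes surface: "smooth_surface A" and immersion: "immersion_S3 A \<psi>"
    and positive: "\<And>p. extrinsic_curvature A \<psi> p > 0"
begin

abbreviation chart_patch :: "'a chart \<Rightarrow> ('a \<Rightarrow> quat) \<Rightarrow> complex set \<Rightarrow> bool" where
  "chart_patch c n V \<equiv> patch (in_chart c \<psi>) (in_chart c n) V"

lemma atlas: "c \<in> A \<Longrightarrow> is_chart c" "c \<in> A \<Longrightarrow> d \<in> A \<Longrightarrow> smooth_transition c d"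
  using surface by (simp_all add: smooth_surface_def)

lemma covered: "\<exists>c\<in>A. p \<in> fst c"
  using surface unfolding smooth_surface_def by blast

lemma norm_\<psi>: "norm (\<psi> p) = 1"
  using immersion by (auto simp: immersion_S3_def S3_def image_subset_iff)

lemma unit_normal_iff_patch:
  assumes c: "c \<in> A"
  shows "unit_normal_on c \<psi> n \<longleftrightarrow> chart_patch c n (chart_image c)"
  unfolding unit_normal_on_def patch_def
  using immersion c chart_facts(2)[OF atlas(1)[OF c]] norm_\<psi> by (auto simp: immersion_S3_def in_chart_def)

lemma exists_unit_normal:
  assumes c: "c \<in> A"
  obtains n where "chart_patch c n (chart_image c)"
proof -
  note ch = chart_facts[OF atlas(1)[OF c]]
  obtain \<nu> where nu: "patch (in_chart c \<psi>) \<nu> (chart_image c)"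
    by (rule unit_normal_exists[of "chart_image c" "in_chart c \<psi>"])
      (use immersion c ch norm_\<psi> in \<open>auto simp: immersion_S3_def in_chart_def\<close>)
  have "chart_patch c (\<lambda>p. \<nu> (snd c p)) (chart_image c)"
    by (rule patch_cong[OF nu]) (simp_all add: in_chart_def ch(8))
  then show ?thesis using that by blast
qed

text \<open>The normal of the second chart is carried to the first by the transition map; there the
  two normals differ at most by a sign.\<close>

lemma curv_well_defined:
  assumes c: "c \<in> A" "chart_patch c n (chart_image c)" "p \<in> fst c"
    and d: "d \<in> A" "chart_patch d n' (chart_image d)" "p \<in> fst d"
  shows "curv (in_chart c \<psi>) (in_chart c n) (snd c p) = curv (in_chart d \<psi>) (in_chart d n') (snd d p)"
proof -
  note t = patch_transition[OF atlas(1)[OF c(1)] atlas(1)[OF d(1)] atlas(2)[OF c(1) d(1)] atlas(2)[OF d(1) c(1)] d(2)]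
  interpret C: patch "in_chart c \<psi>" "in_chart c n" "chart_image c" by (rule c(2))
  have "snd c p \<in> chart_image c" "snd c p \<in> snd c ` (fst c \<inter> fst d)"
    using c(3) d(3) by (auto simp: chart_image_def)
  then have "curv (in_chart c \<psi>) (in_chart c n') (snd c p) = curv (in_chart c \<psi>) (in_chart c n) (snd c p)"
    using C.other_normal[OF t(1)] by metis
  then show ?thesis using t(3)[OF c(3) d(3)] by simp
qed

lemma extrinsic_curvature_eq:
  assumes c: "c \<in> A" "chart_patch c n (chart_image c)" "p \<in> fst c"
  shows "extrinsic_curvature A \<psi> p = curv (in_chart c \<psi>) (in_chart c n) (snd c p)"
proof -
  have s: "plane_det (shape_operator d \<psi> n' (snd d p)) = curv (in_chart d \<psi>) (in_chart d n') (snd d p)"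
    if "chart_patch d n' (chart_image d)" "p \<in> fst d" for d n'
  proof -
    have "snd d p \<in> chart_image d" using that(2) by (simp add: chart_image_def)
    from patch.shape_det[OF that(1) this] show ?thesis by (simp add: shape_operator_def[abs_def])
  qed
  show ?thesis
    unfolding extrinsic_curvature_def
  proof (rule the_equality)
    show "\<exists>d\<in>A. \<exists>n'. p \<in> fst d \<and> unit_normal_on d \<psi> n' \<and>
        curv (in_chart c \<psi>) (in_chart c n) (snd c p) = plane_det (shape_operator d \<psi> n' (snd d p))"
      using c s[OF c(2,3)] unit_normal_iff_patch by metis
    fix k assume "\<exists>d\<in>A. \<exists>n'. p \<in> fst d \<and> unit_normal_on d \<psi> n' \<and> k = plane_det (shape_operator d \<psi> n' (snd d p))"
    then obtain d n' where d: "d \<in> A" "p \<in> fst d" "unit_normal_on d \<psi> n'" "k = plane_det (shape_operator d \<psi> n' (snd d p))"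
      by blast
    have p: "chart_patch d n' (chart_image d)" using d unit_normal_iff_patch by blast
    show "k = curv (in_chart c \<psi>) (in_chart c n) (snd c p)"
      using d(4) s[OF p d(2)] curv_well_defined[OF c d(1) p d(2)] by simp
  qed
qed

definition pos_normal :: "'a chart \<Rightarrow> ('a \<Rightarrow> quat) \<Rightarrow> bool" where
  "pos_normal c n \<longleftrightarrow> chart_patch c n (chart_image c) \<and>
     (\<forall>z\<in>chart_image c. patch.posdef (in_chart c \<psi>) (in_chart c n) z)"

lemma exists_pos_normal:
  assumes c: "c \<in> A"
  obtains n where "pos_normal c n"
proof -
  note ch = chart_facts[OF atlas(1)[OF c]]
  obtain n where n: "chart_patch c n (chart_image c)" using exists_unit_normal[OF c] by blast
  interpret patch "in_chart c \<psi>" "in_chart c n" "chart_image c" by (rule n)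
  have "curv (in_chart c \<psi>) (in_chart c n) z > 0" if z: "z \<in> chart_image c" for z
    using extrinsic_curvature_eq[OF c n ch(7)[OF z]] positive ch(8)[OF z] by metis
  then obtain \<nu> where nu: "patch (in_chart c \<psi>) \<nu> (chart_image c)"
    "\<And>z. z \<in> chart_image c \<Longrightarrow> patch.posdef (in_chart c \<psi>) \<nu> z"
    using positive_patch by blast
  let ?n = "\<lambda>p. \<nu> (snd c p)"
  have eq: "in_chart c ?n z = \<nu> z" if "z \<in> chart_image c" for z by (simp add: in_chart_def ch(8)[OF that])
  have p: "chart_patch c ?n (chart_image c)" by (rule patch_cong[OF nu(1)]) (simp_all add: eq)
  interpret N: patch "in_chart c \<psi>" \<nu> "chart_image c" by (rule nu(1))
  interpret N': patch "in_chart c \<psi>" "in_chart c ?n" "chart_image c" by (rule p)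
  have "N'.posdef z" if z: "z \<in> chart_image c" for z
    using nu(2)[OF z] by (simp add: N.posdef_def N'.posdef_def N.sform_normal[OF z] N'.sform_normal[OF z] eq[OF z])
  then have "pos_normal c ?n" using p by (simp add: pos_normal_def)
  then show ?thesis using that by blast
qed

lemma posdef_transition:
  assumes c: "is_chart c" and d: "is_chart d" and cd: "smooth_transition c d" and dc: "smooth_transition d c"
    and n: "pos_normal d n" and p: "p \<in> fst c" "p \<in> fst d"
  shows "patch.posdef (in_chart c \<psi>) (in_chart c n) (snd c p)"
proof -
  have nd: "chart_patch d n (chart_image d)" using n by (simp add: pos_normal_def)
  note t = patch_transition[OF c d cd dc nd]
  interpret C: patch "in_chart c \<psi>" "in_chart c n" "snd c ` (fst c \<inter> fst d)" by (rule t(1))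
  interpret E: patch "in_chart d \<psi>" "in_chart d n" "chart_image d" by (rule nd)
  have W: "snd c p \<in> snd c ` (fst c \<inter> fst d)" using p by blast
  have "E.posdef (snd d p)" using n p by (auto simp: pos_normal_def chart_image_def)
  moreover have "dd (in_chart c (snd d)) v (snd c p) \<noteq> 0" if "v \<noteq> 0" for v
  proof
    have lin: "linear (frechet_derivative (in_chart c (snd d)) (at (snd c p)))"
      by (rule has_derivative_linear[OF smooth_on_has_derivative[OF transition(2)[OF c d cd dc] W]])
    assume "dd (in_chart c (snd d)) v (snd c p) = 0"
    then have "dd (in_chart c (snd d)) v (snd c p) = dd (in_chart c (snd d)) 0 (snd c p)"
      by (simp add: linear_0[OF lin])
    then show False using injD[OF transition(4)[OF c d cd dc W]] that by blast
  qed
  ultimately show ?thesis unfolding C.posdef_def E.posdef_def t(2)[OF p] by blast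
qed

lemma pos_normal_unique:
  assumes c: "c \<in> A" "pos_normal c n" "p \<in> fst c" and d: "d \<in> A" "pos_normal d n'" "p \<in> fst d"
  shows "n p = n' p"
proof -
  have nd: "chart_patch d n' (chart_image d)" and nc: "chart_patch c n (chart_image c)"
    using c d by (simp_all add: pos_normal_def)
  note at = atlas(1)[OF c(1)] atlas(1)[OF d(1)] atlas(2)[OF c(1) d(1)] atlas(2)[OF d(1) c(1)]
  interpret C: patch "in_chart c \<psi>" "in_chart c n" "chart_image c" by (rule nc)
  have z: "snd c p \<in> chart_image c" "snd c p \<in> snd c ` (fst c \<inter> fst d)"
    using c(3) d(3) by (auto simp: chart_image_def)
  have "in_chart c n' (snd c p) = in_chart c n (snd c p)"
    by (rule C.positive_normal_unique[OF patch_transition(1)[OF at nd] z _ posdef_transition[OF at d(2) c(3) d(3)]])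
      (use c z in \<open>simp add: pos_normal_def\<close>)
  then show ?thesis using in_chart_at[OF at(1) c(3)] by metis
qed

definition N :: "'a \<Rightarrow> quat" where
  "N = positive_normal A \<psi>"

lemma pos_normal_iff:
  assumes c: "c \<in> A"
  shows "pos_normal c n \<longleftrightarrow> unit_normal_on c \<psi> n \<and> (\<forall>z\<in>chart_image c. \<forall>v. v \<noteq> 0 \<longrightarrow> second_form c \<psi> n z v v > 0)"
proof -
  have "patch.posdef (in_chart c \<psi>) (in_chart c n) z \<longleftrightarrow> (\<forall>v. v \<noteq> 0 \<longrightarrow> second_form c \<psi> n z v v > 0)"
    if "chart_patch c n (chart_image c)" for z
    using patch.posdef_def[OF that] by (simp add: second_form_def sform_def)
  then show ?thesis unfolding pos_normal_def unit_normal_iff_patch[OF c] by blast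
qed

text \<open>Positive normals of different charts agree where both are defined, so they glue to one
  global field; the same uniqueness identifies this field with the value of
  \<open>THE\<close>.\<close>

lemma pos_normal_N:
  assumes c: "c \<in> A"
  shows "pos_normal c N"
proof -
  have "\<forall>c\<in>A. \<exists>n. pos_normal c n" using exists_pos_normal by blast
  then obtain \<nu> where nu: "\<And>c. c \<in> A \<Longrightarrow> pos_normal c (\<nu> c)" using bchoice[of A pos_normal] by blast
  \<comment> \<open>An arbitrary chart is selected at each point; \<open>M\<close> shows that the
    selection does not affect the value.\<close>
  obtain ch where ch: "\<And>p. ch p \<in> A" "\<And>p. p \<in> fst (ch p)" using covered by metis
  define M where "M = (\<lambda>p. \<nu> (ch p) p)"
  have M: "M p = \<nu> d p" if "d \<in> A" "p \<in> fst d" for d p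
    unfolding M_def by (rule pos_normal_unique[OF ch(1) nu[OF ch(1)] ch(2) that(1) nu[OF that(1)] that(2)])
  have gM: "pos_normal d M" if d: "d \<in> A" for d
  proof -
    note cf = chart_facts[OF atlas(1)[OF d]]
    have eq: "in_chart d (\<nu> d) z = in_chart d M z" if "z \<in> chart_image d" for z
      using M[OF d cf(7)[OF that]] by (simp add: in_chart_def)
    have pn: "chart_patch d (\<nu> d) (chart_image d)" using nu[OF d] by (simp add: pos_normal_def)
    have p: "chart_patch d M (chart_image d)" by (rule patch_cong[OF pn]) (simp_all add: eq)
    interpret P: patch "in_chart d \<psi>" "in_chart d (\<nu> d)" "chart_image d" by (rule pn)
    interpret P': patch "in_chart d \<psi>" "in_chart d M" "chart_image d" by (rule p)
    have "P'.posdef z" if z: "z \<in> chart_image d" for z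
    proof -
      have "P.posdef z" using nu[OF d] z by (simp add: pos_normal_def)
      then show ?thesis by (simp add: P.posdef_def P'.posdef_def P.sform_normal[OF z] P'.sform_normal[OF z] eq[OF z])
    qed
    then show ?thesis using p by (simp add: pos_normal_def)
  qed
  have "N = M"
    unfolding N_def positive_normal_def
  proof (rule the_equality)
    show "\<forall>c\<in>A. unit_normal_on c \<psi> M \<and> (\<forall>z\<in>chart_image c. \<forall>v. v \<noteq> 0 \<longrightarrow> second_form c \<psi> M z v v > 0)"
      using gM pos_normal_iff by blast
    fix n assume "\<forall>c\<in>A. unit_normal_on c \<psi> n \<and> (\<forall>z\<in>chart_image c. \<forall>v. v \<noteq> 0 \<longrightarrow> second_form c \<psi> n z v v > 0)"
    then have "pos_normal c n" if "c \<in> A" for c using pos_normal_iff[OF that] that by blast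
    then show "n = M" using pos_normal_unique[OF ch(1) _ ch(2) ch(1) gM[OF ch(1)] ch(2)] ch(1) by blast
  qed
  then show ?thesis using gM[OF c] by simp
qed

lemma patch_N: "c \<in> A \<Longrightarrow> chart_patch c N (chart_image c)"
  using pos_normal_N by (simp add: pos_normal_def)

text \<open>A conformal chart need not belong to A, so the normal and the curvature are imported
  near each of its points from a chart of A.\<close>

lemma compatible_patch:
  assumes c: "compatible_chart A c"
  shows "chart_patch c N (chart_image c)"
    and "\<And>z. z \<in> chart_image c \<Longrightarrow>
      curv (in_chart c \<psi>) (in_chart c N) z = extrinsic_curvature A \<psi> (inv_into (fst c) (snd c) z)"
proof -
  have ic: "is_chart c" using c by (simp add: compatible_chart_def)
  note cf = chart_facts[OF ic]
  have tr: "smooth_transition c d" "smooth_transition d c" if "d \<in> A" for d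
    using c that by (simp_all add: compatible_chart_def)
  show "chart_patch c N (chart_image c)"
  proof (rule patch_local[OF cf(2)])
    fix z assume z: "z \<in> chart_image c"
    obtain d where d: "d \<in> A" "inv_into (fst c) (snd c) z \<in> fst d" using covered by blast
    have zW: "z \<in> snd c ` (fst c \<inter> fst d)" using cf(7,8)[OF z] d(2) by (metis IntI imageI)
    show "\<exists>W. z \<in> W \<and> chart_patch c N W"
      by (rule exI, rule conjI[OF zW patch_transition(1)[OF ic atlas(1)[OF d(1)] tr[OF d(1)] patch_N[OF d(1)]]])
  qed
  fix z assume z: "z \<in> chart_image c"
  obtain d where d: "d \<in> A" "inv_into (fst c) (snd c) z \<in> fst d" using covered by blast
  show "curv (in_chart c \<psi>) (in_chart c N) z = extrinsic_curvature A \<psi> (inv_into (fst c) (snd c) z)"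
    using patch_transition(3)[OF ic atlas(1)[OF d(1)] tr[OF d(1)] patch_N[OF d(1)] cf(7)[OF z] d(2)]
      extrinsic_curvature_eq[OF d(1) patch_N[OF d(1)] d(2)] cf(8)[OF z] by simp
qed

text \<open>The factor is given only pointwise in \<open>conformal_charts\<close>; evaluating the
  second form at u = v = 1 produces it as a function.\<close>

lemma conformal_chart_patch:
  assumes c: "c \<in> conformal_charts A \<psi> N"
  shows "conformal_patch (in_chart c \<psi>) (in_chart c N) (chart_image c)
    (\<lambda>z. sform (in_chart c \<psi>) (in_chart c N) z 1 1)"
proof -
  have cc: "compatible_chart A c" using c by (simp add: conformal_charts_def)
  interpret patch "in_chart c \<psi>" "in_chart c N" "chart_image c" by (rule compatible_patch(1)[OF cc])
  have sf: "sform (in_chart c \<psi>) (in_chart c N) z u v = second_form c \<psi> N z u v" for z u v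
    by (simp add: sform_def second_form_def)
  show ?thesis
  proof
    fix z u v assume z: "z \<in> chart_image c"
    obtain \<rho> where r: "\<rho> > 0" "\<And>u v. second_form c \<psi> N z u v = \<rho> * (u \<bullet> v)"
      using c z unfolding conformal_charts_def by blast
    show "sform (in_chart c \<psi>) (in_chart c N) z 1 1 > 0"
      "sform (in_chart c \<psi>) (in_chart c N) z u v = sform (in_chart c \<psi>) (in_chart c N) z 1 1 * (u \<bullet> v)"
      using r by (simp_all add: sf)
  qed
qed

text \<open>A chart of A, restricted and followed by a diffeomorphism w with inverse g, belongs to
  the maximal atlas. This turns the isothermal map into a chart.\<close>

lemma compatible_chart_restrict:
  assumes c: "c \<in> A" and U: "open U" "U \<subseteq> chart_image c"
    and w: "homeomorphism U V w g" "open V" "smooth_on U w" "smooth_on V g"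
  defines "S \<equiv> {q \<in> fst c. snd c q \<in> U}"
  shows "compatible_chart A (S, w \<circ> snd c)" "chart_image (S, w \<circ> snd c) = V"
    and "\<And>(f :: 'a \<Rightarrow> 'b) y. y \<in> V \<Longrightarrow> in_chart (S, w \<circ> snd c) f y = in_chart c f (g y)"
proof -
  have ic: "is_chart c" by (rule atlas(1)[OF c])
  note cf = chart_facts[OF ic]
  let ?c = "(S, w \<circ> snd c)" and ?\<sigma> = "inv_into (fst c) (snd c)"
  have SU: "snd c ` S = U"
  proof
    show "U \<subseteq> snd c ` S"
    proof
      fix z assume "z \<in> U"
      then have "z \<in> chart_image c" using U by blast
      then have "?\<sigma> z \<in> S" "snd c (?\<sigma> z) = z" using cf(7,8) \<open>z \<in> U\<close> by (simp_all add: S_def)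
      then show "z \<in> snd c ` S" by force
    qed
  qed (auto simp: S_def)
  have h1: "homeomorphism S U (snd c) ?\<sigma>"
    by (rule homeomorphism_of_subsets[of "fst c" "chart_image c" "snd c" ?\<sigma> S "{}" U])
      (use ic SU in \<open>auto simp: is_chart_def S_def\<close>)
  have h: "homeomorphism S V (w \<circ> snd c) (?\<sigma> \<circ> g)" by (rule homeomorphism_compose[OF h1 w(1)])
  show img: "chart_image ?c = V" using h by (simp add: chart_image_def homeomorphism_def)
  have inv: "inv_into S (w \<circ> snd c) y = ?\<sigma> (g y)" if y: "y \<in> V" for y
  proof (rule inv_into_f_eq)
    show "inj_on (w \<circ> snd c) S"
      by (rule inj_on_inverseI[of _ "?\<sigma> \<circ> g"]) (rule homeomorphism_apply1[OF h])
    have "(?\<sigma> \<circ> g) y \<in> S" using homeomorphism_image2[OF h] y by blast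
    then show "?\<sigma> (g y) \<in> S" by simp
    show "(w \<circ> snd c) (?\<sigma> (g y)) = y" using homeomorphism_apply2[OF h y] by simp
  qed
  show "in_chart ?c f y = in_chart c f (g y)" if "y \<in> V" for f :: "'a \<Rightarrow> 'b" and y
    by (simp add: in_chart_def inv[OF that, unfolded o_def] o_def)
  have "open (fst c \<inter> snd c -` U)" by (rule continuous_open_preimage[OF cf(3,1) U(1)])
  moreover have "fst c \<inter> snd c -` U = S" by (auto simp: S_def)
  ultimately have oS: "open S" by simp
  have "homeomorphism S V (w \<circ> snd c) (inv_into S (w \<circ> snd c))"
    by (rule homeomorphism_cong[OF h refl refl refl]) (simp add: inv)
  then have ic': "is_chart ?c"
    unfolding is_chart_def img using oS w(2) by simp
  have "smooth_transition ?c d \<and> smooth_transition d ?c" if d: "d \<in> A" for d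
  proof
    have id: "is_chart d" by (rule atlas(1)[OF d])
    note t = transition[OF ic id atlas(2)[OF c d] atlas(2)[OF d c]]
    let ?W = "snd ?c ` (fst ?c \<inter> fst d)"
    have W: "open ?W" by (rule open_chart_subimage[OF ic' chart_facts(1)[OF id]])
    have WV: "?W \<subseteq> V" using img by (auto simp: chart_image_def)
    have gW: "g y \<in> snd c ` (fst c \<inter> fst d)" if "y \<in> ?W" for y
    proof -
      obtain q where q: "q \<in> S" "q \<in> fst d" "y = w (snd c q)" using \<open>y \<in> ?W\<close> by auto
      have "g y = snd c q" using q(1) w(1) unfolding q(3) homeomorphism_def S_def by auto
      then show ?thesis using q by (auto simp: S_def)
    qed
    have "smooth_on ?W (\<lambda>y. in_chart c (snd d) (g y))"
      by (rule smooth_on_compose[OF W smooth_on_subset[OF w(4) WV] gW t(2)])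
    then show "smooth_transition ?c d"
      unfolding smooth_transition_def by (rule smooth_on_cong[OF W, rotated]) (use WV inv in \<open>auto simp: in_chart_def o_def\<close>)
    let ?W' = "snd d ` (fst d \<inter> fst ?c)"
    have W': "open ?W'" by (rule open_chart_subimage[OF id]) (use oS in simp)
    have sub: "?W' \<subseteq> snd d ` (fst d \<inter> fst c)" by (auto simp: S_def)
    have "smooth_on ?W' (\<lambda>y. w (in_chart d (snd c) y))"
    proof (rule smooth_on_compose[OF W' smooth_on_subset[OF _ sub] _ w(3)])
      show "smooth_on (snd d ` (fst d \<inter> fst c)) (in_chart d (snd c))"
        using atlas(2)[OF d c] by (simp add: smooth_transition_def)
      show "in_chart d (snd c) z \<in> U" if "z \<in> ?W'" for z
        using that in_chart_at[OF id, of _ "snd c"] by (auto simp: S_def)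
    qed
    then show "smooth_transition d ?c" by (simp add: smooth_transition_def in_chart_def o_def)
  qed
  then show "compatible_chart A ?c" using ic' by (simp add: compatible_chart_def)
qed

text \<open>The second form is \<rho> times the pullback of the Euclidean product under the
  isothermal map w, so in the coordinate w it is \<rho> times the Euclidean product itself.\<close>

lemma exists_conformal_chart: "\<exists>c\<in>conformal_charts A \<psi> N. p \<in> fst c"
proof -
  obtain c where c: "c \<in> A" "p \<in> fst c" using covered by blast
  have ic: "is_chart c" by (rule atlas(1)[OF c(1)])
  note cf = chart_facts[OF ic]
  interpret patch "in_chart c \<psi>" "in_chart c N" "chart_image c" by (rule patch_N[OF c(1)])
  let ?h = "sform (in_chart c \<psi>) (in_chart c N)"
  have pd: "posdef z" if "z \<in> chart_image c" for z using pos_normal_N[OF c(1)] that by (simp add: pos_normal_def)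
  have pos: "?h z v v > 0" if "z \<in> chart_image c" "v \<noteq> 0" for z v
    using pd[OF that(1)] that(2) by (simp add: posdef_def)
  have det: "?h z 1 1 * ?h z \<i> \<i> - (?h z 1 \<i>)\<^sup>2 > 0" if z: "z \<in> chart_image c" for z
  proof -
    have "curv (in_chart c \<psi>) (in_chart c N) z > 0"
      using extrinsic_curvature_eq[OF c(1) patch_N[OF c(1)] cf(7)[OF z]] positive cf(8)[OF z] by metis
    then show ?thesis using gram_det_pos[OF z]
      by (simp add: curv_def zero_less_divide_iff form_det_def sform_sym[OF z, of \<i> 1] power2_eq_square)
  qed
  define z0 where "z0 = snd c p"
  have z0: "z0 \<in> chart_image c" using cf(6)[OF c(2)] by (simp add: z0_def)
  obtain V and w :: "complex \<Rightarrow> complex" where V: "open V" "z0 \<in> V" "V \<subseteq> chart_image c" "smooth_on V w"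
    and iso: "\<And>z. z \<in> V \<Longrightarrow> \<exists>\<rho>>0. ?h z 1 1 = \<rho> * (dd w 1 z \<bullet> dd w 1 z) \<and> ?h z 1 \<i> = \<rho> * (dd w 1 z \<bullet> dd w \<i> z)
      \<and> ?h z \<i> \<i> = \<rho> * (dd w \<i> z \<bullet> dd w \<i> z)"
    using isothermal_map[OF cf(2) z0 smooth_sform smooth_sform smooth_sform pos pos det] by (metis complex_i_not_zero zero_neq_one)
  have dw: "(w has_derivative frechet_derivative w (at z)) (at z)" if "z \<in> V" for z
    by (rule smooth_on_has_derivative[OF V(4) that])
  have conf: "\<exists>\<rho>>0. \<forall>u v. ?h z u v = \<rho> * (dd w u z \<bullet> dd w v z)" if z: "z \<in> V" for z
  proof -
    have zc: "z \<in> chart_image c" using z V by blast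
    obtain \<rho> where r: "\<rho> > 0" "?h z 1 1 = \<rho> * (dd w 1 z \<bullet> dd w 1 z)" "?h z 1 \<i> = \<rho> * (dd w 1 z \<bullet> dd w \<i> z)"
      "?h z \<i> \<i> = \<rho> * (dd w \<i> z \<bullet> dd w \<i> z)" using iso[OF z] by blast
    have "?h z u v = \<rho> * (dd w u z \<bullet> dd w v z)" for u v
      unfolding sform_bilinear[OF zc, of u v] sform_sym[OF zc, of \<i> 1] r(2-4)
        dd_expand[OF dw[OF z], of u] dd_expand[OF dw[OF z], of v]
      by (simp only: inner_add_left inner_add_right inner_scaleR_left inner_scaleR_right inner_commute[of "dd w \<i> z" "dd w 1 z"])
        (simp add: algebra_simps)
    then show ?thesis using r(1) by blast
  qed
  \<comment> \<open>A vector killed by the derivative of w would be isotropic for the second form,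
    contradicting positivity.\<close>
  have injw: "inj (frechet_derivative w (at z0))"
  proof -
    have lin: "linear (frechet_derivative w (at z0))" by (rule has_derivative_linear[OF dw[OF V(2)]])
    have "v = 0" if "frechet_derivative w (at z0) v = 0" for v
    proof (rule ccontr)
      assume v: "v \<noteq> 0"
      obtain \<rho> where "?h z0 v v = \<rho> * (dd w v z0 \<bullet> dd w v z0)" using conf[OF V(2)] by blast
      then show False using pos[OF z0 v] that by simp
    qed
    then show ?thesis using linear_injective_0[OF lin] by blast
  qed
  obtain U V' g where U: "open U" "z0 \<in> U" "U \<subseteq> V" "open V'" "homeomorphism U V' w g" "smooth_on V' g"
    using smooth_local_inverse[OF V(1,2,4) injw] by blast
  define S where "S = {q \<in> fst c. snd c q \<in> U}"
  have Uc: "U \<subseteq> chart_image c" using U V by blast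
  note r = compatible_chart_restrict[OF c(1) U(1) Uc U(5,4) smooth_on_subset[OF V(4) U(3)] U(6), folded S_def]
  let ?c = "(S, w \<circ> snd c)"
  have gU: "g y \<in> U" "w (g y) = y" if "y \<in> V'" for y
    using U(5) that unfolding homeomorphism_def by auto
  have wg: "dd w (dd g u y) (g y) = u" if y: "y \<in> V'" for u y
  proof -
    have "dd (\<lambda>y. w (g y)) u y = dd (\<lambda>y. y) u y"
      using frechet_derivative_cong_open[OF U(4) y, of "\<lambda>y. w (g y)" "\<lambda>y. y"] gU(2) by simp
    then show ?thesis using dd_compose[OF U(6) y _ V(4), of u] gU(1)[OF y] U(3) by auto
  qed
  have injg: "inj (frechet_derivative g (at y))" if y: "y \<in> V'" for y
    by (rule inj_on_inverseI[of _ "frechet_derivative w (at (g y))"]) (simp add: wg[OF y])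
  have gc: "g y \<in> chart_image c" if "y \<in> V'" for y using gU(1)[OF that] Uc by blast
  have "\<exists>\<rho>>0. \<forall>u v. second_form ?c \<psi> N y u v = \<rho> * (u \<bullet> v)" if y: "y \<in> V'" for y
  proof -
    have gV: "g y \<in> V" using gU(1)[OF y] U(3) by blast
    obtain \<rho> where \<rho>: "\<rho> > 0" "\<And>u v. ?h (g y) u v = \<rho> * (dd w u (g y) \<bullet> dd w v (g y))"
      using conf[OF gV] by blast
    have "second_form ?c \<psi> N y u v = \<rho> * (u \<bullet> v)" for u v
    proof -
      have "second_form ?c \<psi> N y u v = sform (in_chart ?c \<psi>) (in_chart ?c N) y u v"
        by (simp add: sform_def second_form_def)
      also have "\<dots> = ?h (g y) (dd g u y) (dd g v y)"
        by (rule reparam(2)[OF U(4,6) gc injg r(3) r(3)]) (use y in auto)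
      also have "\<dots> = \<rho> * (u \<bullet> v)" unfolding \<rho>(2) wg[OF y] ..
      finally show ?thesis .
    qed
    then show ?thesis using \<rho>(1) by blast
  qed
  then have "?c \<in> conformal_charts A \<psi> N" using r(1,2) by (simp add: conformal_charts_def)
  moreover have "p \<in> fst ?c" using c(2) U(2) by (simp add: S_def z0_def)
  ultimately show ?thesis by blast
qed

lemma harmonic_iff_critical:
  assumes frame: "imaginary_frame e1 e2 e3"
  shows "harmonic_to_sphere (conformal_charts A \<psi> N) (gauss_map e1 e2 e3 \<psi> N) \<longleftrightarrow>
    (\<forall>c\<in>conformal_charts A \<psi> N. \<forall>z\<in>chart_image c.
      dd (curv (in_chart c \<psi>) (in_chart c N)) 1 z = 0 \<and> dd (curv (in_chart c \<psi>) (in_chart c N)) \<i> z = 0)"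
  unfolding harmonic_to_sphere_def
proof (intro ball_cong refl)
  fix c assume c: "c \<in> conformal_charts A \<psi> N"
  interpret gauss_patch "in_chart c \<psi>" "in_chart c N" "chart_image c"
    "\<lambda>z. sform (in_chart c \<psi>) (in_chart c N) z 1 1" e1 e2 e3
    by (intro gauss_patch.intro conformal_chart_patch[OF c] frame)
  show "(\<forall>s\<in>{id, sphere_inversion}.
      let D = {z \<in> chart_image c. s (in_chart c (gauss_map e1 e2 e3 \<psi> N) z) \<noteq> None};
          f = (\<lambda>z. the (s (in_chart c (gauss_map e1 e2 e3 \<psi> N) z)))
      in open D \<and> smooth_on D f \<and> (\<forall>z\<in>D. harmonic_equation f z)) \<longleftrightarrow>
    (\<forall>z\<in>chart_image c. dd (curv (in_chart c \<psi>) (in_chart c N)) 1 z = 0 \<and>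
      dd (curv (in_chart c \<psi>) (in_chart c N)) \<i> z = 0)"
    by (rule harmonic_patch_iff)
      (simp only: gauss_comp_def, simp add: in_chart_def gauss_map_def left_field_def Let_def)
qed

text \<open>Near any point a conformal chart with vanishing derivative makes the curvature constant,
  and connectedness of the surface makes the local constants agree.\<close>

lemma constant_iff_critical:
  "(\<exists>k>0. \<forall>p. extrinsic_curvature A \<psi> p = k) \<longleftrightarrow>
    (\<forall>c\<in>conformal_charts A \<psi> N. \<forall>z\<in>chart_image c.
      dd (curv (in_chart c \<psi>) (in_chart c N)) 1 z = 0 \<and> dd (curv (in_chart c \<psi>) (in_chart c N)) \<i> z = 0)"
proof
  assume "\<exists>k>0. \<forall>p. extrinsic_curvature A \<psi> p = k"
  then obtain k where k: "\<And>p. extrinsic_curvature A \<psi> p = k" by blast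
  show "\<forall>c\<in>conformal_charts A \<psi> N. \<forall>z\<in>chart_image c.
      dd (curv (in_chart c \<psi>) (in_chart c N)) 1 z = 0 \<and> dd (curv (in_chart c \<psi>) (in_chart c N)) \<i> z = 0"
  proof (intro ballI)
    fix c z assume c: "c \<in> conformal_charts A \<psi> N" and z: "z \<in> chart_image c"
    have cc: "compatible_chart A c" using c by (simp add: conformal_charts_def)
    interpret patch "in_chart c \<psi>" "in_chart c N" "chart_image c" by (rule compatible_patch(1)[OF cc])
    have "curv (in_chart c \<psi>) (in_chart c N) y = k" if "y \<in> chart_image c" for y
      using compatible_patch(2)[OF cc that] k by simp
    then show "dd (curv (in_chart c \<psi>) (in_chart c N)) 1 z = 0 \<and> dd (curv (in_chart c \<psi>) (in_chart c N)) \<i> z = 0"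
      using dd_locally_const[OF _ z] by blast
  qed
next
  assume crit: "\<forall>c\<in>conformal_charts A \<psi> N. \<forall>z\<in>chart_image c.
      dd (curv (in_chart c \<psi>) (in_chart c N)) 1 z = 0 \<and> dd (curv (in_chart c \<psi>) (in_chart c N)) \<i> z = 0"
  let ?K = "extrinsic_curvature A \<psi>"
  have loc: "\<exists>S. open S \<and> p \<in> S \<and> (\<forall>q\<in>S. ?K p = ?K q)" for p
  proof -
    obtain c where c: "c \<in> conformal_charts A \<psi> N" "p \<in> fst c" using exists_conformal_chart by blast
    have cc: "compatible_chart A c" using c by (simp add: conformal_charts_def)
    have ic: "is_chart c" using cc by (simp add: compatible_chart_def)
    note cf = chart_facts[OF ic]
    let ?k = "curv (in_chart c \<psi>) (in_chart c N)"
    interpret conformal_patch "in_chart c \<psi>" "in_chart c N" "chart_image c"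
      "\<lambda>z. sform (in_chart c \<psi>) (in_chart c N) z 1 1" by (rule conformal_chart_patch[OF c(1)])
    obtain r where r: "r > 0" "ball (snd c p) r \<subseteq> chart_image c"
      using cf(2) cf(6)[OF c(2)] openE by blast
    have D: "(?k has_derivative (\<lambda>_. 0)) (at z)" if z: "z \<in> chart_image c" for z
    proof -
      have "?k differentiable (at z)"
      proof -
        have "smooth_on (chart_image c) (\<lambda>z. form_det (sform (in_chart c \<psi>) (in_chart c N) z) / gdet z)"
          unfolding form_det_def
          by (intro smooth_on_divide[OF open_V] smooth_on_diff[OF open_V] smooth_on_mult[OF open_V] smooth_sform smooth_gdet)
            (use gdet_pos in force)
        then show ?thesis
          using smooth_on_has_derivative[OF _ z] unfolding curv_def[abs_def] gdet_def differentiable_def by blast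
      qed
      then have d: "(?k has_derivative frechet_derivative ?k (at z)) (at z)" by (simp add: frechet_derivative_works)
      have "frechet_derivative ?k (at z) = (\<lambda>_. 0)"
        using dd_expand[OF d] crit c(1) z by (simp add: fun_eq_iff)
      then show ?thesis using d by simp
    qed
    have const: "?k z = ?k (snd c p)" if "z \<in> ball (snd c p) r" for z
      by (rule has_derivative_zero_unique[OF convex_ball has_derivative_at_withinI[OF D] that])
        (use r in auto)
    let ?S = "fst c \<inter> snd c -` ball (snd c p) r"
    have "open ?S" by (rule continuous_open_preimage[OF cf(3,1) open_ball])
    moreover have "?K q = ?k (snd c q)" if "q \<in> fst c" for q
      using compatible_patch(2)[OF cc cf(6)[OF that]] cf(5)[OF that] by simp
    then have "\<forall>q\<in>?S. ?K p = ?K q" using const c(2) by simp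
    moreover have "p \<in> ?S" using c(2) r(1) by simp
    ultimately show ?thesis by blast
  qed
  have con: "connected (UNIV :: 'a set)" using surface by (simp add: smooth_surface_def)
  have "?K p = ?K q" for p q
  proof (rule connected_local_const[OF con UNIV_I UNIV_I])
    show "\<forall>a\<in>UNIV. \<forall>\<^sub>F b in at a. ?K a = ?K b"
    proof
      fix a
      obtain S where "open S" "a \<in> S" "\<forall>q\<in>S. ?K a = ?K q" using loc by blast
      then show "\<forall>\<^sub>F b in at a. ?K a = ?K b" unfolding eventually_at_topological by blast
    qed
  qed
  then show "\<exists>k>0. \<forall>p. ?K p = k" using positive by blast
qed

end

text \<open>The frame conditions are read off at the identity, where \<open>left_field e\<close> has
  the value e.\<close>

lemma imaginary_frame_of_left_invariant:
  assumes "left_invariant_frame e1 e2 e3"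
  shows "imaginary_frame e1 e2 e3"
proof -
  have q: "qone \<in> S3" by (simp add: S3_def qone_def norm_Pair)
  have e: "left_field e qone = e" for e by (simp add: left_field_def)
  have "\<forall>q\<in>S3. norm (left_field e1 q) = 1 \<and> norm (left_field e2 q) = 1 \<and> norm (left_field e3 q) = 1 \<and>
      left_field e1 q \<bullet> left_field e2 q = 0 \<and> left_field e2 q \<bullet> left_field e3 q = 0 \<and>
      left_field e3 q \<bullet> left_field e1 q = 0"
    using assms by (simp add: left_invariant_frame_def Let_def)
  from bspec[OF this q] show ?thesis
    using assms by unfold_locales (simp_all add: e left_invariant_frame_def)
qed

theorem corollary3p8:
  fixes A :: "'a::{t2_space,second_countable_topology} chart set"
    and m :: "'a chart \<Rightarrow> complex \<Rightarrow> complex \<Rightarrow> complex \<Rightarrow> real"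
    and \<psi> :: "'a \<Rightarrow> quat"
    and e1 e2 e3 :: quat
  assumes frame: "left_invariant_frame e1 e2 e3"
    and surface: "smooth_surface A"
    and metric: "riemannian_metric A m"
    and immersion: "isometric_immersion_S3 A m \<psi>"
    and positive: "\<And>p. extrinsic_curvature A \<psi> p > 0"
  shows "(\<exists>k>0. \<forall>p. extrinsic_curvature A \<psi> p = k) \<longleftrightarrow>
         harmonic_to_sphere (conformal_charts A \<psi> (positive_normal A \<psi>))
           (gauss_map e1 e2 e3 \<psi> (positive_normal A \<psi>))"
proof -
  interpret convex_surface A \<psi>
    by unfold_locales (use surface immersion positive in \<open>simp_all add: isometric_immersion_S3_def\<close>)
  show ?thesis
    unfolding N_def[symmetric] constant_iff_critical
    by (rule harmonic_iff_critical[OF imaginary_frame_of_left_invariant[OF frame], symmetric])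
qed

end
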